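(* Let $p$ be a prime, $Q=\mathrm{Spf}\,\mathbb Z_p[[q-1]]$, and let $H_Q$ (with its $\mathbb Z_p^\times$-action) and $\sigma^*:H_Q\to(\hat{\mathbb G}_m)_Q$ be as in the context. The morphism $$\sigma^*:H_Q\to(\hat{\mathbb G}_m)_Q:=(\hat{\mathbb G}_m)_{\mathrm{Spf}\,\mathbb Z_p}\times Q$$ is $\mathbb Z_p^\times$-equivariant, assuming that $(\hat{\mathbb G}_m)_{\mathrm{Spf}\,\mathbb Z_p}$ is equipped with the following $\mathbb Z_p^\times$-action: $n\in\mathbb Z_p^\times$ acts as raising to the power of $n$.
   Context: Fix a prime $p$. $W$ is the ring scheme of $p$-typical Witt vectors; $[a]$ is the Teichmüller representative; $\Phi_p$ is the $p$-th cyclotomic polynomial. $Q:=\mathrm{Spf}\,\mathbb Z_p[[q-1]]$ with the $(p,q-1)$-adic topology. $\mathbb Z_p^\times$ acts on $Q$: $n\in\mathbb Z_p^\times$ acts by $q\mapsto q^n=\sum_{i\ge0}\frac{n(n-1)\cdots(n-i+1)}{i!}(q-1)^i$. $G_Q$ is the following flat affine commutative group scheme over $Q$: for any ring $A$ in which $p$ is nilpotent, $$G_Q(A)=\{(q,x)\mid q\in A^\times,\ q-1\text{ nilpotent},\ x\in W(A),\ 1+\Phi_p([q])x\in[A^\times]\},$$ with operation (over fixed $q$) $(x_1,x_2)\mapsto x_1+x_2+\Phi_p([q])x_1x_2$. $H_Q$ is the $1$-dimensional commutative formal group over $Q$ whose Cartier dual $\underline{\mathrm{Hom}}(H_Q,\mathbb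 G_m)$ is $G_Q$ (it exists). The section $\sigma:Q\to G_Q$ is $\sigma(q)=(q,[q]-1)$; by Cartier duality it gives a homomorphism $\sigma^*:H_Q\to(\hat{\mathbb G}_m)_Q$. $\mathbb Z_p^\times$-action on $H_Q$: The morphism $\pi:Q\to\Sigma=W_{\mathrm{prim}}/W^\times$ defined by $\Phi_p([q])$ factors through $Q/\mathbb Z_p^\times$, and $G_Q$, $H_Q$ are pullbacks via $\pi$ of groups over $\Sigma$, so they are $\mathbb Z_p^\times$-equivariant. (Here $W_{\mathrm{prim}}$ is the formal completion of $W$ along the locus $p=x_0=0$, $x_1\neq0$, and $u\in W^\times$ acts on it by $\xi\mapsto u^{-1}\xi$.) Explicitly, for $n\in\mathbb Z_p^\times$ there is a unique $u_n\in W(\mathbb Z_p[[q-1]])^\times$ with $\Phi_p([q^n])=u_n\Phi_p([q])$; $n$ acts on $G_Q$ by $(q,x)\mapsto(q^n,u_n^{-1}x)$, and $H_Q$ carries the corresponding dual action (so that the duality pairing between $G_Q$ and $H_Q$ is $\mathbb Z_p^\times$-invariant), lifting the action on $Q$. *)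

theory Defs
  imports "HOL-Algebra.Ring" "HOL-Library.Poly_Mapping" "HOL-Computational_Algebra.Primes"
begin

section \<open>Power series over a ring and their values at nilpotent elements\<close>

definition ps_ring :: "'a ring \<Rightarrow> (nat \<Rightarrow> 'a) ring" where
  "ps_ring A =
    \<lparr> carrier = {f. \<forall>i. f i \<in> carrier A},
      monoid.mult = (\<lambda>f g n. \<Oplus>\<^bsub>A\<^esub>i\<in>{..n}. f i \<otimes>\<^bsub>A\<^esub> g (n - i)),
      one = (\<lambda>n. if n = 0 then \<one>\<^bsub>A\<^esub> else \<zero>\<^bsub>A\<^esub>),
      zero = (\<lambda>n. \<zero>\<^bsub>A\<^esub>),
      add = (\<lambda>f g n. f n \<oplus>\<^bsub>A\<^esub> g n) \<rparr>"

definition nilpotents :: "'a ring \<Rightarrow> 'a set" where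
  "nilpotents A = {z \<in> carrier A. \<exists>N::nat. z [^]\<^bsub>A\<^esub> N = \<zero>\<^bsub>A\<^esub>}"

text \<open>For nilpotent \<open>z\<close> all omitted terms of the series vanish.\<close>

definition ps_eval :: "'a ring \<Rightarrow> (nat \<Rightarrow> 'a) \<Rightarrow> 'a \<Rightarrow> 'a" where
  "ps_eval A f z =
    (\<Oplus>\<^bsub>A\<^esub>i\<in>{..<(LEAST N::nat. z [^]\<^bsub>A\<^esub> N = \<zero>\<^bsub>A\<^esub>)}. f i \<otimes>\<^bsub>A\<^esub> z [^]\<^bsub>A\<^esub> i)"


section \<open>The \<open>p\<close>-adic integers\<close>

type_synonym padic = "nat \<Rightarrow> int"

text \<open>The inverse limit of the rings \<open>\<int>/p\<^sup>k\<close>; the component \<open>a k\<close> is the representative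
  of \<open>a\<close> modulo \<open>p\<^sup>k\<close> in \<open>{0..<p\<^sup>k}\<close>.\<close>

definition Zp :: "nat \<Rightarrow> padic ring" where
  "Zp p =
    \<lparr> carrier = {a. \<forall>k. a k \<in> {0..<int p ^ k} \<and> a (Suc k) mod int p ^ k = a k},
      monoid.mult = (\<lambda>a b k. (a k * b k) mod int p ^ k),
      one = (\<lambda>k. 1 mod int p ^ k),
      zero = (\<lambda>k. 0),
      add = (\<lambda>a b k. (a k + b k) mod int p ^ k) \<rparr>"

definition p_nilpotent_ring :: "nat \<Rightarrow> 'a ring \<Rightarrow> bool" where
  "p_nilpotent_ring p A \<longleftrightarrow> cring A \<and> (\<exists>m::nat. [(p ^ m)] \<cdot>\<^bsub>A\<^esub> \<one>\<^bsub>A\<^esub> = \<zero>\<^bsub>A\<^esub>)"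

text \<open>The unique ring homomorphism from the \<open>p\<close>-adic integers to a ring in which \<open>p\<close> is nilpotent.\<close>

definition padic_to :: "nat \<Rightarrow> 'a ring \<Rightarrow> padic \<Rightarrow> 'a" where
  "padic_to p A a = [(a (LEAST m::nat. [(p ^ m)] \<cdot>\<^bsub>A\<^esub> \<one>\<^bsub>A\<^esub> = \<zero>\<^bsub>A\<^esub>))] \<cdot>\<^bsub>A\<^esub> \<one>\<^bsub>A\<^esub>"

text \<open>The binomial coefficient \<open>n(n-1)\<dots>(n-i+1)/i!\<close>, an element of the torsion-free ring \<open>Zp p\<close>.\<close>

definition padic_binomial :: "nat \<Rightarrow> padic \<Rightarrow> nat \<Rightarrow> padic" where
  "padic_binomial p n i =
    (THE c. c \<in> carrier (Zp p) \<and>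
      [(fact i :: nat)] \<cdot>\<^bsub>Zp p\<^esub> c = (\<Otimes>\<^bsub>Zp p\<^esub>j\<in>{..<i}. n \<ominus>\<^bsub>Zp p\<^esub> [j] \<cdot>\<^bsub>Zp p\<^esub> \<one>\<^bsub>Zp p\<^esub>))"

text \<open>\<open>a\<^sup>n\<close> for \<open>n\<close> a \<open>p\<close>-adic integer and \<open>a\<close> with \<open>a - 1\<close> nilpotent.\<close>

definition padic_pow :: "nat \<Rightarrow> 'a ring \<Rightarrow> 'a \<Rightarrow> padic \<Rightarrow> 'a" where
  "padic_pow p A a n =
    ps_eval A (\<lambda>i. padic_to p A (padic_binomial p n i)) (a \<ominus>\<^bsub>A\<^esub> \<one>\<^bsub>A\<^esub>)"


section \<open>\<open>p\<close>-typical Witt vectors\<close>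

type_synonym 'v ipoly = "('v \<Rightarrow>\<^sub>0 nat) \<Rightarrow>\<^sub>0 int"

definition ipoly_var :: "'v \<Rightarrow> 'v ipoly" where
  "ipoly_var v = Poly_Mapping.single (Poly_Mapping.single v 1) 1"

definition ipoly_eval :: "'a ring \<Rightarrow> ('v \<Rightarrow> 'a) \<Rightarrow> 'v ipoly \<Rightarrow> 'a" where
  "ipoly_eval A f P =
    (\<Oplus>\<^bsub>A\<^esub>m\<in>Poly_Mapping.keys P.
      [(Poly_Mapping.lookup P m)] \<cdot>\<^bsub>A\<^esub>
        (\<Otimes>\<^bsub>A\<^esub>v\<in>Poly_Mapping.keys m. f v [^]\<^bsub>A\<^esub> Poly_Mapping.lookup m v))"

definition witt_ghost :: "nat \<Rightarrow> nat \<Rightarrow> (nat \<Rightarrow> 'b::comm_ring_1) \<Rightarrow> 'b" where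
  "witt_ghost p n X = (\<Sum>i\<le>n. of_nat (p ^ i) * X i ^ (p ^ (n - i)))"

text \<open>The universal polynomials for addition and multiplication of Witt vectors: the variables
  \<open>Inl i\<close> and \<open>Inr i\<close> are the \<open>i\<close>-th components of the two operands, and the
  polynomials are the unique ones compatible with the ghost components.\<close>

definition witt_add_poly :: "nat \<Rightarrow> nat \<Rightarrow> (nat + nat) ipoly" where
  "witt_add_poly p =
    (THE S. \<forall>n. witt_ghost p n S =
      witt_ghost p n (\<lambda>i. ipoly_var (Inl i)) + witt_ghost p n (\<lambda>i. ipoly_var (Inr i)))"

definition witt_mult_poly :: "nat \<Rightarrow> nat \<Rightarrow> (nat + nat) ipoly" where
  "witt_mult_poly p =
    (THE S. \<forall>n. witt_ghost p n S =
      witt_ghost p n (\<lambda>i. ipoly_var (Inl i)) * witt_ghost p n (\<lambda>i. ipoly_var (Inr i)))"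

definition witt :: "nat \<Rightarrow> 'a ring \<Rightarrow> (nat \<Rightarrow> 'a) ring" where
  "witt p A =
    \<lparr> carrier = {x. \<forall>i. x i \<in> carrier A},
      monoid.mult = (\<lambda>x y n. ipoly_eval A (case_sum x y) (witt_mult_poly p n)),
      one = (\<lambda>n. if n = 0 then \<one>\<^bsub>A\<^esub> else \<zero>\<^bsub>A\<^esub>),
      zero = (\<lambda>n. \<zero>\<^bsub>A\<^esub>),
      add = (\<lambda>x y n. ipoly_eval A (case_sum x y) (witt_add_poly p n)) \<rparr>"

definition teich :: "'a ring \<Rightarrow> 'a \<Rightarrow> (nat \<Rightarrow> 'a)" where
  "teich A a = (\<lambda>n. if n = 0 then a else \<zero>\<^bsub>A\<^esub>)"

text \<open>For prime \<open>p\<close>, the cyclotomic polynomial \<open>1 + X + \<dots> + X\<^sup>p\<^sup>-\<^sup>1\<close> at \<open>x\<close>.\<close>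

definition cyclotomic_p :: "nat \<Rightarrow> 'a ring \<Rightarrow> 'a \<Rightarrow> 'a" where
  "cyclotomic_p p A x = (\<Oplus>\<^bsub>A\<^esub>i\<in>{..<p}. x [^]\<^bsub>A\<^esub> i)"

definition Phi_q :: "nat \<Rightarrow> 'a ring \<Rightarrow> 'a \<Rightarrow> (nat \<Rightarrow> 'a)" where
  "Phi_q p A q = cyclotomic_p p (witt p A) (teich A q)"


section \<open>The formal scheme \<open>Q\<close>\<close>

text \<open>The ring of power series over the \<open>p\<close>-adic integers in the variable \<open>q - 1\<close>.\<close>

type_synonym zpq = "nat \<Rightarrow> padic"

definition Zpq :: "nat \<Rightarrow> zpq ring" where
  "Zpq p = ps_ring (Zp p)"

text \<open>(Formal) schemes are given by their points in the rings in which \<open>p\<close> is nilpotent. A point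
  of \<open>Q\<close> in such a ring \<open>A\<close> is a continuous homomorphism from \<open>Zpq p\<close> to the discrete ring \<open>A\<close>,
  that is, an element \<open>q\<close> with \<open>q - 1\<close> nilpotent; \<open>Zpq_to p A q\<close> is the homomorphism itself.\<close>

definition Q_points :: "'a ring \<Rightarrow> 'a set" where
  "Q_points A = {q \<in> Units A. q \<ominus>\<^bsub>A\<^esub> \<one>\<^bsub>A\<^esub> \<in> nilpotents A}"

definition Zpq_to :: "nat \<Rightarrow> 'a ring \<Rightarrow> 'a \<Rightarrow> zpq \<Rightarrow> 'a" where
  "Zpq_to p A q f = ps_eval A (\<lambda>i. padic_to p A (f i)) (q \<ominus>\<^bsub>A\<^esub> \<one>\<^bsub>A\<^esub>)"

definition q_gen :: "nat \<Rightarrow> zpq" where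
  "q_gen p = (\<lambda>i. if i \<le> 1 then \<one>\<^bsub>Zp p\<^esub> else \<zero>\<^bsub>Zp p\<^esub>)"

definition q_gen_pow :: "nat \<Rightarrow> padic \<Rightarrow> zpq" where
  "q_gen_pow p n = (\<lambda>i. padic_binomial p n i)"


section \<open>The group scheme \<open>G\<^sub>Q\<close>\<close>

definition G_points :: "nat \<Rightarrow> 'a ring \<Rightarrow> ('a \<times> (nat \<Rightarrow> 'a)) set" where
  "G_points p A =
    {(q, x). q \<in> Q_points A \<and> x \<in> carrier (witt p A) \<and>
      \<one>\<^bsub>witt p A\<^esub> \<oplus>\<^bsub>witt p A\<^esub> Phi_q p A q \<otimes>\<^bsub>witt p A\<^esub> x \<in> teich A ` Units A}"

definition G_fiber :: "nat \<Rightarrow> 'a ring \<Rightarrow> 'a \<Rightarrow> (nat \<Rightarrow> 'a) monoid" where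
  "G_fiber p A q =
    \<lparr> carrier = {x. (q, x) \<in> G_points p A},
      monoid.mult = (\<lambda>x y. (x \<oplus>\<^bsub>witt p A\<^esub> y) \<oplus>\<^bsub>witt p A\<^esub>
                Phi_q p A q \<otimes>\<^bsub>witt p A\<^esub> (x \<otimes>\<^bsub>witt p A\<^esub> y)),
      one = \<zero>\<^bsub>witt p A\<^esub> \<rparr>"

definition u_unit :: "nat \<Rightarrow> padic \<Rightarrow> (nat \<Rightarrow> zpq)" where
  "u_unit p n =
    (THE u. u \<in> Units (witt p (Zpq p)) \<and>
      Phi_q p (Zpq p) (q_gen_pow p n) = u \<otimes>\<^bsub>witt p (Zpq p)\<^esub> Phi_q p (Zpq p) (q_gen p))"

definition G_act :: "nat \<Rightarrow> padic \<Rightarrow> 'a ring \<Rightarrow> 'a \<times> (nat \<Rightarrow> 'a) \<Rightarrow> 'a \<times> (nat \<Rightarrow> 'a)" where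
  "G_act p n A = (\<lambda>(q, x).
    (padic_pow p A q n,
     (Zpq_to p A q \<circ> inv\<^bsub>witt p (Zpq p)\<^esub> (u_unit p n)) \<otimes>\<^bsub>witt p A\<^esub> x))"

definition sigma :: "nat \<Rightarrow> 'a ring \<Rightarrow> 'a \<Rightarrow> 'a \<times> (nat \<Rightarrow> 'a)" where
  "sigma p A q = (q, teich A q \<ominus>\<^bsub>witt p A\<^esub> \<one>\<^bsub>witt p A\<^esub>)"


section \<open>One-dimensional formal groups over \<open>Q\<close> and their Cartier duals\<close>

text \<open>The ring \<open>Zpq p\<close> is local, so the Lie algebra of a one-dimensional formal group over \<open>Q\<close> is
  free and the group is given by a power series \<open>F\<close> in two variables over \<open>Zpq p\<close>. Its points
  over a point \<open>q\<close> of \<open>Q\<close> are the nilpotent elements, with the operation obtained from \<open>F\<close> by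
  specialization at \<open>q\<close>.\<close>

type_synonym fglaw = "nat \<Rightarrow> nat \<Rightarrow> zpq"

definition H_points :: "'a ring \<Rightarrow> ('a \<times> 'a) set" where
  "H_points A = Q_points A \<times> nilpotents A"

definition H_fiber :: "nat \<Rightarrow> fglaw \<Rightarrow> 'a ring \<Rightarrow> 'a \<Rightarrow> 'a monoid" where
  "H_fiber p F A q =
    \<lparr> carrier = nilpotents A,
      monoid.mult = (\<lambda>x y. ps_eval A (\<lambda>i. ps_eval A (\<lambda>j. Zpq_to p A q (F i j)) y) x),
      one = \<zero>\<^bsub>A\<^esub> \<rparr>"

text \<open>Here and below the type \<open>'a\<close> is the universe of the test rings. As soon as it is infinite
  it contains copies of all finite rings, such as the quotients of \<open>Zpq p[x, y, z]\<close>
  by powers of the ideal \<open>(p, q - 1, x, y, z)\<close>, and the condition says that \<open>F\<close> satisfies the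
  identities of a commutative formal group law.\<close>

definition formal_group_Q :: "'a itself \<Rightarrow> nat \<Rightarrow> fglaw \<Rightarrow> bool" where
  "formal_group_Q _ p F \<longleftrightarrow>
    (\<forall>i j. F i j \<in> carrier (Zpq p)) \<and>
    (\<forall>(A :: 'a ring) q. p_nilpotent_ring p A \<and> q \<in> Q_points A \<longrightarrow> comm_group (H_fiber p F A q))"

text \<open>Homomorphisms from the base change of the formal group along \<open>q\<close> to the multiplicative
  group over \<open>A\<close>: a morphism of the underlying formal schemes is a power series over \<open>A\<close>, and it
  has to be multiplicative on points in all \<open>A\<close>-algebras \<open>B\<close>.\<close>

definition H_dual_fiber :: "nat \<Rightarrow> fglaw \<Rightarrow> 'a ring \<Rightarrow> 'a \<Rightarrow> (nat \<Rightarrow> 'a) monoid" where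
  "H_dual_fiber p F A q =
    \<lparr> carrier = {f \<in> carrier (ps_ring A).
        \<forall>(B :: 'a ring) \<phi>. p_nilpotent_ring p B \<and> \<phi> \<in> ring_hom A B \<longrightarrow>
          ps_eval B (\<phi> \<circ> f) \<in> hom (H_fiber p F B (\<phi> q)) (units_of B)},
      monoid.mult = (\<lambda>f g. f \<otimes>\<^bsub>ps_ring A\<^esub> g),
      one = \<one>\<^bsub>ps_ring A\<^esub> \<rparr>"

text \<open>An isomorphism of group schemes over \<open>Q\<close> from \<open>G\<^sub>Q\<close> to the Cartier dual of the formal group.\<close>

definition cartier_duality ::
    "nat \<Rightarrow> fglaw \<Rightarrow> ('a ring \<Rightarrow> 'a \<times> (nat \<Rightarrow> 'a) \<Rightarrow> (nat \<Rightarrow> 'a)) \<Rightarrow> bool" where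
  "cartier_duality p F \<eta> \<longleftrightarrow>
    (\<forall>A q. p_nilpotent_ring p A \<and> q \<in> Q_points A \<longrightarrow>
      (\<lambda>x. \<eta> A (q, x)) \<in> iso (G_fiber p A q) (H_dual_fiber p F A q)) \<and>
    (\<forall>A B \<phi> q x. p_nilpotent_ring p A \<and> p_nilpotent_ring p B \<and> \<phi> \<in> ring_hom A B \<and>
        (q, x) \<in> G_points p A \<longrightarrow>
      \<eta> B (\<phi> q, \<phi> \<circ> x) = \<phi> \<circ> \<eta> A (q, x))"

text \<open>The value of the duality pairing at two points \<open>g\<close> and \<open>h\<close> over the same point of \<open>Q\<close>.\<close>

definition pairing ::
    "('a ring \<Rightarrow> 'a \<times> (nat \<Rightarrow> 'a) \<Rightarrow> (nat \<Rightarrow> 'a)) \<Rightarrow> 'a ring \<Rightarrow>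
     'a \<times> (nat \<Rightarrow> 'a) \<Rightarrow> 'a \<times> 'a \<Rightarrow> 'a" where
  "pairing \<eta> A g h = ps_eval A (\<eta> A g) (snd h)"

definition sigma_star ::
    "nat \<Rightarrow> ('a ring \<Rightarrow> 'a \<times> (nat \<Rightarrow> 'a) \<Rightarrow> (nat \<Rightarrow> 'a)) \<Rightarrow> 'a ring \<Rightarrow> 'a \<times> 'a \<Rightarrow> 'a \<times> 'a" where
  "sigma_star p \<eta> A h = (pairing \<eta> A (sigma p A (fst h)) h, fst h)"


section \<open>Actions of the group of \<open>p\<close>-adic units\<close>

text \<open>An action on the formal group by group automorphisms, lifting the action on \<open>Q\<close> and
  dual to the action on \<open>G\<^sub>Q\<close>: the pairing is invariant.\<close>

definition dual_action ::
    "nat \<Rightarrow> fglaw \<Rightarrow> ('a ring \<Rightarrow> 'a \<times> (nat \<Rightarrow> 'a) \<Rightarrow> (nat \<Rightarrow> 'a)) \<Rightarrow>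
     (padic \<Rightarrow> 'a ring \<Rightarrow> 'a \<times> 'a \<Rightarrow> 'a \<times> 'a) \<Rightarrow> bool" where
  "dual_action p F \<eta> act \<longleftrightarrow>
    (\<forall>n A q z. n \<in> Units (Zp p) \<and> p_nilpotent_ring p A \<and> (q, z) \<in> H_points A \<longrightarrow>
      act n A (q, z) \<in> H_points A \<and> fst (act n A (q, z)) = padic_pow p A q n) \<and>
    (\<forall>n A B \<phi> q z. n \<in> Units (Zp p) \<and> p_nilpotent_ring p A \<and> p_nilpotent_ring p B \<and>
        \<phi> \<in> ring_hom A B \<and> (q, z) \<in> H_points A \<longrightarrow>
      act n B (\<phi> q, \<phi> z) = map_prod \<phi> \<phi> (act n A (q, z))) \<and>
    (\<forall>A h. p_nilpotent_ring p A \<and> h \<in> H_points A \<longrightarrow> act \<one>\<^bsub>Zp p\<^esub> A h = h) \<and>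
    (\<forall>m n A h. m \<in> Units (Zp p) \<and> n \<in> Units (Zp p) \<and> p_nilpotent_ring p A \<and>
        h \<in> H_points A \<longrightarrow>
      act (m \<otimes>\<^bsub>Zp p\<^esub> n) A h = act m A (act n A h)) \<and>
    (\<forall>n A q. n \<in> Units (Zp p) \<and> p_nilpotent_ring p A \<and> q \<in> Q_points A \<longrightarrow>
      (\<lambda>z. snd (act n A (q, z))) \<in> hom (H_fiber p F A q) (H_fiber p F A (padic_pow p A q n))) \<and>
    (\<forall>n A q x z. n \<in> Units (Zp p) \<and> p_nilpotent_ring p A \<and> (q, x) \<in> G_points p A \<and>
        (q, z) \<in> H_points A \<longrightarrow>
      pairing \<eta> A (G_act p n A (q, x)) (act n A (q, z)) = pairing \<eta> A (q, x) (q, z))"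

definition GmQ_act :: "nat \<Rightarrow> padic \<Rightarrow> 'a ring \<Rightarrow> 'a \<times> 'a \<Rightarrow> 'a \<times> 'a" where
  "GmQ_act p n A = (\<lambda>(a, q). (padic_pow p A a n, padic_pow p A q n))"

end

(* For an integer m the m-th power of sigma(q) = [q] - 1 in the fiber of G_Q at q is the x with
   1 + Phi_p([q]) x = [q]^(pm), namely x = ([q] - 1)(1 + [q]^p + ... + [q]^(p(m-1))). In the same way
   u_n([q^n] - 1) solves 1 + Phi_p([q]) x = [q^n]^p, so it is "sigma(q) to the power n" and the action
   of n maps it to sigma(q^n). Over a ring in which p is nilpotent, [q] - 1 is killed by a power of p
   in the Witt vectors, hence u_n([q^n] - 1) is an honest power sigma(q)^m for m close to n, and
   invariance of the pairing gives <sigma(q^n), n h> = <sigma(q)^m, h> = <sigma(q), h>^m = <sigma(q), h>^n.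

   The unit u_n and all Witt vectors with p-adic exponents are limits of Witt vectors over Z[[q - 1]]
   with integer exponents: their ghost components, and therefore the vectors themselves, depend
   continuously on the exponents. *)
theory Submission
  imports Defs "HOL-Computational_Algebra.Formal_Power_Series"
begin

section \<open>Type class rings as records\<close>

text \<open>The factor p in the exponents comes from 1 + Phi_p([q])([q] - 1) = [q]^p: the map x -> 1
  + Phi_p([q])x turns the group law of G_Q into multiplication and sends sigma(q) to [q]^p. Over a
  ring A in which p is nilpotent this map need not be injective, since Phi_p([q]) can be a zero
  divisor in W(A), so elements of G_Q cannot be identified by their images. Hence every quotient
  ([q]^(ab) - 1)/([q]^a - 1) is carried as an explicit geometric sum, and Phi_p([q]) is cancelled
  only over Z_p[[q-1]], where the ghost map is injective. A second obstacle is that p is in general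
  not nilpotent in W(A): a geometric sum with m terms need not be p-adically locally constant in m,
  and becomes so only after multiplication by [q] - 1. Limits of Witt vectors are taken without
  estimates on Witt polynomials: convergent integer sequences form a ring, evaluation at an index
  and the limit are ring homomorphisms out of it, and functoriality of power series and Witt vectors
  does the rest.\<close>

definition type_ring :: "'b::comm_ring_1 ring" where
  "type_ring = \<lparr>carrier = UNIV, monoid.mult = (*), one = 1, zero = 0, add = (+)\<rparr>"

lemma type_ring_simps [simp]:
  "carrier type_ring = UNIV" "x \<otimes>\<^bsub>type_ring\<^esub> y = x * y" "\<one>\<^bsub>type_ring\<^esub> = 1"
  "\<zero>\<^bsub>type_ring\<^esub> = 0" "x \<oplus>\<^bsub>type_ring\<^esub> y = x + y"
  by (simp_all add: type_ring_def)

lemma cring_type_ring: "cring (type_ring :: 'b::comm_ring_1 ring)"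
proof (rule cringI)
  show "abelian_group (type_ring :: 'b ring)"
    by (rule abelian_groupI) (auto simp: algebra_simps intro: exI[of _ "- _"] add.left_inverse)
  show "comm_monoid (type_ring :: 'b ring)"
    by unfold_locales (auto simp: algebra_simps)
qed (auto simp: algebra_simps)

lemma type_ring_pow [simp]: "(x::'b::comm_ring_1) [^]\<^bsub>type_ring\<^esub> (n::nat) = x ^ n"
proof -
  interpret cring "type_ring :: 'b ring" by (rule cring_type_ring)
  show ?thesis by (induction n) (simp_all add: mult.commute)
qed

lemma type_ring_finsum [simp]: "finite S \<Longrightarrow> finsum (type_ring::'b::comm_ring_1 ring) f S = sum f S"
proof -
  interpret cring "type_ring :: 'b ring" by (rule cring_type_ring)
  show "finite S \<Longrightarrow> ?thesis" by (induction S rule: finite_induct) (simp_all)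
qed

lemma type_ring_finprod [simp]: "finite S \<Longrightarrow> finprod (type_ring::'b::comm_ring_1 ring) f S = prod f S"
proof -
  interpret cring "type_ring :: 'b ring" by (rule cring_type_ring)
  show "finite S \<Longrightarrow> ?thesis" by (induction S rule: finite_induct) (simp_all)
qed

lemma type_ring_a_inv [simp]: "\<ominus>\<^bsub>type_ring\<^esub> (x::'b::comm_ring_1) = - x"
proof -
  interpret cring "type_ring :: 'b ring" by (rule cring_type_ring)
  show ?thesis by (rule minus_equality) auto
qed

lemma type_ring_add_pow_nat [simp]: "[(n::nat)] \<cdot>\<^bsub>type_ring\<^esub> (x::'b::comm_ring_1) = of_nat n * x"
proof -
  interpret cring "type_ring :: 'b ring" by (rule cring_type_ring)
  show ?thesis by (induction n) (simp_all add: algebra_simps)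
qed

lemma type_ring_add_pow_int [simp]: "[(n::int)] \<cdot>\<^bsub>type_ring\<^esub> x = of_int n * x"
  by (cases "n \<ge> 0") (simp_all add: add_pow_int_ge add_pow_int_lt)

context cring
begin

lemma int_ring_hom: "(\<lambda>k::int. [k] \<cdot> \<one>) \<in> ring_hom type_ring R"
proof (rule ring_hom_memI)
  fix k l :: int
  show "[(k \<otimes>\<^bsub>type_ring\<^esub> l)] \<cdot> \<one> = [k] \<cdot> \<one> \<otimes> [l] \<cdot> \<one>"
    by (simp add: add_pow_ldistr_int add.int_pow_pow mult.commute)
qed (auto simp: add.int_pow_mult)

lemma int_add_pow_eq: "x \<in> carrier R \<Longrightarrow> [(k::int)] \<cdot> x = [k] \<cdot> \<one> \<otimes> x"
  by (simp add: add_pow_ldistr_int)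

lemma nat_add_pow_eq: "x \<in> carrier R \<Longrightarrow> [(k::nat)] \<cdot> x = [k] \<cdot> \<one> \<otimes> x"
  by (simp add: add_pow_ldistr)

lemma add_minus_cancel:
  assumes "x \<in> carrier R" "y \<in> carrier R"
  shows "x \<oplus> (y \<ominus> x) = y" "x \<oplus> y \<ominus> x = y"
proof -
  show "x \<oplus> (y \<ominus> x) = y"
    using assms by (simp add: minus_eq a_comm[of y] a_assoc[symmetric] r_neg)
  show "x \<oplus> y \<ominus> x = y"
    using assms by (simp add: minus_eq a_comm[of x] a_assoc r_neg)
qed

lemma add_pow_int_of_nat: "[(int k)] \<cdot> x = [k] \<cdot> x"
  by (simp add: add_pow_int_ge)

end

text \<open>Identities are proved by ordinary arithmetic in a type class ring and moved along
  \<open>h\<close> into the record ring \<open>A\<close>; \<open>h_simps\<close> collects the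
  transport rules.\<close>

locale type_hom = cring A for A :: "'a ring" (structure) +
  fixes h :: "'b::comm_ring_1 \<Rightarrow> _"
  assumes h: "h \<in> ring_hom type_ring A"
begin

sublocale rh: ring_hom_cring "type_ring :: 'b ring" A h
  by (intro ring_hom_cring.intro cring_type_ring ring_hom_cring_axioms.intro h cring_axioms)

lemma h_closed [simp]: "h x \<in> carrier A"
  using rh.hom_closed[of x] by simp
lemma h_add: "h (x + y) = h x \<oplus> h y"
  using rh.hom_add[of x y] by simp
lemma h_mult: "h (x * y) = h x \<otimes> h y"
  using rh.hom_mult[of x y] by simp
lemma h_one: "h 1 = \<one>"
  using rh.hom_one by simp
lemma h_zero: "h 0 = \<zero>"
  using rh.hom_zero by simp
lemma h_uminus: "h (- x) = \<ominus> h x"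
  using rh.hom_a_inv[of x] by simp
lemma h_diff: "h (x - y) = h x \<ominus> h y"
  using h_add[of x "- y"] by (simp add: h_uminus a_minus_def)
lemma h_power: "h (x ^ n) = h x [^] n"
  by (induction n) (simp_all add: h_one h_mult m_comm)
lemma h_sum: "finite S \<Longrightarrow> h (sum f S) = (\<Oplus>i\<in>S. h (f i))"
  by (induction S rule: finite_induct) (simp_all add: h_zero h_add)
lemma h_prod: "finite S \<Longrightarrow> h (prod f S) = (\<Otimes>i\<in>S. h (f i))"
  by (induction S rule: finite_induct) (simp_all add: h_one h_mult)
lemma h_of_nat: "h (of_nat k) = [k] \<cdot> \<one>"
  by (induction k) (simp_all add: h_zero h_add h_one a_comm)
lemma h_of_int: "h (of_int k) = [k] \<cdot> \<one>"
  by (cases "k \<ge> 0") (simp_all add: add_pow_int_ge add_pow_int_lt h_of_nat[symmetric] h_uminus[symmetric])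

lemmas h_simps = h_add h_mult h_one h_zero h_uminus h_diff h_power h_sum h_prod h_of_nat h_of_int

end

lemma type_homI: "cring A \<Longrightarrow> h \<in> ring_hom type_ring A \<Longrightarrow> type_hom A h"
  by (intro type_hom.intro type_hom_axioms.intro)

section \<open>Evaluation of integer polynomials\<close>

text \<open>The definitions of the statement apply to records of type \<open>ring\<close> without extensions only.\<close>

locale plain_cring = cring R for R :: "'a ring" (structure)

locale plain_ring_hom = ring_hom_cring R S h for R :: "'a ring" (structure) and S :: "'b ring" (structure) and h

lemma plain_cringI: "cring R \<Longrightarrow> plain_cring R"
  by (simp add: plain_cring_def)

lemma plain_ring_homI: "cring R \<Longrightarrow> cring S \<Longrightarrow> h \<in> ring_hom R S \<Longrightarrow> plain_ring_hom R S h"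
  by (simp add: plain_ring_hom_def ring_hom_cring_def ring_hom_cring_axioms_def)

definition mono_eval :: "'a ring \<Rightarrow> ('v \<Rightarrow> 'a) \<Rightarrow> ('v \<Rightarrow>\<^sub>0 nat) \<Rightarrow> 'a" where
  "mono_eval A f m = (\<Otimes>\<^bsub>A\<^esub>v\<in>Poly_Mapping.keys m. f v [^]\<^bsub>A\<^esub> Poly_Mapping.lookup m v)"

context plain_cring
begin

text \<open>Adding exponents changes the set of keys; over a common finite superset both sides can
  be compared factor by factor. \<open>ipoly_eval_superset\<close> does the same for sums.\<close>

lemma mono_eval_superset:
  assumes "range f \<subseteq> carrier R" "finite S" "Poly_Mapping.keys m \<subseteq> S"
  shows "mono_eval R f m = (\<Otimes>v\<in>S. f v [^] Poly_Mapping.lookup m v)"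
  unfolding mono_eval_def
  by (rule add.finprod_mono_neutral_cong_left finprod_mono_neutral_cong_left)
     (use assms in \<open>auto simp: in_keys_iff\<close>)

lemma mono_eval_closed [simp]: "range f \<subseteq> carrier R \<Longrightarrow> mono_eval R f m \<in> carrier R"
  unfolding mono_eval_def by (rule finprod_closed) auto

lemma mono_eval_add:
  assumes f: "range f \<subseteq> carrier R"
  shows "mono_eval R f (m + m') = mono_eval R f m \<otimes> mono_eval R f m'"
proof -
  define S where "S = Poly_Mapping.keys m \<union> Poly_Mapping.keys m'"
  have S: "finite S" "Poly_Mapping.keys m \<subseteq> S" "Poly_Mapping.keys m' \<subseteq> S"
      "Poly_Mapping.keys (m + m') \<subseteq> S"
    using keys_add[of m m'] by (auto simp: S_def)
  show ?thesis
    unfolding mono_eval_superset[OF f S(1,2)] mono_eval_superset[OF f S(1,3)]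
      mono_eval_superset[OF f S(1,4)]
    by (subst finprod_multf[symmetric])
       (use f in \<open>auto simp: lookup_add nat_pow_mult image_subset_iff intro!: finprod_cong\<close>)
qed

lemma ipoly_eval_superset:
  assumes "range f \<subseteq> carrier R" "finite S" "Poly_Mapping.keys P \<subseteq> S"
  shows "ipoly_eval R f P = (\<Oplus>m\<in>S. [Poly_Mapping.lookup P m] \<cdot> mono_eval R f m)"
  unfolding ipoly_eval_def mono_eval_def[symmetric]
  by (rule add.finprod_mono_neutral_cong_left)
     (use assms in \<open>auto simp: in_keys_iff add_pow_int_ge\<close>)

lemma ipoly_eval_closed [simp]: "range f \<subseteq> carrier R \<Longrightarrow> ipoly_eval R f P \<in> carrier R"
  by (subst ipoly_eval_superset[OF _ finite_keys order_refl]) (auto intro!: finsum_closed)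

lemma ipoly_eval_add:
  assumes f: "range f \<subseteq> carrier R"
  shows "ipoly_eval R f (P + P') = ipoly_eval R f P \<oplus> ipoly_eval R f P'"
proof -
  define S where "S = Poly_Mapping.keys P \<union> Poly_Mapping.keys P'"
  have S: "finite S" "Poly_Mapping.keys P \<subseteq> S" "Poly_Mapping.keys P' \<subseteq> S"
      "Poly_Mapping.keys (P + P') \<subseteq> S"
    using keys_add[of P P'] by (auto simp: S_def)
  show ?thesis
    unfolding ipoly_eval_superset[OF f S(1,2)] ipoly_eval_superset[OF f S(1,3)]
      ipoly_eval_superset[OF f S(1,4)]
    by (subst finsum_addf[symmetric])
       (use f in \<open>auto simp: lookup_add add.int_pow_mult intro!: finsum_cong\<close>)
qed

lemma ipoly_eval_zero [simp]: "ipoly_eval R f 0 = \<zero>"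
  by (simp add: ipoly_eval_def)

lemma ipoly_eval_single:
  assumes f: "range f \<subseteq> carrier R"
  shows "ipoly_eval R f (Poly_Mapping.single m c) = [c] \<cdot> mono_eval R f m"
  by (subst ipoly_eval_superset[OF f, of "{m}"]) (use f in auto)

end

text \<open>Updating at a key outside the support is adding a single term, so additive statements
  reduce to monomials.\<close>

lemma poly_mapping_add_single_induct [case_names zero single add]:
  fixes P :: "'b \<Rightarrow>\<^sub>0 'c::ab_group_add"
  assumes "Q 0" "\<And>m c. Q (Poly_Mapping.single m c)" "\<And>P P'. Q P \<Longrightarrow> Q P' \<Longrightarrow> Q (P + P')"
  shows "Q P"
proof (induction P rule: update_induct)
  case const
  then show ?case using assms(1) by simp
next
  case (update f a b)
  have "Poly_Mapping.update a b f = f + Poly_Mapping.single a b"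
    using update by (intro poly_mapping_eqI) (auto simp: lookup_update lookup_add lookup_single in_keys_iff when_def)
  then show ?case using assms update by simp
qed

context plain_cring
begin

lemma ipoly_eval_mult:
  assumes f: "range f \<subseteq> carrier R"
  shows "ipoly_eval R f (P * P') = ipoly_eval R f P \<otimes> ipoly_eval R f P'"
proof (induction P rule: poly_mapping_add_single_induct)
  case zero
  then show ?case using f by (simp add: ipoly_eval_zero)
next
  case (add P1 P2)
  then show ?case using f by (simp add: ring_distribs ipoly_eval_add l_distr)
next
  case (single m c)
  show ?case
  proof (induction P' rule: poly_mapping_add_single_induct)
    case zero
    then show ?case using f by (simp add: ipoly_eval_zero)
  next
    case (add P1 P2)
    then show ?case using f by (simp add: ring_distribs ipoly_eval_add r_distr)
  next
    case (single m' c')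
    then show ?case using f
      by (simp add: mult_single ipoly_eval_single mono_eval_add add_pow_ldistr_int add_pow_rdistr_int
        add.int_pow_pow mult.commute[of c c'])
  qed
qed

lemma ipoly_eval_hom:
  assumes f: "range f \<subseteq> carrier R"
  shows "ipoly_eval R f \<in> ring_hom type_ring R"
proof (rule ring_hom_memI)
  have "ipoly_eval R f 1 = [(1::int)] \<cdot> mono_eval R f 0"
    using ipoly_eval_single[OF f, of 0 1] by simp
  then show "ipoly_eval R f \<one>\<^bsub>type_ring\<^esub> = \<one>"
    by (simp add: mono_eval_def add_pow_int_ge)
qed (use f in \<open>auto simp: ipoly_eval_add ipoly_eval_mult\<close>)

lemma ipoly_eval_type_hom:
  assumes f: "range f \<subseteq> carrier R"
  shows "type_hom R (ipoly_eval R f)"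
  by (intro type_homI ipoly_eval_hom f cring_axioms)

lemma ipoly_eval_var:
  assumes f: "range f \<subseteq> carrier R"
  shows "ipoly_eval R f (ipoly_var v) = f v"
proof -
  have "f v \<in> carrier R" using f by auto
  then show ?thesis unfolding ipoly_var_def ipoly_eval_single[OF f] by (simp add: mono_eval_def add_pow_int_ge)
qed

end

text \<open>This is the source of the functoriality of Witt vectors, whose operations evaluate fixed
  integer polynomials.\<close>

lemma (in plain_ring_hom) hom_ipoly_eval:
  assumes f: "range f \<subseteq> carrier R"
  shows "h (ipoly_eval R f P) = ipoly_eval S (h \<circ> f) P"
proof -
  have hf: "range (h \<circ> f) \<subseteq> carrier S" using f by auto
  have nat: "h ([(k::nat)] \<cdot>\<^bsub>R\<^esub> x) = [k] \<cdot>\<^bsub>S\<^esub> h x" if "x \<in> carrier R" for k x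
    using that by (induction k) simp_all
  have int: "h ([(k::int)] \<cdot>\<^bsub>R\<^esub> x) = [k] \<cdot>\<^bsub>S\<^esub> h x" if "x \<in> carrier R" for k x
    using that by (cases "k \<ge> 0") (simp_all add: add_pow_int_ge add_pow_int_lt nat)
  have pow: "h (x [^]\<^bsub>R\<^esub> (k::nat)) = h x [^]\<^bsub>S\<^esub> k" if "x \<in> carrier R" for k x
    using that by (induction k) simp_all
  have mono: "h (mono_eval R f m) = mono_eval S (h \<circ> f) m" for m
    unfolding mono_eval_def using f by (subst hom_finprod) (auto simp: pow o_def image_subset_iff intro!: S.finprod_cong)
  show ?thesis
    unfolding ipoly_eval_def mono_eval_def[symmetric]
    using f hf plain_cring.mono_eval_closed[OF plain_cringI[OF R.cring_axioms] f]
      plain_cring.mono_eval_closed[OF plain_cringI[OF S.cring_axioms] hf]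
    by (subst hom_finsum) (auto simp: int mono intro!: S.finsum_cong)
qed

lemma ipoly_of_int: "of_int c * Poly_Mapping.single m d = (Poly_Mapping.single m (c * d) :: 'v ipoly)"
  by (metis mult_single single_of_int add_0_left of_int_eq_id id_apply)

text \<open>Lets a ring endomorphism be computed on a monomial from its values at the
  variables.\<close>

lemma ipoly_single_eq:
  "(Poly_Mapping.single m c :: 'v ipoly) = of_int c * (\<Prod>v\<in>Poly_Mapping.keys m. ipoly_var v ^ Poly_Mapping.lookup m v)"
proof -
  have pow: "ipoly_var v ^ k = (Poly_Mapping.single (Poly_Mapping.single v k) 1 :: 'v ipoly)" for v k
    by (induction k) (simp_all add: ipoly_var_def mult_single flip: single_add)
  have pr: "(\<Prod>v\<in>S. Poly_Mapping.single (g v) 1) = (Poly_Mapping.single (sum g S) 1 :: 'v ipoly)"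
    if "finite S" for S and g :: "'v \<Rightarrow> 'v \<Rightarrow>\<^sub>0 nat"
    using that by (induction S rule: finite_induct) (simp_all add: mult_single)
  have "(\<Sum>v\<in>Poly_Mapping.keys m. Poly_Mapping.single v (Poly_Mapping.lookup m v)) = m"
    by (rule poly_mapping_eqI) (simp add: lookup_sum lookup_single when_def in_keys_iff)
  then show ?thesis by (simp add: pow pr ipoly_of_int)
qed

lemma ipoly_torsion_free:
  fixes P :: "'v ipoly"
  assumes "of_int c * P = 0" "c \<noteq> 0"
  shows "P = 0"
proof (rule poly_mapping_eqI)
  fix m
  have "Poly_Mapping.lookup (of_int c * P) m = c * Poly_Mapping.lookup P m"
    by (induction P rule: poly_mapping_add_single_induct)
       (simp_all add: ring_distribs lookup_add ipoly_of_int lookup_single when_def)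
  then show "Poly_Mapping.lookup P m = Poly_Mapping.lookup 0 m" using assms by simp
qed

section \<open>Ghost components and Dwork's lemma\<close>

lemma of_nat_dvd_of_natI: "a dvd b \<Longrightarrow> (of_nat a :: 'b::comm_ring_1) dvd of_nat b"
  by (auto simp: dvd_def)

lemma of_int_dvd_of_intI: "a dvd b \<Longrightarrow> (of_int a :: 'b::comm_ring_1) dvd of_int b"
  by (auto simp: dvd_def)

lemma freshman_dvd:
  fixes a b :: "'b::comm_ring_1"
  assumes "prime p"
  shows "of_nat p dvd (a + b) ^ p - (a ^ p + b ^ p)"
proof -
  have p: "p > 0" using assms prime_gt_0_nat by blast
  have "(a + b) ^ p = (\<Sum>k\<le>p. of_nat (p choose k) * a ^ k * b ^ (p - k))"
    by (rule binomial_ring)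
  also have "{..p} = {0, p} \<union> {0<..<p}" using p by auto
  also have "(\<Sum>k\<in>\<dots>. of_nat (p choose k) * a ^ k * b ^ (p - k)) =
      (a ^ p + b ^ p) + (\<Sum>k\<in>{0<..<p}. of_nat (p choose k) * a ^ k * b ^ (p - k))"
    using p by (subst sum.union_disjoint) auto
  finally have "(a + b) ^ p - (a ^ p + b ^ p) = (\<Sum>k\<in>{0<..<p}. of_nat (p choose k) * a ^ k * b ^ (p - k))"
    by simp
  also have "of_nat p dvd \<dots>"
  proof (rule dvd_sum)
    fix k assume "k \<in> {0<..<p}"
    then have "p dvd (p choose k)" using assms by (intro dvd_choose_prime) auto
    then show "of_nat p dvd of_nat (p choose k) * a ^ k * b ^ (p - k)"
      by (intro dvd_mult2 of_nat_dvd_of_natI)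
  qed
  finally show ?thesis .
qed

lemma fermat_int:
  assumes "prime p"
  shows "int p dvd c ^ p - c"
proof -
  have nat: "int p dvd int k ^ p - int k" for k
  proof (induction k)
    case 0
    then show ?case using assms by (simp add: zero_power prime_gt_0_nat)
  next
    case (Suc k)
    have "int p dvd ((int k + 1) ^ p - (int k ^ p + 1 ^ p)) + (int k ^ p - int k)"
      using freshman_dvd[OF assms, of "int k" 1] Suc by (intro dvd_add) auto
    then show ?case by (simp add: algebra_simps)
  qed
  define k where "k = nat (c mod int p)"
  have k: "int k = c mod int p" using assms by (simp add: k_def prime_gt_0_nat)
  have "c ^ p mod int p = int k ^ p mod int p" unfolding k by (simp add: power_mod)
  moreover have "int k ^ p mod int p = int k mod int p" using nat by (simp add: mod_eq_dvd_iff)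
  ultimately show ?thesis using k by (simp add: mod_eq_dvd_iff flip: mod_eq_dvd_iff)
qed

text \<open>Each p-th power gains one factor p: c^p - d^p is c - d times a sum of p terms, all
  congruent to d^(p-1) modulo p.\<close>

lemma power_dvd_diff:
  fixes a b :: "'b::comm_ring_1"
  assumes "of_nat p dvd a - b"
  shows "of_nat (p ^ (k + 1)) dvd a ^ (p ^ k) - b ^ (p ^ k)"
proof (induction k)
  case 0
  then show ?case using assms by simp
next
  case (Suc k)
  define c d where "c = a ^ (p ^ k)" and "d = b ^ (p ^ k)"
  have cd: "of_nat (p ^ (k + 1)) dvd c - d" using Suc by (simp add: c_def d_def)
  then have cd': "of_nat p dvd c - d" by (rule dvd_trans[rotated]) (simp flip: of_nat_power)
  have "of_nat (p ^ (Suc k + 1)) dvd c ^ p - d ^ p"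
  proof (cases p)
    case 0
    then show ?thesis by simp
  next
    case (Suc r)
    have "of_nat p dvd (\<Sum>i<p. c ^ i * d ^ (r - i) - d ^ r)"
    proof (rule dvd_sum)
      fix i assume "i \<in> {..<p}"
      then have "c ^ i * d ^ (r - i) - d ^ r = (c ^ i - d ^ i) * d ^ (r - i)"
        using Suc by (simp add: algebra_simps flip: power_add)
      moreover have "c - d dvd c ^ i - d ^ i"
        by (cases i) (auto simp: diff_power_eq_sum simp del: power_Suc)
      ultimately show "of_nat p dvd c ^ i * d ^ (r - i) - d ^ r"
        using dvd_trans[OF cd'] by simp
    qed
    then have "of_nat p dvd (\<Sum>i<p. c ^ i * d ^ (r - i) - d ^ r) + of_nat p * d ^ r" by simp
    then have "of_nat p dvd (\<Sum>i<p. c ^ i * d ^ (r - i))" by (simp add: sum_subtractf)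
    moreover have "c ^ p - d ^ p = (c - d) * (\<Sum>i<p. c ^ i * d ^ (r - i))"
      unfolding Suc by (rule diff_power_eq_sum)
    moreover have "(of_nat (p ^ (Suc k + 1)) :: 'b) = of_nat (p ^ (k + 1)) * of_nat p" by simp
    ultimately show ?thesis using cd by (simp only: mult_dvd_mono)
  qed
  then show ?case by (simp add: c_def d_def mult.commute flip: power_mult)
qed

lemma witt_ghost_Suc:
  "witt_ghost p (Suc n) X = witt_ghost p n (\<lambda>i. X i ^ p) + of_nat (p ^ Suc n) * X (Suc n)"
proof -
  have "X i ^ (p ^ (Suc n - i)) = (X i ^ p) ^ (p ^ (n - i))" if "i \<le> n" for i
    using that by (simp add: Suc_diff_le flip: power_mult)
  then show ?thesis by (simp add: witt_ghost_def)
qed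

text \<open>The setting of Dwork's lemma: a ring endomorphism that is the p-th power map modulo
  p.\<close>

locale frobenius_lift =
  fixes p :: nat and \<phi> :: "'b::comm_ring_1 \<Rightarrow> 'b"
  assumes prime: "prime p"
    and hom: "type_hom type_ring \<phi>"
    and lift: "of_nat p dvd \<phi> x - x ^ p"
begin

sublocale type_hom type_ring \<phi> by (rule hom)

text \<open>Dwork's congruences. They hold for ghost sequences and are stable under ring operations,
  and every sequence satisfying them is a ghost sequence; this yields the Witt polynomials.\<close>

definition dwork :: "(nat \<Rightarrow> 'b) \<Rightarrow> bool" where
  "dwork g \<longleftrightarrow> (\<forall>n. of_nat (p ^ Suc n) dvd g (Suc n) - \<phi> (g n))"

text \<open>The congruence of \<phi>(X_i) and X_i^p modulo p improves to p^(n-i+1) after raising to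
  the power p^(n-i); the factor p^i of the ghost component supplies the rest.\<close>

lemma ghost_frobenius: "of_nat (p ^ Suc n) dvd \<phi> (witt_ghost p n X) - witt_ghost p n (\<lambda>i. X i ^ p)"
proof -
  have "\<phi> (witt_ghost p n X) - witt_ghost p n (\<lambda>i. X i ^ p) =
      (\<Sum>i\<le>n. of_nat (p ^ i) * (\<phi> (X i) ^ p ^ (n - i) - (X i ^ p) ^ p ^ (n - i)))"
    by (simp add: witt_ghost_def h_sum h_mult h_power h_of_nat sum_subtractf right_diff_distrib del: of_nat_power)
  also have "of_nat (p ^ Suc n) dvd \<dots>"
  proof (rule dvd_sum)
    fix i assume "i \<in> {..n}"
    then have "p ^ Suc n = p ^ i * p ^ (n - i + 1)"
      by (simp flip: power_add del: power_Suc)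
    then have "(of_nat (p ^ Suc n) :: 'b) = of_nat (p ^ i) * of_nat (p ^ (n - i + 1))"
      by (simp only: of_nat_mult)
    then show "of_nat (p ^ Suc n) dvd of_nat (p ^ i) * (\<phi> (X i) ^ p ^ (n - i) - (X i ^ p) ^ p ^ (n - i))"
      using power_dvd_diff[OF lift] by (simp only: mult_dvd_mono dvd_refl)
  qed
  finally show ?thesis .
qed

lemma dwork_ghost: "dwork (\<lambda>n. witt_ghost p n X)"
  unfolding dwork_def
proof
  fix n
  have "of_nat (p ^ Suc n) dvd of_nat (p ^ Suc n) * X (Suc n) - (\<phi> (witt_ghost p n X) - witt_ghost p n (\<lambda>i. X i ^ p))"
    by (intro dvd_diff ghost_frobenius) simp
  then show "of_nat (p ^ Suc n) dvd witt_ghost p (Suc n) X - \<phi> (witt_ghost p n X)"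
    by (simp add: witt_ghost_Suc algebra_simps)
qed

lemma dwork_add: "dwork f \<Longrightarrow> dwork g \<Longrightarrow> dwork (\<lambda>n. f n + g n)"
  unfolding dwork_def h_add type_ring_simps add_diff_add by (blast intro: dvd_add)

lemma dwork_uminus: "dwork f \<Longrightarrow> dwork (\<lambda>n. - f n)"
  unfolding dwork_def h_uminus type_ring_a_inv by (simp only: minus_diff_minus dvd_minus_iff simp_thms)

lemma dwork_mult: "dwork f \<Longrightarrow> dwork g \<Longrightarrow> dwork (\<lambda>n. f n * g n)"
  unfolding dwork_def h_mult type_ring_simps
proof
  fix n assume *: "\<forall>n. of_nat (p ^ Suc n) dvd f (Suc n) - \<phi> (f n)" "\<forall>n. of_nat (p ^ Suc n) dvd g (Suc n) - \<phi> (g n)"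
  have "f (Suc n) * g (Suc n) - \<phi> (f n) * \<phi> (g n) =
     (f (Suc n) - \<phi> (f n)) * g (Suc n) + \<phi> (f n) * (g (Suc n) - \<phi> (g n))" by (simp add: algebra_simps)
  then show "of_nat (p ^ Suc n) dvd f (Suc n) * g (Suc n) - \<phi> (f n) * \<phi> (g n)"
    using * by (simp only: dvd_add dvd_mult dvd_mult2)
qed

text \<open>The components are solved for one at a time: Dwork's congruence and
  \<open>ghost_frobenius\<close> make g(n+1) minus the contribution of the earlier components
  divisible by p^(n+1), and the quotient is the next component.\<close>

lemma dwork_is_ghost:
  assumes "dwork g"
  shows "\<exists>X. \<forall>n. witt_ghost p n X = g n"
proof -
  define good where "good X n \<longleftrightarrow> witt_ghost p n X = g n" for X :: "nat \<Rightarrow> 'b" and n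
  have local: "witt_ghost p n X = witt_ghost p n Y" if "\<And>i. i \<le> n \<Longrightarrow> X i = Y i" for n and X Y :: "nat \<Rightarrow> 'b"
    using that by (simp add: witt_ghost_def)
  have step: "\<exists>y. good (X(Suc n := y)) (Suc n)" if "good X n" for X n
  proof -
    have "of_nat (p ^ Suc n) dvd (g (Suc n) - \<phi> (g n)) + (\<phi> (g n) - witt_ghost p n (\<lambda>i. X i ^ p))"
      using assms ghost_frobenius[of n X] that by (intro dvd_add) (auto simp: dwork_def good_def)
    then obtain y where y: "g (Suc n) = witt_ghost p n (\<lambda>i. X i ^ p) + of_nat (p ^ Suc n) * y"
      by (auto simp: dvd_def algebra_simps)
    have "witt_ghost p n (\<lambda>i. (X(Suc n := y)) i ^ p) = witt_ghost p n (\<lambda>i. X i ^ p)" by (rule local) simp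
    then have "good (X(Suc n := y)) (Suc n)"
      unfolding good_def witt_ghost_Suc y by simp
    then show ?thesis ..
  qed
  \<comment> \<open>Stage n is correct at index n, and later stages never change entries up to n.
    The solution is therefore the diagonal \<open>Z i i\<close>.\<close>
  define Z where "Z = rec_nat (\<lambda>_. g 0) (\<lambda>n X. X(Suc n := (SOME y. good (X(Suc n := y)) (Suc n))))"
  have Z_Suc: "Z (Suc n) = (Z n)(Suc n := (SOME y. good ((Z n)(Suc n := y)) (Suc n)))" for n
    by (simp add: Z_def)
  have good: "good (Z n) n" for n
  proof (induction n)
    case 0
    then show ?case by (simp add: Z_def good_def witt_ghost_def)
  next
    case (Suc n)
    then show ?case unfolding Z_Suc by (rule someI_ex[OF step])
  qed
  have "Z (i + k) i = Z i i" for i k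
    by (induction k) (simp_all add: Z_Suc)
  then have stab: "Z n i = Z i i" if "i \<le> n" for n i
    using that by (auto simp: le_iff_add)
  have "witt_ghost p n (\<lambda>i. Z i i) = witt_ghost p n (Z n)" for n
    by (rule local, rule stab[symmetric])
  then have "witt_ghost p n (\<lambda>i. Z i i) = g n" for n
    using good[of n] by (simp only: good_def)
  then show ?thesis by blast
qed

end

lemma power_commutes_exp: "((x::'b::comm_ring_1) ^ a) ^ b = (x ^ b) ^ a"
  unfolding power_mult[symmetric] by (subst mult.commute) (rule refl)

text \<open>The lift raises every variable to the power p. Modulo p the p-th power is additive, so
  monomials suffice, and there Fermat's little theorem handles the coefficient.\<close>

lemma frobenius_lift_ipoly:
  assumes "prime p"
  shows "frobenius_lift p (ipoly_eval type_ring (\<lambda>v. ipoly_var v ^ p) :: 'v ipoly \<Rightarrow> 'v ipoly)"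
proof -
  interpret T: plain_cring "type_ring :: 'v ipoly ring" by (intro plain_cringI cring_type_ring)
  define \<phi> where "\<phi> = (ipoly_eval type_ring (\<lambda>v. ipoly_var v ^ p) :: 'v ipoly \<Rightarrow> 'v ipoly)"
  have \<phi>: "type_hom type_ring \<phi>" unfolding \<phi>_def by (rule T.ipoly_eval_type_hom) simp
  interpret type_hom type_ring \<phi> by (rule \<phi>)
  have var: "\<phi> (ipoly_var v) = ipoly_var v ^ p" for v
    unfolding \<phi>_def by (rule T.ipoly_eval_var) simp
  have "of_nat p dvd \<phi> P - P ^ p" for P
  proof (induction P rule: poly_mapping_add_single_induct)
    case zero
    then show ?case using assms by (simp add: h_zero zero_power prime_gt_0_nat)
  next
    case (add P P')
    have "of_nat p dvd (\<phi> P - P ^ p) + (\<phi> P' - P' ^ p) - ((P + P') ^ p - (P ^ p + P' ^ p))"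
      by (intro dvd_diff dvd_add add freshman_dvd assms)
    then show ?case by (simp add: h_add algebra_simps)
  next
    case (single m c)
    have fermat: "(of_nat p :: 'v ipoly) dvd of_int (c - c ^ p)"
      using of_int_dvd_of_intI[of "int p" "c - c ^ p", where 'b = "'v ipoly"] fermat_int[OF assms, of c]
      by (simp add: dvd_diff_commute)
    define M :: "'v ipoly" where "M = (\<Prod>v\<in>Poly_Mapping.keys m. ipoly_var v ^ Poly_Mapping.lookup m v)"
    have "\<phi> M = M ^ p"
      by (simp add: M_def h_prod h_power var prod_power_distrib power_commutes_exp)
    then have "\<phi> (Poly_Mapping.single m c) - Poly_Mapping.single m c ^ p = of_int (c - c ^ p) * M ^ p"
      unfolding ipoly_single_eq M_def[symmetric] by (simp add: h_mult h_of_int power_mult_distrib algebra_simps)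
    then show ?case using fermat by simp
  qed
  then show ?thesis unfolding \<phi>_def[symmetric] using assms \<phi> by unfold_locales
qed

section \<open>The ring of Witt vectors\<close>

text \<open>Defined as a value of the universal ghost polynomial, so that naturality and
  compatibility with the Witt operations follow from facts about \<open>ipoly_eval\<close>.\<close>

definition ghost :: "nat \<Rightarrow> 'a ring \<Rightarrow> nat \<Rightarrow> (nat \<Rightarrow> 'a) \<Rightarrow> 'a" where
  "ghost p A n x = ipoly_eval A x (witt_ghost p n ipoly_var)"

lemma (in type_hom) hom_witt_ghost:
  "h (witt_ghost p n X) = (\<Oplus>i\<in>{..n}. [(p ^ i)] \<cdot> \<one> \<otimes> h (X i) [^] (p ^ (n - i)))"
  unfolding witt_ghost_def by (simp only: h_sum finite_atMost h_mult h_power h_of_nat)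

context plain_cring
begin

lemma one_add_pow [simp]: "x \<in> carrier R \<Longrightarrow> [(1::nat)] \<cdot> x = x" "x \<in> carrier R \<Longrightarrow> [(Suc 0)] \<cdot> x = x"
  by simp_all

lemma minus_eq_zeroD:
  assumes "x \<in> carrier R" "y \<in> carrier R" "x \<ominus> y = \<zero>"
  shows "x = y"
proof -
  have "x = (x \<ominus> y) \<oplus> y" using assms(1,2) by (simp add: minus_eq a_assoc l_neg)
  also have "\<dots> = y" using assms(2) by (simp add: assms(3))
  finally show ?thesis .
qed

lemma nat_add_pow_minus:
  assumes "x \<in> carrier R" "y \<in> carrier R"
  shows "[(k::nat)] \<cdot> (x \<ominus> y) = [k] \<cdot> x \<ominus> [k] \<cdot> y"
  unfolding nat_add_pow_eq[OF assms(1)] nat_add_pow_eq[OF assms(2)] nat_add_pow_eq[OF minus_closed[OF assms]]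
  using assms by (simp add: minus_eq r_distr r_minus)

lemma ghost_eq:
  assumes "range x \<subseteq> carrier R"
  shows "ghost p R n x = (\<Oplus>i\<in>{..n}. [(p ^ i)] \<cdot> \<one> \<otimes> x i [^] (p ^ (n - i)))"
proof -
  interpret type_hom R "ipoly_eval R x" by (rule ipoly_eval_type_hom[OF assms])
  show ?thesis unfolding ghost_def hom_witt_ghost ipoly_eval_var[OF assms] ..
qed

lemma ghost_closed [simp]: "range x \<subseteq> carrier R \<Longrightarrow> ghost p R n x \<in> carrier R"
  unfolding ghost_def by simp

text \<open>The n-th ghost component is p^n x_n plus an expression in earlier components, so x_n can
  be recovered when multiplication by p is injective.\<close>

lemma ghost_inj:
  assumes x: "range x \<subseteq> carrier R" and y: "range y \<subseteq> carrier R"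
    and tf: "\<And>a. a \<in> carrier R \<Longrightarrow> [p] \<cdot> a = \<zero> \<Longrightarrow> a = \<zero>"
    and eq: "\<And>n. ghost p R n x = ghost p R n y"
  shows "x = y"
proof
  fix n
  show "x n = y n"
  proof (induction n rule: less_induct)
    case (less n)
    have xc: "x i \<in> carrier R" and yc: "y i \<in> carrier R" for i using x y by auto
    have tf': "a \<in> carrier R \<Longrightarrow> [(p ^ k)] \<cdot> a = \<zero> \<Longrightarrow> a = \<zero>" for a k
    proof (induction k arbitrary: a)
      case (Suc k)
      note a = Suc.prems(1)
      have "[p] \<cdot> ([(p ^ k)] \<cdot> a) = [(p ^ Suc k)] \<cdot> a"
        unfolding add.nat_pow_pow[OF a] power_Suc by (subst mult.commute) (rule refl)
      also have "\<dots> = \<zero>" by (rule Suc.prems(2))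
      finally have "[(p ^ k)] \<cdot> a = \<zero>" by (rule tf[OF add.nat_pow_closed[OF a]])
      then show ?case by (rule Suc.IH[OF Suc.prems(1)])
    qed (simp only: power_0 one_add_pow)
    have split: "ghost p R n z = [(p ^ n)] \<cdot> z n \<oplus> (\<Oplus>i\<in>{..<n}. [(p ^ i)] \<cdot> \<one> \<otimes> z i [^] (p ^ (n - i)))"
      if z: "range z \<subseteq> carrier R" for z
    proof -
      have zc: "z i \<in> carrier R" for i using z by auto
      have "{..n} = insert n {..<n}" by auto
      then show ?thesis unfolding ghost_eq[OF z] using zc by (simp add: nat_add_pow_eq[of "z n"])
    qed
    have "(\<Oplus>i\<in>{..<n}. [(p ^ i)] \<cdot> \<one> \<otimes> x i [^] (p ^ (n - i))) = (\<Oplus>i\<in>{..<n}. [(p ^ i)] \<cdot> \<one> \<otimes> y i [^] (p ^ (n - i)))"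
      using less xc yc by (intro finsum_cong') auto
    then have "[(p ^ n)] \<cdot> x n = [(p ^ n)] \<cdot> y n"
      using eq[of n] xc yc unfolding split[OF x] split[OF y] by simp
    then have "[(p ^ n)] \<cdot> (x n \<ominus> y n) = \<zero>"
      unfolding nat_add_pow_minus[OF xc yc] using xc yc by (simp add: minus_eq r_neg)
    then have "x n \<ominus> y n = \<zero>" using xc yc by (intro tf'[of "x n \<ominus> y n" n]) simp_all
    then show ?case by (rule minus_eq_zeroD[OF xc yc])
  qed
qed

end

lemma (in plain_ring_hom) hom_ghost:
  "range x \<subseteq> carrier R \<Longrightarrow> h (ghost p R n x) = ghost p S n (h \<circ> x)"
  unfolding ghost_def by (rule hom_ipoly_eval)

lemma ghost_type_ring: "ghost p type_ring n x = witt_ghost p n (x :: nat \<Rightarrow> 'b::comm_ring_1)"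
  by (subst plain_cring.ghost_eq) (auto simp: plain_cring_def cring_type_ring witt_ghost_def)

lemma ipoly_ghost_inj:
  fixes X Y :: "nat \<Rightarrow> 'v ipoly"
  assumes "p > 0" "\<And>n. witt_ghost p n X = witt_ghost p n Y"
  shows "X = Y"
proof (rule plain_cring.ghost_inj[of type_ring])
  show "plain_cring (type_ring :: 'v ipoly ring)" by (intro plain_cringI cring_type_ring)
  show "a = \<zero>\<^bsub>type_ring\<^esub>" if "[p] \<cdot>\<^bsub>type_ring\<^esub> a = \<zero>\<^bsub>type_ring\<^esub>" for a :: "'v ipoly"
    using ipoly_torsion_free[of "int p" a] that assms by simp
qed (use assms in \<open>auto simp: ghost_type_ring\<close>)

text \<open>Dwork's lemma gives existence and torsion-freeness of the polynomial ring gives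
  uniqueness, so the definite descriptions denote the intended polynomials.\<close>

lemma
  fixes p :: nat
  assumes p: "prime p"
  shows witt_add_poly: "witt_ghost p n (witt_add_poly p) =
      witt_ghost p n (\<lambda>i. ipoly_var (Inl i)) + witt_ghost p n (\<lambda>i. ipoly_var (Inr i))"
    and witt_mult_poly: "witt_ghost p n (witt_mult_poly p) =
      witt_ghost p n (\<lambda>i. ipoly_var (Inl i)) * witt_ghost p n (\<lambda>i. ipoly_var (Inr i))"
proof -
  interpret frobenius_lift p "ipoly_eval type_ring (\<lambda>v. ipoly_var v ^ p) :: (nat + nat) ipoly \<Rightarrow> _"
    by (rule frobenius_lift_ipoly[OF p])
  have ex1: "\<exists>!X. \<forall>n. witt_ghost p n X = g n" if "dwork g" for g
    using dwork_is_ghost[OF that] ipoly_ghost_inj[of p] prime_gt_0_nat[OF p] by (metis (no_types, lifting))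
  show "witt_ghost p n (witt_add_poly p) =
      witt_ghost p n (\<lambda>i. ipoly_var (Inl i)) + witt_ghost p n (\<lambda>i. ipoly_var (Inr i))"
    using theI'[OF ex1[OF dwork_add[OF dwork_ghost dwork_ghost]]] unfolding witt_add_poly_def by blast
  show "witt_ghost p n (witt_mult_poly p) =
      witt_ghost p n (\<lambda>i. ipoly_var (Inl i)) * witt_ghost p n (\<lambda>i. ipoly_var (Inr i))"
    using theI'[OF ex1[OF dwork_mult[OF dwork_ghost dwork_ghost]]] unfolding witt_mult_poly_def by blast
qed

lemma witt_simps:
  "carrier (witt p A) = {x. range x \<subseteq> carrier A}"
  "x \<otimes>\<^bsub>witt p A\<^esub> y = (\<lambda>n. ipoly_eval A (case_sum x y) (witt_mult_poly p n))"
  "\<one>\<^bsub>witt p A\<^esub> = teich A \<one>\<^bsub>A\<^esub>"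
  "\<zero>\<^bsub>witt p A\<^esub> = teich A \<zero>\<^bsub>A\<^esub>"
  "x \<oplus>\<^bsub>witt p A\<^esub> y = (\<lambda>n. ipoly_eval A (case_sum x y) (witt_add_poly p n))"
  by (auto simp: witt_def teich_def)

lemma in_witt_iff: "x \<in> carrier (witt p A) \<longleftrightarrow> range x \<subseteq> carrier A"
  by (simp add: witt_simps)

lemma witt_component: "x \<in> carrier (witt p A) \<Longrightarrow> x i \<in> carrier A"
  by (auto simp: witt_simps)

lemma range_case_sum: "range (case_sum x y) = range x \<union> range y"
  by (force split: sum.splits simp: image_iff)

context plain_cring
begin

lemma witt_add_closed: "x \<in> carrier (witt p R) \<Longrightarrow> y \<in> carrier (witt p R) \<Longrightarrow> x \<oplus>\<^bsub>witt p R\<^esub> y \<in> carrier (witt p R)"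
  by (auto simp: witt_simps range_case_sum)

lemma witt_mult_closed: "x \<in> carrier (witt p R) \<Longrightarrow> y \<in> carrier (witt p R) \<Longrightarrow> x \<otimes>\<^bsub>witt p R\<^esub> y \<in> carrier (witt p R)"
  by (auto simp: witt_simps range_case_sum)

lemma teich_closed [simp]: "a \<in> carrier R \<Longrightarrow> teich R a \<in> carrier (witt p R)"
  by (auto simp: witt_simps teich_def)

text \<open>The universal identities between ghost polynomials are evaluated at the components of
  \<open>x\<close> and \<open>y\<close>; this works over any commutative ring.\<close>

lemma
  assumes p: "prime p" and x: "x \<in> carrier (witt p R)" and y: "y \<in> carrier (witt p R)"
  shows ghost_add: "ghost p R n (x \<oplus>\<^bsub>witt p R\<^esub> y) = ghost p R n x \<oplus> ghost p R n y"
    and ghost_mult: "ghost p R n (x \<otimes>\<^bsub>witt p R\<^esub> y) = ghost p R n x \<otimes> ghost p R n y"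
proof -
  have xy: "range (case_sum x y) \<subseteq> carrier R" using x y by (simp add: in_witt_iff range_case_sum)
  interpret type_hom R "ipoly_eval R (case_sum x y)" by (rule ipoly_eval_type_hom[OF xy])
  interpret rh: plain_ring_hom "type_ring :: (nat + nat) ipoly ring" R "ipoly_eval R (case_sum x y)"
    by (intro plain_ring_homI cring_type_ring cring_axioms h)
  have comp: "ipoly_eval R (case_sum x y) (witt_ghost p n X) = ghost p R n (ipoly_eval R (case_sum x y) \<circ> X)" for X
    using rh.hom_ghost[of X p n] by (simp add: ghost_type_ring)
  have l: "ipoly_eval R (case_sum x y) \<circ> (\<lambda>i. ipoly_var (Inl i)) = x"
    and r: "ipoly_eval R (case_sum x y) \<circ> (\<lambda>i. ipoly_var (Inr i)) = y"
    by (auto simp: ipoly_eval_var[OF xy])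
  have "ghost p R n (x \<oplus>\<^bsub>witt p R\<^esub> y) = ipoly_eval R (case_sum x y) (witt_ghost p n (witt_add_poly p))"
    unfolding comp by (simp add: witt_simps comp_def)
  then show "ghost p R n (x \<oplus>\<^bsub>witt p R\<^esub> y) = ghost p R n x \<oplus> ghost p R n y"
    unfolding witt_add_poly[OF p] h_add comp l r .
  have "ghost p R n (x \<otimes>\<^bsub>witt p R\<^esub> y) = ipoly_eval R (case_sum x y) (witt_ghost p n (witt_mult_poly p))"
    unfolding comp by (simp add: witt_simps comp_def)
  then show "ghost p R n (x \<otimes>\<^bsub>witt p R\<^esub> y) = ghost p R n x \<otimes> ghost p R n y"
    unfolding witt_mult_poly[OF p] h_mult comp l r .
qed

lemma ghost_teich:
  assumes "p > 0" "a \<in> carrier R"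
  shows "ghost p R n (teich R a) = a [^] (p ^ n)"
proof -
  have r: "range (teich R a) \<subseteq> carrier R" using assms by (auto simp: teich_def)
  have "(\<Oplus>i\<in>{..n}. [(p ^ i)] \<cdot> \<one> \<otimes> teich R a i [^] (p ^ (n - i))) =
      (\<Oplus>i\<in>{..n}. if 0 = i then a [^] (p ^ n) else \<zero>)"
    using assms by (intro finsum_cong') (auto simp: teich_def nat_pow_zero)
  also have "\<dots> = a [^] (p ^ n)" using assms by (subst finsum_singleton) auto
  finally show ?thesis unfolding ghost_eq[OF r] .
qed

lemma ghost_one: "p > 0 \<Longrightarrow> ghost p R n \<one>\<^bsub>witt p R\<^esub> = \<one>"
  by (simp add: witt_simps ghost_teich)

lemma ghost_zero: "p > 0 \<Longrightarrow> ghost p R n \<zero>\<^bsub>witt p R\<^esub> = \<zero>"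
  by (simp add: witt_simps ghost_teich nat_pow_zero)

end

section \<open>Functoriality of Witt vectors and the ring axioms\<close>

context plain_ring_hom
begin

lemma witt_hom_closed: "x \<in> carrier (witt p R) \<Longrightarrow> h \<circ> x \<in> carrier (witt p S)"
  by (auto simp: in_witt_iff)

lemma
  assumes "x \<in> carrier (witt p R)" "y \<in> carrier (witt p R)"
  shows witt_hom_add: "h \<circ> (x \<oplus>\<^bsub>witt p R\<^esub> y) = (h \<circ> x) \<oplus>\<^bsub>witt p S\<^esub> (h \<circ> y)"
    and witt_hom_mult: "h \<circ> (x \<otimes>\<^bsub>witt p R\<^esub> y) = (h \<circ> x) \<otimes>\<^bsub>witt p S\<^esub> (h \<circ> y)"
proof -
  have xy: "range (case_sum x y) \<subseteq> carrier R" using assms by (simp add: in_witt_iff range_case_sum)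
  have "h \<circ> case_sum x y = case_sum (h \<circ> x) (h \<circ> y)" by (auto split: sum.splits)
  then show "h \<circ> (x \<oplus>\<^bsub>witt p R\<^esub> y) = (h \<circ> x) \<oplus>\<^bsub>witt p S\<^esub> (h \<circ> y)"
    "h \<circ> (x \<otimes>\<^bsub>witt p R\<^esub> y) = (h \<circ> x) \<otimes>\<^bsub>witt p S\<^esub> (h \<circ> y)"
    by (simp_all add: witt_simps comp_def hom_ipoly_eval[OF xy])
qed

lemma hom_teich: "a \<in> carrier R \<Longrightarrow> h \<circ> teich R a = teich S (h a)"
  by (auto simp: teich_def)

lemma witt_hom: "(\<lambda>x. h \<circ> x) \<in> ring_hom (witt p R) (witt p S)"
proof (rule ring_hom_memI)
  show "h \<circ> \<one>\<^bsub>witt p R\<^esub> = \<one>\<^bsub>witt p S\<^esub>" by (simp add: witt_simps hom_teich)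
qed (rule witt_hom_closed witt_hom_add witt_hom_mult; assumption)+

end

text \<open>Over a torsion-free ring the ghost map is injective, so equational axioms are inherited
  from it. Negatives are an existence statement and use Dwork's lemma: negated ghost components
  still satisfy the congruences.\<close>

lemma cring_witt_ipoly:
  assumes p: "prime p"
  shows "cring (witt p (type_ring :: 'v ipoly ring))"
proof -
  interpret T: plain_cring "type_ring :: 'v ipoly ring" by (intro plain_cringI cring_type_ring)
  interpret F: frobenius_lift p "ipoly_eval type_ring (\<lambda>v. ipoly_var v ^ p) :: 'v ipoly \<Rightarrow> _"
    by (rule frobenius_lift_ipoly[OF p])
  let ?W = "witt p (type_ring :: 'v ipoly ring)"
  have [simp]: "carrier ?W = UNIV" by (simp add: witt_simps)
  have add: "witt_ghost p n (x \<oplus>\<^bsub>?W\<^esub> y) = witt_ghost p n x + witt_ghost p n y" for n x y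
    using T.ghost_add[OF p, of x y n] by (simp add: ghost_type_ring)
  have mult: "witt_ghost p n (x \<otimes>\<^bsub>?W\<^esub> y) = witt_ghost p n x * witt_ghost p n y" for n x y
    using T.ghost_mult[OF p, of x y n] by (simp add: ghost_type_ring)
  have one: "witt_ghost p n \<one>\<^bsub>?W\<^esub> = 1" and zero: "witt_ghost p n \<zero>\<^bsub>?W\<^esub> = 0" for n
    using T.ghost_one[of p n] T.ghost_zero[of p n] prime_gt_0_nat[OF p] by (simp_all add: ghost_type_ring)
  have inj: "x = y" if "\<And>n. witt_ghost p n x = witt_ghost p n y" for x y :: "nat \<Rightarrow> 'v ipoly"
    by (rule ipoly_ghost_inj[OF prime_gt_0_nat[OF p] that])
  have neg: "\<exists>y. y \<oplus>\<^bsub>?W\<^esub> x = \<zero>\<^bsub>?W\<^esub>" for x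
  proof -
    obtain y where "\<forall>n. witt_ghost p n y = - witt_ghost p n x"
      using F.dwork_is_ghost[OF F.dwork_uminus[OF F.dwork_ghost]] by blast
    then show ?thesis by (intro exI[of _ y] inj) (simp add: add zero)
  qed
  show ?thesis
  proof (rule cringI)
    show "abelian_group ?W"
    proof (rule abelian_groupI)
      show "\<exists>y\<in>carrier ?W. y \<oplus>\<^bsub>?W\<^esub> x = \<zero>\<^bsub>?W\<^esub>" for x using neg by simp
    qed (auto intro!: inj simp: add zero algebra_simps)
    show "comm_monoid ?W"
      by (rule comm_monoidI) (auto intro!: inj simp: mult one algebra_simps)
  qed (auto intro!: inj simp: add mult algebra_simps)
qed

text \<open>The variable (k, i) stands for component i of the k-th vector, so that several Witt
  vectors are lifted by one and the same homomorphism.\<close>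

lemma (in plain_cring) obtain_ipoly_hom:
  fixes x :: "nat \<Rightarrow> nat \<Rightarrow> 'a"
  assumes "\<And>k i. x k i \<in> carrier R"
  obtains h and X :: "nat \<Rightarrow> nat \<Rightarrow> (nat \<times> nat) ipoly" where
    "plain_ring_hom type_ring R h" "\<And>k. h \<circ> X k = x k"
proof
  let ?f = "\<lambda>(k, i). x k i"
  have f: "range ?f \<subseteq> carrier R" using assms by auto
  show "plain_ring_hom type_ring R (ipoly_eval R ?f)"
    by (intro plain_ring_homI cring_type_ring cring_axioms ipoly_eval_hom f)
  show "ipoly_eval R ?f \<circ> (\<lambda>i. ipoly_var (k, i)) = x k" for k
    by (auto simp: ipoly_eval_var[OF f])
qed

context plain_cring
begin

text \<open>Ghost components are not injective over a general ring. The axioms are transported from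
  a polynomial ring over the integers: any vectors are images of vectors of variables.\<close>

lemma cring_witt:
  assumes p: "prime p"
  shows "cring (witt p R)"
proof -
  let ?U = "witt p (type_ring :: (nat \<times> nat) ipoly ring)" and ?W = "witt p R"
  interpret U: cring ?U by (rule cring_witt_ipoly[OF p])
  have [simp]: "carrier ?U = UNIV" by (simp add: witt_simps)
  have lift: "\<exists>h X Y Z. plain_ring_hom type_ring R h \<and> x = h \<circ> X \<and> y = h \<circ> Y \<and> z = h \<circ> (Z :: nat \<Rightarrow> (nat \<times> nat) ipoly)"
    if "x \<in> carrier ?W" "y \<in> carrier ?W" "z \<in> carrier ?W" for x y z
  proof -
    have "(if k = 0 then x else if k = 1 then y else z) i \<in> carrier R" for k i :: nat
      using that by (simp add: witt_component)
    then obtain h and X :: "nat \<Rightarrow> nat \<Rightarrow> (nat \<times> nat) ipoly" where h: "plain_ring_hom type_ring R h"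
      and X: "\<And>k. h \<circ> X k = (if k = 0 then x else if k = 1 then y else z)"
      using obtain_ipoly_hom[of "\<lambda>k. if k = 0 then x else if k = 1 then y else z"] by blast
    show ?thesis using h X[of 0] X[of 1] X[of 2] by (intro exI[of _ h] exI[of _ "X 0"] exI[of _ "X 1"] exI[of _ "X 2"]) simp
  qed
  have hom: "(h \<circ> X) \<oplus>\<^bsub>?W\<^esub> (h \<circ> Y) = h \<circ> (X \<oplus>\<^bsub>?U\<^esub> Y)" "(h \<circ> X) \<otimes>\<^bsub>?W\<^esub> (h \<circ> Y) = h \<circ> (X \<otimes>\<^bsub>?U\<^esub> Y)"
    "\<one>\<^bsub>?W\<^esub> = h \<circ> \<one>\<^bsub>?U\<^esub>" "\<zero>\<^bsub>?W\<^esub> = h \<circ> \<zero>\<^bsub>?U\<^esub>" if "plain_ring_hom type_ring R h" for h X Y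
  proof -
    interpret plain_ring_hom type_ring R h by (rule that)
    show "(h \<circ> X) \<oplus>\<^bsub>?W\<^esub> (h \<circ> Y) = h \<circ> (X \<oplus>\<^bsub>?U\<^esub> Y)" "(h \<circ> X) \<otimes>\<^bsub>?W\<^esub> (h \<circ> Y) = h \<circ> (X \<otimes>\<^bsub>?U\<^esub> Y)"
      by (simp_all add: witt_hom_add witt_hom_mult)
    show "\<one>\<^bsub>?W\<^esub> = h \<circ> \<one>\<^bsub>?U\<^esub>" "\<zero>\<^bsub>?W\<^esub> = h \<circ> \<zero>\<^bsub>?U\<^esub>"
      using hom_teich[of 1] hom_teich[of 0] hom_one hom_zero by (simp_all add: witt_simps)
  qed
  show ?thesis
  proof (rule cringI)
    show "abelian_group ?W"
    proof (rule abelian_groupI)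
      fix x y z assume x: "x \<in> carrier ?W" and y: "y \<in> carrier ?W" and z: "z \<in> carrier ?W"
      obtain h X Y Z where h: "plain_ring_hom type_ring R h"
        and XYZ: "x = h \<circ> X" "y = h \<circ> Y" "z = h \<circ> (Z :: nat \<Rightarrow> (nat \<times> nat) ipoly)"
        using lift[OF x y z] by blast
      show "x \<oplus>\<^bsub>?W\<^esub> y \<oplus>\<^bsub>?W\<^esub> z = x \<oplus>\<^bsub>?W\<^esub> (y \<oplus>\<^bsub>?W\<^esub> z)"
        unfolding XYZ hom[OF h] by (simp add: U.a_assoc)
    next
      fix x y assume x: "x \<in> carrier ?W" and y: "y \<in> carrier ?W"
      obtain h X Y Z where h: "plain_ring_hom type_ring R h"
        and XYZ: "x = h \<circ> X" "y = h \<circ> (Y :: nat \<Rightarrow> (nat \<times> nat) ipoly)"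
        using lift[OF x y y] by blast
      show "x \<oplus>\<^bsub>?W\<^esub> y = y \<oplus>\<^bsub>?W\<^esub> x"
        unfolding XYZ hom[OF h] by (simp add: U.a_comm)
    next
      fix x assume x: "x \<in> carrier ?W"
      obtain h X where h: "plain_ring_hom type_ring R h" and X: "x = h \<circ> (X :: nat \<Rightarrow> (nat \<times> nat) ipoly)"
        using lift[OF x x x] by blast
      show "\<zero>\<^bsub>?W\<^esub> \<oplus>\<^bsub>?W\<^esub> x = x" unfolding X hom(4)[OF h] hom[OF h] by simp
      have "h \<circ> (\<ominus>\<^bsub>?U\<^esub> X) \<in> carrier ?W" by (rule plain_ring_hom.witt_hom_closed[OF h]) simp
      moreover have "(h \<circ> (\<ominus>\<^bsub>?U\<^esub> X)) \<oplus>\<^bsub>?W\<^esub> x = \<zero>\<^bsub>?W\<^esub>"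
        unfolding X hom(4)[OF h] hom(1)[OF h] by (simp add: U.l_neg)
      ultimately show "\<exists>y\<in>carrier ?W. y \<oplus>\<^bsub>?W\<^esub> x = \<zero>\<^bsub>?W\<^esub>" by blast
    qed (auto simp: witt_add_closed witt_simps(4))
    show "comm_monoid ?W"
    proof (rule comm_monoidI)
      fix x y z assume x: "x \<in> carrier ?W" and y: "y \<in> carrier ?W" and z: "z \<in> carrier ?W"
      obtain h X Y Z where h: "plain_ring_hom type_ring R h"
        and XYZ: "x = h \<circ> X" "y = h \<circ> Y" "z = h \<circ> (Z :: nat \<Rightarrow> (nat \<times> nat) ipoly)"
        using lift[OF x y z] by blast
      show "x \<otimes>\<^bsub>?W\<^esub> y \<otimes>\<^bsub>?W\<^esub> z = x \<otimes>\<^bsub>?W\<^esub> (y \<otimes>\<^bsub>?W\<^esub> z)"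
        unfolding XYZ hom[OF h] by (simp add: U.m_assoc)
    next
      fix x y assume x: "x \<in> carrier ?W" and y: "y \<in> carrier ?W"
      obtain h X Y Z where h: "plain_ring_hom type_ring R h"
        and XYZ: "x = h \<circ> X" "y = h \<circ> (Y :: nat \<Rightarrow> (nat \<times> nat) ipoly)"
        using lift[OF x y y] by blast
      show "x \<otimes>\<^bsub>?W\<^esub> y = y \<otimes>\<^bsub>?W\<^esub> x"
        unfolding XYZ hom[OF h] by (simp add: U.m_comm)
    next
      fix x assume x: "x \<in> carrier ?W"
      obtain h X where h: "plain_ring_hom type_ring R h" and X: "x = h \<circ> (X :: nat \<Rightarrow> (nat \<times> nat) ipoly)"
        using lift[OF x x x] by blast
      show "\<one>\<^bsub>?W\<^esub> \<otimes>\<^bsub>?W\<^esub> x = x" unfolding X hom(3)[OF h] hom[OF h] by simp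
    qed (auto simp: witt_mult_closed witt_simps(3))
    fix x y z assume x: "x \<in> carrier ?W" and y: "y \<in> carrier ?W" and z: "z \<in> carrier ?W"
    obtain h X Y Z where h: "plain_ring_hom type_ring R h"
      and XYZ: "x = h \<circ> X" "y = h \<circ> Y" "z = h \<circ> (Z :: nat \<Rightarrow> (nat \<times> nat) ipoly)"
      using lift[OF x y z] by blast
    show "(x \<oplus>\<^bsub>?W\<^esub> y) \<otimes>\<^bsub>?W\<^esub> z = x \<otimes>\<^bsub>?W\<^esub> z \<oplus>\<^bsub>?W\<^esub> y \<otimes>\<^bsub>?W\<^esub> z"
      unfolding XYZ hom[OF h] by (simp add: U.l_distr)
  qed
qed

text \<open>The identity is checked on ghost components over a polynomial ring, where both sides
  give (cd)^(p^n), and is then specialized.\<close>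

lemma teich_mult:
  assumes p: "prime p" and ab: "a \<in> carrier R" "b \<in> carrier R"
  shows "teich R a \<otimes>\<^bsub>witt p R\<^esub> teich R b = teich R (a \<otimes> b)"
proof -
  \<comment> \<open>Each operand enters as a constant family; entry 0 of the lifted family then
    lifts \<open>a\<close> or \<open>b\<close>.\<close>
  have "(if k = 0 then (\<lambda>_. a) else (\<lambda>_. b)) i \<in> carrier R" for k i :: nat using ab by simp
  then obtain h and X :: "nat \<Rightarrow> nat \<Rightarrow> (nat \<times> nat) ipoly" where h: "plain_ring_hom type_ring R h"
      and X: "\<And>k. h \<circ> X k = (if k = 0 then (\<lambda>_. a) else (\<lambda>_. b))"
    using obtain_ipoly_hom[of "\<lambda>k::nat. if k = 0 then (\<lambda>_::nat. a) else (\<lambda>_. b)"] by blast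
  interpret h: plain_ring_hom type_ring R h by (rule h)
  interpret T: plain_cring "type_ring :: (nat \<times> nat) ipoly ring" by (intro plain_cringI cring_type_ring)
  let ?T = "type_ring :: (nat \<times> nat) ipoly ring"
  define c d where "c = X 0 0" and "d = X 1 0"
  have cd: "a = h c" "b = h d" using fun_cong[OF X, of 0 0] fun_cong[OF X, of 1 0] by (simp_all add: c_def d_def)
  have "teich ?T c \<otimes>\<^bsub>witt p ?T\<^esub> teich ?T d = teich ?T (c * d)"
  proof (rule ipoly_ghost_inj)
    fix n
    have [simp]: "x \<in> carrier (witt p ?T)" for x by (simp add: in_witt_iff)
    show "witt_ghost p n (teich ?T c \<otimes>\<^bsub>witt p ?T\<^esub> teich ?T d) = witt_ghost p n (teich ?T (c * d))"
      unfolding ghost_type_ring[symmetric]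
      by (simp add: T.ghost_mult[OF p] T.ghost_teich[OF prime_gt_0_nat[OF p]] power_mult_distrib)
  qed (use p prime_gt_0_nat in blast)
  from arg_cong[OF this, of "\<lambda>x. h \<circ> x"] show ?thesis
    unfolding cd using h.hom_mult[of c d]
    by (simp add: h.witt_hom_mult in_witt_iff h.hom_teich[unfolded type_ring_simps])
qed

lemma teich_pow:
  assumes p: "prime p" and a: "a \<in> carrier R"
  shows "teich R a [^]\<^bsub>witt p R\<^esub> (n::nat) = teich R (a [^] n)"
proof -
  interpret W: cring "witt p R" by (rule cring_witt[OF p])
  show ?thesis by (induction n) (simp_all add: witt_simps(3) teich_mult p a)
qed

end

section \<open>The \<open>p\<close>-adic integers\<close>

text \<open>Cancelling n costs v_p(n) factors p, and v_p(n) < p^(v_p(n)) <= n. The crude bound n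
  keeps valuations out of later statements.\<close>

lemma prime_power_dvd_cancel:
  fixes c :: int
  assumes p: "prime p" and n: "n > 0" and dvd: "int p ^ (k + n) dvd int n * c"
  shows "int p ^ k dvd c"
proof (cases "c = 0")
  case False
  have p': "prime (int p)" using p by simp
  have "k + n \<le> multiplicity (int p) (int n * c)"
    by (rule multiplicity_geI[OF _ _ dvd]) (use n False p' in \<open>auto simp: not_prime_unit\<close>)
  also have "\<dots> = multiplicity (int p) (int n) + multiplicity (int p) c"
    using p' n False by (simp add: prime_elem_multiplicity_mult_distrib)
  also have "multiplicity (int p) (int n) < n"
  proof -
    have "int p ^ multiplicity (int p) (int n) \<le> int n"
      using n by (intro zdvd_imp_le multiplicity_dvd) auto
    then have "p ^ multiplicity (int p) (int n) \<le> n" by (simp flip: of_nat_power)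
    moreover have "m < p ^ m" for m using p prime_gt_1_nat power_gt_expt by auto
    ultimately show ?thesis using less_le_trans by blast
  qed
  finally have "k \<le> multiplicity (int p) c" by simp
  then show ?thesis by (rule multiplicity_dvd')
qed simp

lemma Zp_simps:
  "a \<otimes>\<^bsub>Zp p\<^esub> b = (\<lambda>k. (a k * b k) mod int p ^ k)" "\<one>\<^bsub>Zp p\<^esub> = (\<lambda>k. 1 mod int p ^ k)"
  "\<zero>\<^bsub>Zp p\<^esub> = (\<lambda>k. 0)" "a \<oplus>\<^bsub>Zp p\<^esub> b = (\<lambda>k. (a k + b k) mod int p ^ k)"
  by (simp_all add: Zp_def)

lemma Zp_memI:
  assumes "p > 0" "\<And>k. F (Suc k) mod int p ^ k = F k mod int p ^ k"
  shows "(\<lambda>k. F k mod int p ^ k) \<in> carrier (Zp p)"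
  using assms by (simp add: Zp_def mod_mod_cancel)

lemma Zp_Suc: "a \<in> carrier (Zp p) \<Longrightarrow> a (Suc k) mod int p ^ k = a k"
  by (simp add: Zp_def)

lemma Zp_mod: "a \<in> carrier (Zp p) \<Longrightarrow> a k mod int p ^ k = a k"
  by (simp add: Zp_def)

lemma Zp_le: "a \<in> carrier (Zp p) \<Longrightarrow> k \<le> l \<Longrightarrow> a l mod int p ^ k = a k"
proof (induction l)
  case 0
  then show ?case using Zp_mod[of a p 0] by simp
next
  case (Suc l)
  show ?case
  proof (cases "k = Suc l")
    case True
    show ?thesis unfolding True by (rule Zp_mod[OF Suc.prems(1)])
  next
    case False
    then have "k \<le> l" using Suc.prems by simp
    moreover have "a (Suc l) mod int p ^ k = (a (Suc l) mod int p ^ l) mod int p ^ k"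
      using \<open>k \<le> l\<close> by (simp add: mod_mod_cancel le_imp_power_dvd)
    ultimately show ?thesis using Suc Zp_Suc[OF Suc.prems(1)] by simp
  qed
qed

lemma Zp_nonneg: "a \<in> carrier (Zp p) \<Longrightarrow> 0 \<le> a k"
  by (simp add: Zp_def)

lemma cring_Zp:
  assumes p: "p > 0"
  shows "cring (Zp p)"
proof -
  \<comment> \<open>Any operation compatible with reduction modulo every integer preserves coherent
    sequences; addition, multiplication and negation are instances.\<close>
  have closed: "(\<lambda>k. (f (a k) (b k)) mod int p ^ k) \<in> carrier (Zp p)"
    if "a \<in> carrier (Zp p)" "b \<in> carrier (Zp p)"
      "\<And>x y m. f x y mod m = f (x mod m) (y mod m) mod m" for a b f
    by (rule Zp_memI[OF p]) (metis that Zp_Suc Zp_mod)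
  have add: "a \<oplus>\<^bsub>Zp p\<^esub> b \<in> carrier (Zp p)" and mult: "a \<otimes>\<^bsub>Zp p\<^esub> b \<in> carrier (Zp p)"
    if "a \<in> carrier (Zp p)" "b \<in> carrier (Zp p)" for a b
    unfolding Zp_simps by (intro closed that; simp add: mod_simps)+
  have neg: "(\<lambda>k. (- a k) mod int p ^ k) \<in> carrier (Zp p)" if "a \<in> carrier (Zp p)" for a
    using closed[OF that that, of "\<lambda>x _. - x"] by (simp add: mod_simps)
  show ?thesis
  proof (rule cringI)
    show "abelian_group (Zp p)"
    proof (rule abelian_groupI)
      fix x assume x: "x \<in> carrier (Zp p)"
      show "\<exists>y\<in>carrier (Zp p). y \<oplus>\<^bsub>Zp p\<^esub> x = \<zero>\<^bsub>Zp p\<^esub>"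
        by (rule bexI[OF _ neg[OF x]]) (simp add: Zp_simps mod_simps)
      show "\<zero>\<^bsub>Zp p\<^esub> \<oplus>\<^bsub>Zp p\<^esub> x = x" using x by (auto simp: Zp_simps Zp_mod)
    next
      show "\<zero>\<^bsub>Zp p\<^esub> \<in> carrier (Zp p)" using p by (simp add: Zp_def)
    qed (auto simp: add, auto simp: Zp_simps mod_simps algebra_simps)
    show "comm_monoid (Zp p)"
    proof (rule comm_monoidI)
      show "\<one>\<^bsub>Zp p\<^esub> \<in> carrier (Zp p)" unfolding Zp_simps by (rule Zp_memI[OF p]) simp
      fix x assume x: "x \<in> carrier (Zp p)"
      show "\<one>\<^bsub>Zp p\<^esub> \<otimes>\<^bsub>Zp p\<^esub> x = x" using x by (auto simp: Zp_simps Zp_mod mod_simps)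
    qed (auto simp: mult, auto simp: Zp_simps mod_simps algebra_simps)
  qed (auto simp: Zp_simps mod_simps algebra_simps)
qed

lemma Zp_add_pow_nat:
  assumes "a \<in> carrier (Zp p)" "p > 0"
  shows "[(n::nat)] \<cdot>\<^bsub>Zp p\<^esub> a = (\<lambda>k. (int n * a k) mod int p ^ k)"
proof -
  interpret cring "Zp p" by (rule cring_Zp[OF assms(2)])
  show ?thesis by (induction n) (simp_all add: assms Zp_simps mod_simps algebra_simps)
qed

text \<open>Division by n loses at most n levels, so component k is controlled by the equation at
  level k + n.\<close>

lemma Zp_torsion_free:
  assumes p: "prime p" and n: "n > 0" and a: "a \<in> carrier (Zp p)" and eq: "[(n::nat)] \<cdot>\<^bsub>Zp p\<^esub> a = \<zero>\<^bsub>Zp p\<^esub>"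
  shows "a = \<zero>\<^bsub>Zp p\<^esub>"
proof
  fix k
  have "(int n * a (k + n)) mod int p ^ (k + n) = 0"
    using fun_cong[OF eq, of "k + n"] a prime_gt_0_nat[OF p] by (simp add: Zp_add_pow_nat Zp_simps)
  then have "int p ^ k dvd a (k + n)"
    by (rule prime_power_dvd_cancel[OF p n, OF mod_0_imp_dvd])
  then have "a k = 0" using Zp_le[OF a, of k "k + n"] by simp
  then show "a k = \<zero>\<^bsub>Zp p\<^esub> k" by (simp add: Zp_simps)
qed

section \<open>Power series\<close>

lemma ps_ring_simps:
  "carrier (ps_ring A) = {f. \<forall>i. f i \<in> carrier A}"
  "f \<otimes>\<^bsub>ps_ring A\<^esub> g = (\<lambda>n. \<Oplus>\<^bsub>A\<^esub>i\<in>{..n}. f i \<otimes>\<^bsub>A\<^esub> g (n - i))"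
  "\<one>\<^bsub>ps_ring A\<^esub> = (\<lambda>n. if n = 0 then \<one>\<^bsub>A\<^esub> else \<zero>\<^bsub>A\<^esub>)"
  "\<zero>\<^bsub>ps_ring A\<^esub> = (\<lambda>n. \<zero>\<^bsub>A\<^esub>)"
  "f \<oplus>\<^bsub>ps_ring A\<^esub> g = (\<lambda>n. f n \<oplus>\<^bsub>A\<^esub> g n)"
  by (simp_all add: ps_ring_def)

context type_hom
begin

text \<open>Connects the record of power series with the type \<open>fps\<close>, whose ring laws
  are thereby available.\<close>

lemma fps_coeff_op:
  "(\<lambda>n. h (fps_nth (F + G) n)) = (\<lambda>n. h (fps_nth F n)) \<oplus>\<^bsub>ps_ring A\<^esub> (\<lambda>n. h (fps_nth G n))"
  "(\<lambda>n. h (fps_nth (F * G) n)) = (\<lambda>n. h (fps_nth F n)) \<otimes>\<^bsub>ps_ring A\<^esub> (\<lambda>n. h (fps_nth G n))"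
  "(\<lambda>n. h (fps_nth 1 n)) = \<one>\<^bsub>ps_ring A\<^esub>"
  by (auto simp: ps_ring_simps h_add fps_mult_nth h_sum h_mult atLeast0AtMost h_one h_zero)

lemma fps_coeff_hom: "(\<lambda>F n. h (fps_nth F n)) \<in> ring_hom type_ring (ps_ring A)"
  by (rule ring_hom_memI) (simp_all add: fps_coeff_op[unfolded fps_add_nth fps_one_nth] ps_ring_simps(1))

end

context plain_cring
begin

lemma obtain_ipoly_type_hom:
  fixes x :: "nat \<Rightarrow> nat \<Rightarrow> 'a"
  assumes "\<And>k i. x k i \<in> carrier R"
  obtains h and X :: "nat \<Rightarrow> nat \<Rightarrow> (nat \<times> nat) ipoly" where
    "type_hom R h" "\<And>k i. x k i = h (X k i)"
proof -
  obtain h and X :: "nat \<Rightarrow> nat \<Rightarrow> (nat \<times> nat) ipoly" where h: "plain_ring_hom type_ring R h" and X: "\<And>k. h \<circ> X k = x k"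
    using obtain_ipoly_hom[of x] assms by metis
  interpret h: plain_ring_hom type_ring R h by (rule h)
  show thesis
  proof (rule that)
    show "type_hom R h" by (rule type_homI[OF cring_axioms h.homh])
    show "x k i = h (X k i)" for k i using fun_cong[OF X[of k], of i] by simp
  qed
qed

text \<open>As for Witt vectors, multiplicative identities are transported from the universal case:
  three series over the ring are coefficientwise images of series over an integer polynomial
  ring.\<close>

lemma cring_ps_ring: "cring (ps_ring R)"
proof -
  have closed: "f \<otimes>\<^bsub>ps_ring R\<^esub> g \<in> carrier (ps_ring R)"
    if "f \<in> carrier (ps_ring R)" "g \<in> carrier (ps_ring R)" for f g
    using that by (auto simp: ps_ring_simps intro!: finsum_closed)
  have lift: "\<exists>h F G H. type_hom R h \<and> f = (\<lambda>n. h (fps_nth F n)) \<and> g = (\<lambda>n. h (fps_nth G n)) \<and>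
     k = (\<lambda>n. h (fps_nth (H :: (nat \<times> nat) ipoly fps) n))"
    if "f \<in> carrier (ps_ring R)" "g \<in> carrier (ps_ring R)" "k \<in> carrier (ps_ring R)" for f g k
  proof -
    have "(if j = 0 then f else if j = 1 then g else k) i \<in> carrier R" for j i :: nat
      using that by (simp add: ps_ring_simps)
    then obtain h and X :: "nat \<Rightarrow> nat \<Rightarrow> (nat \<times> nat) ipoly" where h: "type_hom R h"
      and X: "\<And>j i. (if j = 0 then f else if j = 1 then g else k) i = h (X j i)"
      using obtain_ipoly_type_hom[of "\<lambda>j. if j = 0 then f else if j = 1 then g else k"] by blast
    show ?thesis using h X[of 0] X[of 1] X[of 2]
      by (intro exI[of _ h] exI[of _ "Abs_fps (X 0)"] exI[of _ "Abs_fps (X 1)"] exI[of _ "Abs_fps (X 2)"]) auto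
  qed
  show ?thesis
  proof (rule cringI)
    show "abelian_group (ps_ring R)"
    proof (rule abelian_groupI)
      fix x assume x: "x \<in> carrier (ps_ring R)"
      show "\<exists>y\<in>carrier (ps_ring R). y \<oplus>\<^bsub>ps_ring R\<^esub> x = \<zero>\<^bsub>ps_ring R\<^esub>"
        using x by (intro bexI[of _ "\<lambda>i. \<ominus> x i"]) (auto simp: ps_ring_simps l_neg)
    qed (auto simp: ps_ring_simps a_ac)
    show "comm_monoid (ps_ring R)"
    proof (rule comm_monoidI)
      fix x y z assume "x \<in> carrier (ps_ring R)" "y \<in> carrier (ps_ring R)" "z \<in> carrier (ps_ring R)"
      from lift[OF this] obtain h F G H where h: "type_hom R h" and eq: "x = (\<lambda>n. h (fps_nth F n))"
        "y = (\<lambda>n. h (fps_nth G n))" "z = (\<lambda>n. h (fps_nth (H :: (nat \<times> nat) ipoly fps) n))" by blast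
      show "x \<otimes>\<^bsub>ps_ring R\<^esub> y \<otimes>\<^bsub>ps_ring R\<^esub> z = x \<otimes>\<^bsub>ps_ring R\<^esub> (y \<otimes>\<^bsub>ps_ring R\<^esub> z)"
        unfolding eq type_hom.fps_coeff_op[OF h, symmetric] by (simp only: mult.assoc)
    next
      fix x y assume xy: "x \<in> carrier (ps_ring R)" "y \<in> carrier (ps_ring R)"
      from lift[OF this(1,2,2)] obtain h F G where h: "type_hom R h" and eq: "x = (\<lambda>n. h (fps_nth F n))"
        "y = (\<lambda>n. h (fps_nth (G :: (nat \<times> nat) ipoly fps) n))" by blast
      show "x \<otimes>\<^bsub>ps_ring R\<^esub> y = y \<otimes>\<^bsub>ps_ring R\<^esub> x"
        unfolding eq type_hom.fps_coeff_op[OF h, symmetric] by (simp only: mult.commute)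
    next
      fix x assume x: "x \<in> carrier (ps_ring R)"
      from lift[OF x x x] obtain h F where h: "type_hom R h" and eq: "x = (\<lambda>n. h (fps_nth (F :: (nat \<times> nat) ipoly fps) n))"
        by blast
      show "\<one>\<^bsub>ps_ring R\<^esub> \<otimes>\<^bsub>ps_ring R\<^esub> x = x"
        unfolding eq type_hom.fps_coeff_op(3)[OF h, symmetric] type_hom.fps_coeff_op(2)[OF h, symmetric] by simp
    qed (auto simp: closed, auto simp: ps_ring_simps)
    fix x y z assume "x \<in> carrier (ps_ring R)" "y \<in> carrier (ps_ring R)" "z \<in> carrier (ps_ring R)"
    from lift[OF this] obtain h F G H where h: "type_hom R h" and eq: "x = (\<lambda>n. h (fps_nth F n))"
      "y = (\<lambda>n. h (fps_nth G n))" "z = (\<lambda>n. h (fps_nth (H :: (nat \<times> nat) ipoly fps) n))" by blast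
    show "(x \<oplus>\<^bsub>ps_ring R\<^esub> y) \<otimes>\<^bsub>ps_ring R\<^esub> z = x \<otimes>\<^bsub>ps_ring R\<^esub> z \<oplus>\<^bsub>ps_ring R\<^esub> y \<otimes>\<^bsub>ps_ring R\<^esub> z"
      unfolding eq type_hom.fps_coeff_op[OF h, symmetric] by (simp only: distrib_right)
  qed
qed

text \<open>Replaces the least vanishing exponent by any vanishing one, so that several series can
  be truncated at a common N.\<close>

lemma ps_eval_bound:
  assumes f: "f \<in> carrier (ps_ring R)" and z: "z \<in> carrier R" and N: "z [^] (N::nat) = \<zero>"
  shows "ps_eval R f z = (\<Oplus>i\<in>{..<N}. f i \<otimes> z [^] i)"
proof -
  define L where "L = (LEAST N::nat. z [^] N = \<zero>)"
  have L: "z [^] L = \<zero>" "L \<le> N" unfolding L_def using N by (auto intro: LeastI Least_le)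
  have pow0: "z [^] i = \<zero>" if "L \<le> i" for i
    using nat_pow_mult[OF z, of L "i - L"] that L z by simp
  show ?thesis unfolding ps_eval_def L_def[symmetric]
    by (rule add.finprod_mono_neutral_cong_left) (use L f z pow0 in \<open>auto simp: ps_ring_simps\<close>)
qed

end

text \<open>The two expressions differ only in the terms with i, j < N and i + j >= N, which vanish
  once Z is specialized to an element with N-th power zero.\<close>

lemma fps_truncated_product:
  fixes f g :: "nat \<Rightarrow> 'b::comm_ring_1"
  shows "Z ^ N dvd (\<Sum>i<N. f i * Z ^ i) * (\<Sum>j<N. g j * Z ^ j) - (\<Sum>k<N. (\<Sum>i\<le>k. f i * g (k - i)) * Z ^ k)"
proof -
  define t where "t = (\<lambda>(i, j). f i * g j * Z ^ (i + j))"
  have "(\<Sum>i<N. f i * Z ^ i) * (\<Sum>j<N. g j * Z ^ j) = (\<Sum>ij\<in>{..<N} \<times> {..<N}. t ij)"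
    by (simp add: sum_product sum.cartesian_product t_def power_add mult_ac)
  also have "{..<N} \<times> {..<N} = {(i, j). i + j < N} \<union> {(i, j). i < N \<and> j < N \<and> N \<le> i + j}" by auto
  also have "sum t \<dots> = sum t {(i, j). i + j < N} + sum t {(i, j). i < N \<and> j < N \<and> N \<le> i + j}"
  proof (rule sum.union_disjoint)
    show "finite {(i, j). i + j < N}" by (rule finite_subset[of _ "{..<N} \<times> {..<N}"]) auto
    show "finite {(i, j). i < N \<and> j < N \<and> N \<le> i + j}" by (rule finite_subset[of _ "{..<N} \<times> {..<N}"]) auto
  qed auto
  also have "sum t {(i, j). i + j < N} = (\<Sum>k<N. \<Sum>i\<le>k. f i * g (k - i) * Z ^ k)"
    unfolding t_def by (subst sum.triangle_reindex) (intro sum.cong, auto)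
  also have "\<dots> = (\<Sum>k<N. (\<Sum>i\<le>k. f i * g (k - i)) * Z ^ k)" by (simp add: sum_distrib_right)
  finally have "(\<Sum>i<N. f i * Z ^ i) * (\<Sum>j<N. g j * Z ^ j) - (\<Sum>k<N. (\<Sum>i\<le>k. f i * g (k - i)) * Z ^ k) =
    sum t {(i, j). i < N \<and> j < N \<and> N \<le> i + j}" by simp
  also have "Z ^ N dvd \<dots>"
    by (rule dvd_sum) (auto simp: t_def intro!: dvd_mult le_imp_power_dvd)
  finally show ?thesis .
qed

context plain_cring
begin

lemma nilpotentsE:
  assumes "z \<in> nilpotents R"
  obtains N :: nat where "z \<in> carrier R" "z [^] N = \<zero>"
  using assms by (auto simp: nilpotents_def)

lemma ps_eval_hom:
  assumes z: "z \<in> nilpotents R"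
  shows "(\<lambda>f. ps_eval R f z) \<in> ring_hom (ps_ring R) R"
proof -
  obtain N0 :: nat where zc: "z \<in> carrier R" and N0: "z [^] N0 = \<zero>" using nilpotentsE[OF z] .
  \<comment> \<open>\<open>N0\<close> may be 0 in the zero ring; the successor ensures that the
    constant term lies inside the truncation.\<close>
  define N where "N = Suc N0"
  have N: "z [^] N = \<zero>" using N0 zc by (simp add: N_def)
  note eq = ps_eval_bound[OF _ zc N]
  have one: "\<one>\<^bsub>ps_ring R\<^esub> \<in> carrier (ps_ring R)" by (auto simp: ps_ring_simps)
  have add: "f \<oplus>\<^bsub>ps_ring R\<^esub> g \<in> carrier (ps_ring R)" and mult: "f \<otimes>\<^bsub>ps_ring R\<^esub> g \<in> carrier (ps_ring R)"
    if "f \<in> carrier (ps_ring R)" "g \<in> carrier (ps_ring R)" for f g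
    using that by (auto simp: ps_ring_simps intro!: finsum_closed)
  show ?thesis
  proof (rule ring_hom_memI)
    fix f assume f: "f \<in> carrier (ps_ring R)"
    show "ps_eval R f z \<in> carrier R" unfolding eq[OF f]
      using f zc by (intro finsum_closed) (auto simp: ps_ring_simps)
    fix g assume g: "g \<in> carrier (ps_ring R)"
    have fc: "f i \<in> carrier R" and gc: "g i \<in> carrier R" for i using f g by (auto simp: ps_ring_simps)
    show "ps_eval R (f \<oplus>\<^bsub>ps_ring R\<^esub> g) z = ps_eval R f z \<oplus> ps_eval R g z"
      unfolding eq[OF f] eq[OF g] eq[OF add[OF f g]]
      by (subst finsum_addf[symmetric]) (use fc gc zc in \<open>auto simp: ps_ring_simps l_distr intro!: finsum_cong'\<close>)
    \<comment> \<open>The coefficients of both series and \<open>z\<close> are lifted together to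
      integer polynomials, where the truncated product identity is available.\<close>
    have "(if j = 0 then f else if j = 1 then g else (\<lambda>_. z)) i \<in> carrier R" for j i :: nat
      using fc gc zc by simp
    then obtain h and X :: "nat \<Rightarrow> nat \<Rightarrow> (nat \<times> nat) ipoly" where h: "type_hom R h"
      and X: "\<And>j i. (if j = 0 then f else if j = 1 then g else (\<lambda>_. z)) i = h (X j i)"
      using obtain_ipoly_type_hom[of "\<lambda>j. if j = 0 then f else if j = 1 then g else (\<lambda>_. z)"] by blast
    interpret type_hom R h by (rule h)
    define F G Z where "F = X 0" and "G = X 1" and "Z = X 2 0"
    have FGZ: "f i = h (F i)" "g i = h (G i)" "z = h Z" for i
      using X[of 0 i] X[of 1 i] X[of 2 0] by (simp_all add: F_def G_def Z_def)
    obtain C where "(\<Sum>i<N. F i * Z ^ i) * (\<Sum>j<N. G j * Z ^ j) - (\<Sum>k<N. (\<Sum>i\<le>k. F i * G (k - i)) * Z ^ k) = Z ^ N * C"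
      using fps_truncated_product[of Z N F G] by (auto simp: dvd_def)
    then have "(\<Sum>i<N. F i * Z ^ i) * (\<Sum>j<N. G j * Z ^ j) = Z ^ N * C + (\<Sum>k<N. (\<Sum>i\<le>k. F i * G (k - i)) * Z ^ k)"
      by (simp add: algebra_simps)
    from arg_cong[OF this, of h]
    have "(\<Oplus>i\<in>{..<N}. f i \<otimes> z [^] i) \<otimes> (\<Oplus>i\<in>{..<N}. g i \<otimes> z [^] i) =
       z [^] N \<otimes> h C \<oplus> (\<Oplus>k\<in>{..<N}. (\<Oplus>i\<in>{..k}. f i \<otimes> g (k - i)) \<otimes> z [^] k)"
      by (simp add: h_simps FGZ)
    also have "\<dots> = (\<Oplus>k\<in>{..<N}. (\<Oplus>i\<in>{..k}. f i \<otimes> g (k - i)) \<otimes> z [^] k)"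
      unfolding N using fc gc zc by (simp add: finsum_closed)
    finally show "ps_eval R (f \<otimes>\<^bsub>ps_ring R\<^esub> g) z = ps_eval R f z \<otimes> ps_eval R g z"
      unfolding eq[OF f] eq[OF g] eq[OF mult[OF f g]] by (simp add: ps_ring_simps)
  next
    have "(\<Oplus>i\<in>{..<N}. \<one>\<^bsub>ps_ring R\<^esub> i \<otimes> z [^] i) = (\<Oplus>i\<in>{..<N}. if 0 = i then \<one> else \<zero>)"
      using zc by (intro finsum_cong') (auto simp: ps_ring_simps)
    also have "\<dots> = \<one>" by (subst finsum_singleton) (auto simp: N_def)
    finally show "ps_eval R \<one>\<^bsub>ps_ring R\<^esub> z = \<one>" unfolding eq[OF one] .
  qed
qed

text \<open>Splitting off the constant term leaves a multiple of z. This is how the value of a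
  character of the formal group is seen to be 1 plus a nilpotent.\<close>

lemma ps_eval_eq:
  assumes f: "f \<in> carrier (ps_ring R)" and z: "z \<in> nilpotents R"
  shows "\<exists>c\<in>carrier R. ps_eval R f z = f 0 \<oplus> z \<otimes> c"
proof -
  obtain N :: nat where zc: "z \<in> carrier R" and "z [^] N = \<zero>" using nilpotentsE[OF z] .
  then have N: "z [^] Suc (Suc N) = \<zero>" by simp
  have fc: "f i \<in> carrier R" for i using f by (auto simp: ps_ring_simps)
  let ?c = "\<Oplus>i\<in>{..N}. f (Suc i) \<otimes> z [^] i"
  have c: "?c \<in> carrier R" using fc zc by (auto intro!: finsum_closed)
  have "ps_eval R f z = (\<Oplus>i\<in>{..Suc N}. f i \<otimes> z [^] i)"
    unfolding ps_eval_bound[OF f zc N] lessThan_Suc_atMost ..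
  also have "\<dots> = (\<Oplus>i\<in>{..N}. f (Suc i) \<otimes> z [^] Suc i) \<oplus> f 0"
    using fc zc by (subst finsum_Suc2) auto
  also have "(\<Oplus>i\<in>{..N}. f (Suc i) \<otimes> z [^] Suc i) = (\<Oplus>i\<in>{..N}. z \<otimes> (f (Suc i) \<otimes> z [^] i))"
    using fc zc by (intro finsum_cong') (auto simp: m_ac)
  also have "\<dots> = z \<otimes> ?c" using fc zc by (subst finsum_rdistr) auto
  finally show ?thesis using c zc fc by (intro bexI[OF _ c]) (simp add: a_comm)
qed

end

lemma (in plain_ring_hom) ps_ring_hom: "(\<lambda>f. h \<circ> f) \<in> ring_hom (ps_ring R) (ps_ring S)"
proof (rule ring_hom_memI)
  fix f g assume "f \<in> carrier (ps_ring R)" "g \<in> carrier (ps_ring R)"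
  then have "f i \<in> carrier R" "g i \<in> carrier R" for i by (auto simp: ps_ring_simps)
  then show "h \<circ> (f \<oplus>\<^bsub>ps_ring R\<^esub> g) = (h \<circ> f) \<oplus>\<^bsub>ps_ring S\<^esub> (h \<circ> g)"
     "h \<circ> (f \<otimes>\<^bsub>ps_ring R\<^esub> g) = (h \<circ> f) \<otimes>\<^bsub>ps_ring S\<^esub> (h \<circ> g)"
    by (auto simp: ps_ring_simps comp_def intro!: S.finsum_cong')
qed (auto simp: ps_ring_simps)

section \<open>Points of \<open>Q\<close>\<close>

locale p_nilpotent = plain_cring R for R (structure) +
  fixes p :: nat
  assumes p_nil: "p_nilpotent_ring p R" and prime: "prime p"
begin

text \<open>The index at which \<open>padic_to\<close> reads a p-adic integer: integers matter in
  the ring only modulo p to this power.\<close>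

definition exponent :: nat where "exponent = (LEAST m::nat. [(p ^ m)] \<cdot> \<one> = \<zero>)"

lemma exponent: "[(p ^ exponent)] \<cdot> \<one> = \<zero>"
  unfolding exponent_def using p_nil unfolding p_nilpotent_ring_def by (auto intro: LeastI)

lemma p_pos: "p > 0" by (rule prime_gt_0_nat[OF prime])

lemma int_mod_exponent: "[(x mod int p ^ exponent)] \<cdot> \<one> = [x] \<cdot> \<one>"
proof -
  interpret type_hom R "\<lambda>k::int. [k] \<cdot> \<one>" by (rule type_homI[OF cring_axioms int_ring_hom])
  have z: "[(int p ^ exponent)] \<cdot> \<one> = \<zero>" using exponent by (simp flip: of_nat_power add: add_pow_int_of_nat)
  have "[x] \<cdot> \<one> = [(x mod int p ^ exponent + int p ^ exponent * (x div int p ^ exponent))] \<cdot> \<one>"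
    by simp
  also have "\<dots> = [(x mod int p ^ exponent)] \<cdot> \<one>" unfolding h_add h_mult z by simp
  finally show ?thesis by simp
qed

lemma int_cong_exponent: "x mod int p ^ exponent = y mod int p ^ exponent \<Longrightarrow> [x] \<cdot> \<one> = [y] \<cdot> \<one>"
  by (metis int_mod_exponent)

lemma padic_to_eq: "padic_to p R a = [(a exponent)] \<cdot> \<one>"
  by (simp add: padic_to_def exponent_def)

lemma padic_to_hom: "padic_to p R \<in> ring_hom (Zp p) R"
proof -
  interpret type_hom R "\<lambda>k::int. [k] \<cdot> \<one>" by (rule type_homI[OF cring_axioms int_ring_hom])
  show ?thesis
  proof (rule ring_hom_memI)
    show "padic_to p R \<one>\<^bsub>Zp p\<^esub> = \<one>"
      unfolding padic_to_eq Zp_simps int_mod_exponent by (rule h_one)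
  qed (simp_all add: padic_to_eq Zp_simps int_mod_exponent h_add h_mult)
qed

lemma plain_Zp: "plain_cring (Zp p)" by (intro plain_cringI cring_Zp p_pos)

lemma cring_Zpq: "cring (Zpq p)"
  unfolding Zpq_def by (rule plain_cring.cring_ps_ring[OF plain_Zp])

lemma Q_pointsD: "q \<in> Q_points R \<Longrightarrow> q \<ominus> \<one> \<in> nilpotents R" "q \<in> Q_points R \<Longrightarrow> q \<in> Units R"
  by (auto simp: Q_points_def)

lemma Zpq_to_hom:
  assumes "q \<in> Q_points R"
  shows "Zpq_to p R q \<in> ring_hom (Zpq p) R"
proof -
  have "plain_ring_hom (Zp p) R (padic_to p R)"
    by (intro plain_ring_homI padic_to_hom cring_axioms cring_Zp p_pos)
  from ring_hom_trans[OF plain_ring_hom.ps_ring_hom[OF this] ps_eval_hom[OF Q_pointsD(1)[OF assms]]]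
  show ?thesis unfolding Zpq_def Zpq_to_def comp_def .
qed

text \<open>The counterpart of \<open>Zpq_to\<close> for series with integer coefficients, that is,
  before passing to p-adic limits.\<close>

definition int_fps_eval :: "'a \<Rightarrow> int fps \<Rightarrow> 'a" where
  "int_fps_eval z F = ps_eval R (\<lambda>i. [(fps_nth F i)] \<cdot> \<one>) z"

lemma int_fps_eval_hom:
  assumes "z \<in> nilpotents R"
  shows "int_fps_eval z \<in> ring_hom type_ring R"
proof -
  have "type_hom R (\<lambda>k::int. [k] \<cdot> \<one>)" by (rule type_homI[OF cring_axioms int_ring_hom])
  from ring_hom_trans[OF type_hom.fps_coeff_hom[OF this] ps_eval_hom[OF assms]]
  show ?thesis unfolding int_fps_eval_def comp_def .
qed

end

section \<open>Torsion of \<open>[q] - 1\<close>\<close>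

definition mono_deg :: "('v \<Rightarrow>\<^sub>0 nat) \<Rightarrow> nat" where
  "mono_deg m = (\<Sum>v\<in>Poly_Mapping.keys m. Poly_Mapping.lookup m v)"

text \<open>Membership in the d-th power of the ideal generated by the variables; the zero
  polynomial belongs to all of them.\<close>

definition min_deg :: "nat \<Rightarrow> 'v ipoly \<Rightarrow> bool" where
  "min_deg d P \<longleftrightarrow> (\<forall>m\<in>Poly_Mapping.keys P. d \<le> mono_deg m)"

lemma mono_deg_superset: "finite S \<Longrightarrow> Poly_Mapping.keys m \<subseteq> S \<Longrightarrow> mono_deg m = (\<Sum>v\<in>S. Poly_Mapping.lookup m v)"
  unfolding mono_deg_def by (rule sum.mono_neutral_left) (auto simp: in_keys_iff)

lemma mono_deg_add: "mono_deg (m + m') = mono_deg m + mono_deg m'"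
proof -
  define S where "S = Poly_Mapping.keys m \<union> Poly_Mapping.keys m'"
  have "finite S" "Poly_Mapping.keys m \<subseteq> S" "Poly_Mapping.keys m' \<subseteq> S" "Poly_Mapping.keys (m + m') \<subseteq> S"
    using keys_add[of m m'] by (auto simp: S_def)
  then show ?thesis by (simp add: mono_deg_superset[of S] lookup_add sum.distrib)
qed

lemma min_deg_0 [simp]: "min_deg 0 P"
  by (simp add: min_deg_def)

lemma min_deg_zero [simp]: "min_deg d 0"
  by (simp add: min_deg_def)

lemma min_deg_add: "min_deg d P \<Longrightarrow> min_deg d Q \<Longrightarrow> min_deg d (P + Q)"
  using keys_add[of P Q] unfolding min_deg_def by blast

lemma min_deg_uminus: "min_deg d P \<Longrightarrow> min_deg d (- P)"
  by (simp add: min_deg_def in_keys_iff)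

lemma min_deg_diff: "min_deg d P \<Longrightarrow> min_deg d Q \<Longrightarrow> min_deg d (P - Q)"
  using min_deg_add[of d P "- Q"] min_deg_uminus[of d Q] by simp

lemma min_deg_sum: "(\<And>i. i \<in> S \<Longrightarrow> min_deg d (f i)) \<Longrightarrow> min_deg d (sum f S)"
  by (induction S rule: infinite_finite_induct) (auto intro: min_deg_add)

lemma min_deg_mult: "min_deg d P \<Longrightarrow> min_deg e Q \<Longrightarrow> min_deg (d + e) (P * Q)"
  unfolding min_deg_def
proof
  fix m assume *: "\<forall>m\<in>Poly_Mapping.keys P. d \<le> mono_deg m" "\<forall>m\<in>Poly_Mapping.keys Q. e \<le> mono_deg m"
    "m \<in> Poly_Mapping.keys (P * Q)"
  then obtain a b where "m = a + b" "a \<in> Poly_Mapping.keys P" "b \<in> Poly_Mapping.keys Q"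
    using keys_mult[of P Q] by blast
  then show "d + e \<le> mono_deg m" using * by (simp add: mono_deg_add add_mono)
qed

lemma min_deg_mult_left: "min_deg d Q \<Longrightarrow> min_deg d (P * Q)"
  using min_deg_mult[of 0 P d Q] by simp

lemma min_deg_power:
  assumes "min_deg 1 P" "d \<le> k"
  shows "min_deg d (P ^ k)"
proof -
  have "min_deg d (P ^ d)"
  proof (induction d)
    case (Suc d)
    then show ?case using min_deg_mult[OF assms(1) Suc] by simp
  qed simp
  moreover have "P ^ k = P ^ (k - d) * P ^ d" using assms(2) by (simp flip: power_add)
  ultimately show ?thesis by (simp add: min_deg_mult_left)
qed

lemma min_deg_var: "min_deg 1 (ipoly_var v)"
  by (simp add: min_deg_def ipoly_var_def mono_deg_def)

lemma lookup_of_nat_mult: "Poly_Mapping.lookup (of_nat c * P :: 'v ipoly) m = int c * Poly_Mapping.lookup P m"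
proof (induction P rule: poly_mapping_add_single_induct)
  case (single m' d)
  then show ?case using ipoly_of_int[of "int c" m' d] by (simp add: lookup_single when_def)
qed (simp_all add: ring_distribs lookup_add)

lemma min_deg_cancel: "min_deg d (of_nat c * P) \<Longrightarrow> c \<noteq> 0 \<Longrightarrow> min_deg d P"
  by (simp add: min_deg_def in_keys_iff lookup_of_nat_mult)

lemma ghost_lessThan: "witt_ghost p n X = (\<Sum>i<n. of_nat (p ^ i) * X i ^ (p ^ (n - i))) + of_nat (p ^ n) * X n"
proof -
  have "{..n} = insert n {..<n}" by auto
  then show ?thesis by (simp add: witt_ghost_def)
qed

text \<open>By induction the earlier components have no constant term, hence neither does p^n X_n,
  and integer factors can be cancelled.\<close>

lemma min_deg_of_ghost:
  assumes p: "p > 0" and ghost: "\<And>n. min_deg 1 (witt_ghost p n X)"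
  shows "min_deg 1 (X n)"
proof (induction n rule: less_induct)
  case (less n)
  have "min_deg 1 (\<Sum>i<n. of_nat (p ^ i) * X i ^ (p ^ (n - i)))"
    using p by (intro min_deg_sum min_deg_mult_left min_deg_power less) (auto simp: Suc_le_eq)
  then have "min_deg 1 (witt_ghost p n X - (\<Sum>i<n. of_nat (p ^ i) * X i ^ (p ^ (n - i))))"
    by (rule min_deg_diff[OF ghost])
  also have "witt_ghost p n X - (\<Sum>i<n. of_nat (p ^ i) * X i ^ (p ^ (n - i))) = of_nat (p ^ n) * X n"
    by (simp add: ghost_lessThan)
  finally show ?case by (rule min_deg_cancel) (use p in simp)
qed

text \<open>After multiplication by p^n the difference is a combination of powers with exponents
  p^(n-i), i < n, of polynomials without constant term, and these exponents are at least p >=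
  2.\<close>

lemma min_deg_witt_add:
  assumes p: "prime p"
  shows "min_deg 2 (witt_add_poly p n - (ipoly_var (Inl n) + ipoly_var (Inr n)))"
proof -
  have var: "min_deg 1 (witt_ghost p n (\<lambda>i. ipoly_var (f i)))" for n and f :: "nat \<Rightarrow> nat + nat"
    unfolding witt_ghost_def using prime_gt_0_nat[OF p]
    by (intro min_deg_sum min_deg_mult_left min_deg_power min_deg_var) (auto simp: Suc_le_eq)
  have 1: "min_deg 1 (witt_add_poly p n)" for n
    by (rule min_deg_of_ghost[OF prime_gt_0_nat[OF p]]) (unfold witt_add_poly[OF p], intro min_deg_add var)
  let ?X = "\<lambda>i. ipoly_var (Inl i) :: (nat + nat) ipoly" and ?Y = "\<lambda>i. ipoly_var (Inr i) :: (nat + nat) ipoly"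
  let ?f = "\<lambda>X. \<Sum>i<n. of_nat (p ^ i) * X i ^ (p ^ (n - i)) :: (nat + nat) ipoly"
  have f: "min_deg 2 (?f X)" if "\<And>i. min_deg 1 (X i)" for X
  proof (intro min_deg_sum min_deg_mult_left min_deg_power that)
    fix i assume "i \<in> {..<n}"
    then have "p ^ 1 \<le> p ^ (n - i)" using prime_gt_0_nat[OF p] by (intro power_increasing) auto
    then show "2 \<le> p ^ (n - i)" using prime_ge_2_nat[OF p] by simp
  qed
  have "of_nat (p ^ n) * (witt_add_poly p n - (?X n + ?Y n)) = ?f ?X + ?f ?Y - ?f (witt_add_poly p)"
    using witt_add_poly[OF p, of n] unfolding ghost_lessThan by (simp add: algebra_simps)
  moreover have "min_deg 2 \<dots>"
    by (intro min_deg_diff min_deg_add f min_deg_var 1)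
  ultimately have "min_deg 2 (of_nat (p ^ n) * (witt_add_poly p n - (?X n + ?Y n)))" by simp
  then show "min_deg 2 (witt_add_poly p n - (?X n + ?Y n))"
    by (rule min_deg_cancel) (use prime_gt_0_nat[OF p] in simp)
qed

section \<open>Principal ideals and their powers\<close>

context plain_cring
begin

definition multiples :: "'a \<Rightarrow> 'a set" where
  "multiples u = {u \<otimes> c | c. c \<in> carrier R}"

lemma multiples_closed: "u \<in> carrier R \<Longrightarrow> x \<in> multiples u \<Longrightarrow> x \<in> carrier R"
  by (auto simp: multiples_def)

lemma multiples_add:
  assumes "u \<in> carrier R" "x \<in> multiples u" "y \<in> multiples u"
  shows "x \<oplus> y \<in> multiples u"
proof -
  obtain c d where "c \<in> carrier R" "d \<in> carrier R" "x = u \<otimes> c" "y = u \<otimes> d"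
    using assms by (auto simp: multiples_def)
  then have "x \<oplus> y = u \<otimes> (c \<oplus> d)" "c \<oplus> d \<in> carrier R" using assms by (auto simp: r_distr)
  then show ?thesis unfolding multiples_def by blast
qed

lemma multiples_mult:
  assumes "u \<in> carrier R" "x \<in> multiples u" "y \<in> carrier R"
  shows "y \<otimes> x \<in> multiples u"
proof -
  obtain c where "c \<in> carrier R" "x = u \<otimes> c"
    using assms by (auto simp: multiples_def)
  then have "y \<otimes> x = u \<otimes> (y \<otimes> c)" "y \<otimes> c \<in> carrier R" using assms by (auto simp: m_ac)
  then show ?thesis unfolding multiples_def by blast
qed

lemma multiples_zero: "u \<in> carrier R \<Longrightarrow> \<zero> \<in> multiples u"
  unfolding multiples_def by (intro CollectI exI[of _ \<zero>]) simp

lemma multiples_finsum: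
  assumes "u \<in> carrier R" "\<And>i. i \<in> S \<Longrightarrow> f i \<in> multiples u"
  shows "finsum R f S \<in> multiples u"
  using assms(2)
proof (induction S rule: infinite_finite_induct)
  case (insert i S)
  then have "finsum R f (insert i S) = f i \<oplus> finsum R f S"
    by (intro finsum_insert) (auto intro: multiples_closed[OF assms(1)])
  then show ?case using insert assms(1) by (auto intro: multiples_add)
qed (auto simp: multiples_zero assms(1))

lemma multiples_power:
  assumes u: "u \<in> carrier R" and "d \<le> e" and x: "x \<in> multiples (u [^] (e::nat))"
  shows "x \<in> multiples (u [^] (d::nat))"
proof -
  obtain c where "c \<in> carrier R" "x = u [^] e \<otimes> c" using x by (auto simp: multiples_def)
  moreover have "u [^] e = u [^] d \<otimes> u [^] (e - d)" using assms by (simp add: nat_pow_mult)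
  ultimately have "x = u [^] d \<otimes> (u [^] (e - d) \<otimes> c)" "u [^] (e - d) \<otimes> c \<in> carrier R"
    using u by (auto simp: m_assoc)
  then show ?thesis unfolding multiples_def by blast
qed

lemma mono_eval_scaled:
  assumes u: "u \<in> carrier R" and \<alpha>: "range \<alpha> \<subseteq> carrier R"
  shows "mono_eval R (\<lambda>v. u \<otimes> \<alpha> v) m = u [^] mono_deg m \<otimes> mono_eval R \<alpha> m"
proof -
  have \<alpha>': "\<alpha> v \<in> carrier R" for v using \<alpha> by auto
  have "finite S \<Longrightarrow> (\<Otimes>v\<in>S. (u \<otimes> \<alpha> v) [^] e v) = u [^] sum e S \<otimes> (\<Otimes>v\<in>S. \<alpha> v [^] e v)" for S and e :: "_ \<Rightarrow> nat"
  proof (induction S rule: finite_induct)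
    case (insert v S)
    then have "(\<Otimes>v\<in>insert v S. (u \<otimes> \<alpha> v) [^] e v) = (u \<otimes> \<alpha> v) [^] e v \<otimes> (u [^] sum e S \<otimes> (\<Otimes>v\<in>S. \<alpha> v [^] e v))"
      using u \<alpha>' by (subst finprod_insert) auto
    also have "\<dots> = u [^] (e v + sum e S) \<otimes> (\<alpha> v [^] e v \<otimes> (\<Otimes>v\<in>S. \<alpha> v [^] e v))"
      using u \<alpha>' by (simp add: nat_pow_distrib nat_pow_mult[symmetric] m_ac finprod_closed)
    finally show ?case using insert u \<alpha>' by (subst finprod_insert) auto
  qed simp
  then show ?thesis unfolding mono_eval_def mono_deg_def by simp
qed

text \<open>Every variable contributes a factor u, so a monomial of degree at least d takes a value
  in the ideal of u^d.\<close>

lemma ipoly_eval_multiples: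
  assumes u: "u \<in> carrier R" and f: "\<And>v. f v \<in> multiples u" and P: "min_deg d P"
  shows "ipoly_eval R f P \<in> multiples (u [^] d)"
proof -
  obtain \<alpha> where \<alpha>: "\<And>v. \<alpha> v \<in> carrier R" "\<And>v. f v = u \<otimes> \<alpha> v"
    using f unfolding multiples_def mem_Collect_eq by metis
  have f_eq: "f = (\<lambda>v. u \<otimes> \<alpha> v)" using \<alpha> by auto
  have r: "range \<alpha> \<subseteq> carrier R" "range f \<subseteq> carrier R" using \<alpha> u by auto
  show ?thesis unfolding ipoly_eval_def mono_eval_def[symmetric]
  proof (rule multiples_finsum)
    fix m assume "m \<in> Poly_Mapping.keys P"
    then have "d \<le> mono_deg m" using P by (simp add: min_deg_def)
    moreover have "mono_eval R f m \<in> multiples (u [^] mono_deg m)"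
      unfolding f_eq mono_eval_scaled[OF u r(1)] using r(1) by (auto simp: multiples_def)
    ultimately have "mono_eval R f m \<in> multiples (u [^] d)" using u by (blast intro: multiples_power)
    then show "[(Poly_Mapping.lookup P m)] \<cdot> mono_eval R f m \<in> multiples (u [^] d)"
      unfolding int_add_pow_eq[OF mono_eval_closed[OF r(2)]] using u by (intro multiples_mult) auto
  qed (use u in simp)
qed

end

section \<open>Witt vectors with components in a nilpotent principal ideal\<close>

context p_nilpotent
begin

lemma cring_W: "cring (witt p R)"
  by (rule cring_witt[OF prime])

sublocale W: cring "witt p R" by (rule cring_W)

lemma witt_add_multiples:
  assumes u: "u \<in> carrier R" and x: "\<And>i. x i \<in> multiples u" and y: "\<And>i. y i \<in> multiples u"
  shows "\<exists>c \<in> multiples (u [^] (2::nat)). (x \<oplus>\<^bsub>witt p R\<^esub> y) i = x i \<oplus> y i \<oplus> c"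
proof -
  let ?f = "case_sum x y"
  have f: "?f v \<in> multiples u" for v using x y by (auto split: sum.splits)
  have r: "range ?f \<subseteq> carrier R" using multiples_closed[OF u f] by auto
  interpret type_hom R "ipoly_eval R ?f" by (rule ipoly_eval_type_hom[OF r])
  let ?X = "ipoly_var (Inl i) + ipoly_var (Inr i)"
  have "(x \<oplus>\<^bsub>witt p R\<^esub> y) i = ipoly_eval R ?f (?X + (witt_add_poly p i - ?X))"
    by (simp add: witt_simps)
  also have "\<dots> = x i \<oplus> y i \<oplus> ipoly_eval R ?f (witt_add_poly p i - ?X)"
    unfolding h_add by (simp add: ipoly_eval_var[OF r])
  finally show ?thesis
    using ipoly_eval_multiples[of u ?f, OF u f min_deg_witt_add[OF prime, of i]] by blast
qed

text \<open>Since the linear part of Witt vector addition is componentwise addition, multiplication by an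
  integer is componentwise modulo \<open>t\<^sup>2\<^sup>k\<close>, and \<open>p\<close> is nilpotent in the ring.\<close>

lemma witt_exponent_multiples:
  assumes t: "t \<in> carrier R" and k: "k \<ge> 1" and x: "\<And>i. x i \<in> multiples (t [^] (k::nat))"
  shows "([(p ^ exponent)] \<cdot>\<^bsub>witt p R\<^esub> x) i \<in> multiples (t [^] Suc k)"
proof -
  define u where "u = t [^] k"
  have u: "u \<in> carrier R" using t by (simp add: u_def)
  have x: "x i \<in> multiples u" for i using x by (simp add: u_def)
  have xc: "x i \<in> carrier R" for i by (rule multiples_closed[OF u x])
  have xW: "x \<in> carrier (witt p R)" using xc by (auto simp: in_witt_iff)
  have u2: "u [^] (2::nat) \<in> carrier R" using u by simp
  have sub: "c \<in> multiples u" if "c \<in> multiples (u [^] (2::nat))" for c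
    using multiples_power[OF u, of 1 2 c] that u by simp
  have claim: "\<exists>c \<in> multiples (u [^] (2::nat)). ([s] \<cdot>\<^bsub>witt p R\<^esub> x) i = [s] \<cdot> x i \<oplus> c" for s :: nat and i
  proof (induction s arbitrary: i)
    case 0
    show ?case using u2 by (intro bexI[of _ \<zero>] multiples_zero) (auto simp: witt_simps teich_def)
  next
    case (Suc s)
    have sx: "([s] \<cdot>\<^bsub>witt p R\<^esub> x) i \<in> multiples u" for i
    proof -
      have "[s] \<cdot> x i \<in> multiples u"
        unfolding nat_add_pow_eq[OF xc] by (rule multiples_mult[OF u x]) simp
      then show ?thesis using Suc[of i] sub multiples_add[OF u] by auto
    qed
    obtain c where c: "c \<in> multiples (u [^] (2::nat))" "([s] \<cdot>\<^bsub>witt p R\<^esub> x) i = [s] \<cdot> x i \<oplus> c"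
      using Suc by blast
    obtain d where d: "d \<in> multiples (u [^] (2::nat))"
      "([s] \<cdot>\<^bsub>witt p R\<^esub> x \<oplus>\<^bsub>witt p R\<^esub> x) i = ([s] \<cdot>\<^bsub>witt p R\<^esub> x) i \<oplus> x i \<oplus> d"
      using witt_add_multiples[of u "[s] \<cdot>\<^bsub>witt p R\<^esub> x" x i, OF u sx x] by blast
    have cd: "c \<in> carrier R" "d \<in> carrier R" using c d multiples_closed[OF u2] by auto
    have "([(Suc s)] \<cdot>\<^bsub>witt p R\<^esub> x) i = [(Suc s)] \<cdot> x i \<oplus> (c \<oplus> d)"
      using d(2) unfolding c(2) using xc cd by (simp add: a_ac)
    then show ?case using multiples_add[OF u2 c(1) d(1)] by blast
  qed
  obtain c where c: "c \<in> multiples (u [^] (2::nat))" "([(p ^ exponent)] \<cdot>\<^bsub>witt p R\<^esub> x) i = [(p ^ exponent)] \<cdot> x i \<oplus> c"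
    using claim by blast
  have "[(p ^ exponent)] \<cdot> x i = \<zero>"
    unfolding nat_add_pow_eq[OF xc] exponent using xc by simp
  then have "([(p ^ exponent)] \<cdot>\<^bsub>witt p R\<^esub> x) i \<in> multiples (t [^] (k * 2))"
    using c multiples_closed[OF u2 c(1)] t by (simp add: u_def nat_pow_pow)
  \<comment> \<open>The error lies in the ideal of t^(2k), and 2k >= k + 1 because k >= 1; this is
    where k = 0 would fail.\<close>
  then show ?thesis by (rule multiples_power[OF t, rotated]) (use k in simp)
qed

text \<open>Each multiplication by \<open>p ^ exponent\<close> raises the power of t dividing all
  components by one, until t^(N+1) = 0. The number of rounds is the same for all components.\<close>

lemma witt_multiples_torsion:
  assumes t: "t \<in> nilpotents R" and x: "\<And>i. x i \<in> multiples t"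
  shows "\<exists>K::nat. [(p ^ K)] \<cdot>\<^bsub>witt p R\<^esub> x = \<zero>\<^bsub>witt p R\<^esub>"
proof -
  obtain N :: nat where tc: "t \<in> carrier R" and N: "t [^] N = \<zero>" using nilpotentsE[OF t] .
  have xW: "x \<in> carrier (witt p R)" using multiples_closed[OF tc x] by (auto simp: in_witt_iff)
  have "([(p ^ (exponent * j))] \<cdot>\<^bsub>witt p R\<^esub> x) i \<in> multiples (t [^] Suc j)" for j i
  proof (induction j arbitrary: i)
    case 0
    then show ?case using x tc plain_cring.one_add_pow[OF plain_cringI[OF cring_W] xW] by simp
  next
    case (Suc j)
    have "[(p ^ (exponent * Suc j))] \<cdot>\<^bsub>witt p R\<^esub> x = [(p ^ exponent)] \<cdot>\<^bsub>witt p R\<^esub> ([(p ^ (exponent * j))] \<cdot>\<^bsub>witt p R\<^esub> x)"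
      using xW by (simp add: W.add.nat_pow_pow power_add mult.commute)
    then show ?case by (simp only:) (rule witt_exponent_multiples[OF tc _ Suc], simp)
  qed
  moreover have "multiples (t [^] Suc N) = {\<zero>}"
    using tc multiples_zero[of \<zero>] by (auto simp: multiples_def N)
  ultimately have "([(p ^ (exponent * N))] \<cdot>\<^bsub>witt p R\<^esub> x) i = \<zero>" for i by blast
  then have "[(p ^ (exponent * N))] \<cdot>\<^bsub>witt p R\<^esub> x = \<zero>\<^bsub>witt p R\<^esub>"
    by (auto simp: witt_simps teich_def)
  then show ?thesis by blast
qed

text \<open>In the universal case, with t a variable X, the ghost components are (1 + X)^(p^n) - 1,
  which have no constant term; hence neither do the components themselves.\<close>

lemma teich_minus_one_multiples:
  assumes t: "t \<in> carrier R"
  shows "(teich R (\<one> \<oplus> t) \<ominus>\<^bsub>witt p R\<^esub> \<one>\<^bsub>witt p R\<^esub>) i \<in> multiples t"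
proof -
  let ?T = "type_ring :: nat ipoly ring"
  interpret T: plain_cring ?T by (intro plain_cringI cring_type_ring)
  interpret U: cring "witt p ?T" by (rule cring_witt_ipoly[OF prime])
  have [simp]: "carrier (witt p ?T) = UNIV" by (simp add: witt_simps)
  let ?f = "\<lambda>_::nat. t"
  have f: "range ?f \<subseteq> carrier R" using t by auto
  interpret type_hom R "ipoly_eval R ?f" by (rule ipoly_eval_type_hom[OF f])
  interpret h: plain_ring_hom ?T R "ipoly_eval R ?f" by (intro plain_ring_homI cring_type_ring cring_axioms h)
  interpret wh: ring_hom_cring "witt p ?T" "witt p R" "\<lambda>x. ipoly_eval R ?f \<circ> x"
    by (intro ring_hom_cring.intro U.cring_axioms cring_W ring_hom_cring_axioms.intro h.witt_hom)
  define X where "X = (ipoly_var 0 :: nat ipoly)"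
  have X: "ipoly_eval R ?f (1 + X) = \<one> \<oplus> t" by (simp only: X_def h_add h_one ipoly_eval_var[OF f])
  define Y where "Y = teich ?T (1 + X) \<ominus>\<^bsub>witt p ?T\<^esub> \<one>\<^bsub>witt p ?T\<^esub>"
  have "min_deg 1 (Y n)" for n
  proof (rule min_deg_of_ghost[OF p_pos])
    fix n
    have "Y \<oplus>\<^bsub>witt p ?T\<^esub> \<one>\<^bsub>witt p ?T\<^esub> = teich ?T (1 + X)"
      unfolding Y_def U.minus_eq by (simp add: U.a_assoc U.l_neg)
    then have "witt_ghost p n Y + 1 = (1 + X) ^ (p ^ n)"
      using T.ghost_add[OF prime, of Y "\<one>\<^bsub>witt p ?T\<^esub>" n] T.ghost_one[OF p_pos, of n]
        T.ghost_teich[OF p_pos, of "1 + X" n] by (simp add: ghost_type_ring)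
    then have "witt_ghost p n Y = (1 + X) ^ (p ^ n) - 1" by (simp add: eq_diff_eq)
    also have "\<dots> = (\<Sum>i<p ^ n. (1 + X) ^ i) * X" by (simp add: power_diff_1_eq mult.commute)
    also have "min_deg 1 \<dots>" unfolding X_def by (intro min_deg_mult_left min_deg_var)
    finally show "min_deg 1 (witt_ghost p n Y)" .
  qed
  moreover have "t \<in> multiples t" using t by (auto simp: multiples_def intro: exI[of _ \<one>])
  ultimately have "ipoly_eval R ?f (Y i) \<in> multiples (t [^] (1::nat))"
    using t by (intro ipoly_eval_multiples) auto
  moreover have "ipoly_eval R ?f \<circ> Y = teich R (\<one> \<oplus> t) \<ominus>\<^bsub>witt p R\<^esub> \<one>\<^bsub>witt p R\<^esub>"
    unfolding Y_def U.minus_eq W.minus_eq using h.hom_teich[of "1 + X"]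
    by (simp only: wh.hom_add wh.hom_a_inv wh.hom_one U.one_closed U.a_inv_closed X type_ring_simps UNIV_I
        \<open>carrier (witt p ?T) = UNIV\<close>)
  ultimately show ?thesis using t by (simp add: fun_eq_iff)
qed

lemma teich_minus_one_torsion:
  assumes q: "q \<in> Q_points R"
  shows "\<exists>K::nat. [(p ^ K)] \<cdot>\<^bsub>witt p R\<^esub> (teich R q \<ominus>\<^bsub>witt p R\<^esub> \<one>\<^bsub>witt p R\<^esub>) = \<zero>\<^bsub>witt p R\<^esub>"
proof -
  have qc: "q \<in> carrier R" using Q_pointsD(2)[OF q] by auto
  have "q = \<one> \<oplus> (q \<ominus> \<one>)" using qc by (simp add: minus_eq a_lcomm r_neg)
  then show ?thesis
    using witt_multiples_torsion[OF Q_pointsD(1)[OF q] teich_minus_one_multiples] qc by auto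
qed

end

section \<open>\<open>p\<close>-adically continuous functions\<close>

text \<open>Uniform p-adic continuity on pairs of naturals, which makes limits at p-adic arguments
  independent of the approximating sequences. In the application \<open>a\<close> is an exponent of
  q and \<open>b\<close> the length of a geometric sum.\<close>

definition adic_cont :: "nat \<Rightarrow> (nat \<Rightarrow> nat \<Rightarrow> int) \<Rightarrow> bool" where
  "adic_cont p f \<longleftrightarrow> (\<forall>L. \<exists>K. \<forall>a a' b b'. int p ^ K dvd int a - int a' \<and> int p ^ K dvd int b - int b' \<longrightarrow>
    int p ^ L dvd f a b - f a' b')"

lemma adic_contI:
  assumes "\<And>L. \<exists>K. \<forall>a a' b b'. int p ^ K dvd int a - int a' \<and> int p ^ K dvd int b - int b' \<longrightarrow>
    int p ^ L dvd f a b - f a' b'"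
  shows "adic_cont p f"
  using assms by (simp add: adic_cont_def)

lemma adic_contE:
  assumes "adic_cont p f"
  obtains K where "\<And>a a' b b'. int p ^ K dvd int a - int a' \<Longrightarrow> int p ^ K dvd int b - int b' \<Longrightarrow>
    int p ^ L dvd f a b - f a' b'"
  using assms unfolding adic_cont_def by blast

lemma adic_cont_const: "adic_cont p (\<lambda>_ _. c)"
  by (simp add: adic_cont_def)

lemma adic_cont_combine:
  assumes f: "adic_cont p f" and g: "adic_cont p g"
    and comb: "\<And>d x x' y y'. d dvd x - x' \<Longrightarrow> d dvd y - y' \<Longrightarrow> d dvd F x y - F x' y'"
  shows "adic_cont p (\<lambda>a b. F (f a b) (g a b))"
proof (rule adic_contI)
  fix L
  obtain K1 where K1: "\<And>a a' b b'. int p ^ K1 dvd int a - int a' \<Longrightarrow> int p ^ K1 dvd int b - int b' \<Longrightarrow>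
    int p ^ L dvd f a b - f a' b'" using adic_contE[OF f] by blast
  obtain K2 where K2: "\<And>a a' b b'. int p ^ K2 dvd int a - int a' \<Longrightarrow> int p ^ K2 dvd int b - int b' \<Longrightarrow>
    int p ^ L dvd g a b - g a' b'" using adic_contE[OF g] by blast
  have "int p ^ K1 dvd int p ^ (K1 + K2)" "int p ^ K2 dvd int p ^ (K1 + K2)"
    by (simp_all add: le_imp_power_dvd)
  then show "\<exists>K. \<forall>a a' b b'. int p ^ K dvd int a - int a' \<and> int p ^ K dvd int b - int b' \<longrightarrow>
    int p ^ L dvd F (f a b) (g a b) - F (f a' b') (g a' b')"
    using K1 K2 comb by (intro exI[of _ "K1 + K2"]) (meson dvd_trans)
qed

lemma adic_cont_add: "adic_cont p f \<Longrightarrow> adic_cont p g \<Longrightarrow> adic_cont p (\<lambda>a b. f a b + g a b)"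
  by (rule adic_cont_combine[where F = "(+)"]) (auto simp: add_diff_add)

lemma adic_cont_diff: "adic_cont p f \<Longrightarrow> adic_cont p g \<Longrightarrow> adic_cont p (\<lambda>a b. f a b - g a b)"
proof (rule adic_cont_combine[where F = "(-)"])
  fix d x x' y y' :: int assume "d dvd x - x'" "d dvd y - y'"
  then have "d dvd (x - x') - (y - y')" by (rule dvd_diff)
  then show "d dvd x - y - (x' - y')" by (simp add: algebra_simps)
qed

lemma adic_cont_mult: "adic_cont p f \<Longrightarrow> adic_cont p g \<Longrightarrow> adic_cont p (\<lambda>a b. f a b * g a b)"
proof (rule adic_cont_combine[where F = "(*)"])
  fix d x x' y y' :: int assume "d dvd x - x'" "d dvd y - y'"
  then have "d dvd (x - x') * y + x' * (y - y')" by (intro dvd_add dvd_mult dvd_mult2)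
  then show "d dvd x * y - x' * y'" by (simp add: algebra_simps)
qed

lemma adic_cont_sum: "(\<And>i. i \<in> S \<Longrightarrow> adic_cont p (f i)) \<Longrightarrow> adic_cont p (\<lambda>a b. \<Sum>i\<in>S. f i a b)"
  by (induction S rule: infinite_finite_induct) (auto intro: adic_cont_add adic_cont_const)

lemma adic_cont_prod: "(\<And>i. i \<in> S \<Longrightarrow> adic_cont p (f i)) \<Longrightarrow> adic_cont p (\<lambda>a b. \<Prod>i\<in>S. f i a b)"
  by (induction S rule: infinite_finite_induct) (auto intro: adic_cont_mult adic_cont_const)

text \<open>Continuity at level L + c survives division by c at level L. Binomial coefficients and
  Witt components, both defined by division, inherit continuity in this way.\<close>

lemma adic_cont_cancel:
  assumes p: "prime p" and c: "c > 0" and f: "adic_cont p (\<lambda>a b. int c * f a b)"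
  shows "adic_cont p f"
proof (rule adic_contI)
  fix L
  obtain K where K: "\<And>a a' b b'. int p ^ K dvd int a - int a' \<Longrightarrow> int p ^ K dvd int b - int b' \<Longrightarrow>
    int p ^ (L + c) dvd int c * f a b - int c * f a' b'" using adic_contE[OF f] by blast
  show "\<exists>K. \<forall>a a' b b'. int p ^ K dvd int a - int a' \<and> int p ^ K dvd int b - int b' \<longrightarrow> int p ^ L dvd f a b - f a' b'"
  proof (intro exI[of _ K] allI impI, elim conjE)
    fix a a' b b' assume "int p ^ K dvd int a - int a'" "int p ^ K dvd int b - int b'"
    from K[OF this] have "int p ^ (L + c) dvd int c * (f a b - f a' b')" by (simp add: algebra_simps)
    then show "int p ^ L dvd f a b - f a' b'" by (rule prime_power_dvd_cancel[OF p c])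
  qed
qed

lemma adic_cont_fst: "adic_cont p (\<lambda>a b. int a)"
  by (auto simp: adic_cont_def)

lemma fact_binomial: "int (fact l) * int (a choose l) = (\<Prod>j<l. int a - int j)"
proof -
  have "of_int (int (fact l) * int (a choose l)) = (of_int (\<Prod>j<l. int a - int j) :: real)"
    using gbinomial_mult_fact[of l "real a"] by (simp add: binomial_gbinomial atLeast0LessThan of_int_prod)
  then show ?thesis by (simp only: of_int_eq_iff)
qed

text \<open>Times l! the binomial coefficient is a polynomial in a with integer
  coefficients.\<close>

lemma adic_cont_binomial:
  assumes p: "prime p"
  shows "adic_cont p (\<lambda>a b. int (a choose l))"
  by (rule adic_cont_cancel[OF p, of "fact l"])
     (simp_all only: fact_gt_zero fact_binomial, intro adic_cont_prod adic_cont_diff adic_cont_fst adic_cont_const)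

lemma adic_cont_scale:
  assumes "adic_cont p f"
  shows "adic_cont p (\<lambda>a b. f (c * a) b)"
proof (rule adic_contI)
  fix L
  obtain K where K: "\<And>a a' b b'. int p ^ K dvd int a - int a' \<Longrightarrow> int p ^ K dvd int b - int b' \<Longrightarrow>
    int p ^ L dvd f a b - f a' b'" using adic_contE[OF assms] by blast
  have "int p ^ K dvd int (c * a) - int (c * a')" if "int p ^ K dvd int a - int a'" for a a'
    using dvd_mult[OF that, of "int c"] by (simp add: right_diff_distrib)
  then show "\<exists>K. \<forall>a a' b b'. int p ^ K dvd int a - int a' \<and> int p ^ K dvd int b - int b' \<longrightarrow>
    int p ^ L dvd f (c * a) b - f (c * a') b'" using K by blast
qed

text \<open>Shifting a block of P terms by one replaces g(s) by g(s + P), so modulo m all blocks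
  have the sum of the first one.\<close>

lemma periodic_sum:
  fixes g :: "nat \<Rightarrow> int"
  assumes per: "\<And>j. m dvd g (j + P) - g j"
  shows "m dvd (\<Sum>j<b + P * n. g j) - (\<Sum>j<b. g j) - int n * (\<Sum>j<P. g j)"
proof -
  have block: "m dvd (\<Sum>j<P. g (s + j)) - (\<Sum>j<P. g j)" for s
  proof (induction s)
    case (Suc s)
    have "(\<Sum>j<P. g (Suc s + j)) + g s = (\<Sum>j<Suc P. g (s + j))"
      by (subst sum.lessThan_Suc_shift) simp
    then have eq: "(\<Sum>j<P. g (Suc s + j)) - (\<Sum>j<P. g j) = ((\<Sum>j<P. g (s + j)) - (\<Sum>j<P. g j)) + (g (s + P) - g s)"
      by simp
    show ?case unfolding eq by (rule dvd_add[OF Suc per])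
  qed simp
  show ?thesis
  proof (induction n)
    case (Suc n)
    have shift: "(\<Sum>j<c + P. g j) = (\<Sum>j<c. g j) + (\<Sum>j<P. g (c + j))" for c
      by (induction P) simp_all
    have "b + P * Suc n = (b + P * n) + P" by simp
    then have "(\<Sum>j<b + P * Suc n. g j) = (\<Sum>j<b + P * n. g j) + (\<Sum>j<P. g ((b + P * n) + j))"
      by (simp only: shift)
    then have eq: "(\<Sum>j<b + P * Suc n. g j) - (\<Sum>j<b. g j) - int (Suc n) * (\<Sum>j<P. g j) =
      ((\<Sum>j<b + P * n. g j) - (\<Sum>j<b. g j) - int n * (\<Sum>j<P. g j)) + ((\<Sum>j<P. g ((b + P * n) + j)) - (\<Sum>j<P. g j))"
      by (simp add: algebra_simps)
    show ?case unfolding eq by (rule dvd_add[OF Suc block])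
  qed simp
qed

text \<open>Changing a changes the sum termwise. Modulo p^L the summands have period p^K in j, so
  lengthening the sum by a multiple of p^(K+L) adds a multiple of p^L full periods, which vanishes
  modulo p^L.\<close>

lemma adic_cont_geo:
  assumes p: "prime p" and f: "adic_cont p (\<lambda>a b. f a)"
  shows "adic_cont p (\<lambda>a b. \<Sum>j<b. f (a * j))"
proof (rule adic_contI)
  fix L
  obtain K where K: "\<And>a a'. int p ^ K dvd int a - int a' \<Longrightarrow> int p ^ L dvd f a - f a'"
    using adic_contE[OF f, of L] by (metis dvd_0_right diff_self)
  have step1: "int p ^ L dvd (\<Sum>j<b. f (a * j)) - (\<Sum>j<b. f (a' * j))" if "int p ^ K dvd int a - int a'" for a a' b
    unfolding sum_subtractf[symmetric]
  proof (rule dvd_sum)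
    fix j
    show "int p ^ L dvd f (a * j) - f (a' * j)"
      using dvd_mult2[OF that, of "int j"] by (intro K) (simp add: left_diff_distrib)
  qed
  have step2: "int p ^ L dvd (\<Sum>j<b'. f (a * j)) - (\<Sum>j<b. f (a * j))"
    if 1: "int p ^ (K + L) dvd int b' - int b" and 2: "b \<le> b'" for a b b'
  proof -
    have "p ^ (K + L) dvd b' - b" using 1 2 by (simp flip: of_nat_diff of_nat_power add: of_nat_dvd_iff)
    then obtain r where "b' - b = p ^ (K + L) * r" by (rule dvdE)
    then have r: "b' = b + p ^ K * (p ^ L * r)"
      using 2 by (simp add: power_add mult.assoc)
    have "int p ^ L dvd f (a * (j + p ^ K)) - f (a * j)" for j
      by (rule K) (simp add: algebra_simps)
    from periodic_sum[of "int p ^ L" "\<lambda>j. f (a * j)" "p ^ K", OF this, of b "p ^ L * r"]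
    have "int p ^ L dvd ((\<Sum>j<b'. f (a * j)) - (\<Sum>j<b. f (a * j)) - int (p ^ L * r) * (\<Sum>j<p ^ K. f (a * j))) +
        int (p ^ L * r) * (\<Sum>j<p ^ K. f (a * j))"
      unfolding r by (intro dvd_add) auto
    then show ?thesis by simp
  qed
  have step3: "int p ^ L dvd (\<Sum>j<b. f (a * j)) - (\<Sum>j<b'. f (a * j))"
    if "int p ^ (K + L) dvd int b - int b'" for a b b'
    using step2[of b b' a] step2[of b' b a] that by (cases "b \<le> b'") (auto simp: dvd_diff_commute)
  show "\<exists>K. \<forall>a a' b b'. int p ^ K dvd int a - int a' \<and> int p ^ K dvd int b - int b' \<longrightarrow>
    int p ^ L dvd (\<Sum>j<b. f (a * j)) - (\<Sum>j<b'. f (a' * j))"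
  proof (intro exI[of _ "K + L"] allI impI, elim conjE)
    fix a a' b b' assume a: "int p ^ (K + L) dvd int a - int a'" and b: "int p ^ (K + L) dvd int b - int b'"
    have "int p ^ K dvd int a - int a'" using a by (rule dvd_trans[rotated]) (simp add: le_imp_power_dvd)
    from dvd_add[OF step1[OF this, of b] step3[OF b, of a']]
    show "int p ^ L dvd (\<Sum>j<b. f (a * j)) - (\<Sum>j<b'. f (a' * j))" by simp
  qed
qed

section \<open>Coefficientwise p-adic continuity of integer power series\<close>

definition fps_cont :: "nat \<Rightarrow> (nat \<Rightarrow> nat \<Rightarrow> int fps) \<Rightarrow> bool" where
  "fps_cont p F \<longleftrightarrow> (\<forall>l. adic_cont p (\<lambda>a b. fps_nth (F a b) l))"

lemma fps_cont_const: "fps_cont p (\<lambda>_ _. c)"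
  by (simp add: fps_cont_def adic_cont_const)

lemma fps_cont_add: "fps_cont p F \<Longrightarrow> fps_cont p G \<Longrightarrow> fps_cont p (\<lambda>a b. F a b + G a b)"
  by (simp add: fps_cont_def adic_cont_add)

lemma fps_cont_diff: "fps_cont p F \<Longrightarrow> fps_cont p G \<Longrightarrow> fps_cont p (\<lambda>a b. F a b - G a b)"
  by (simp add: fps_cont_def adic_cont_diff)

lemma fps_cont_mult: "fps_cont p F \<Longrightarrow> fps_cont p G \<Longrightarrow> fps_cont p (\<lambda>a b. F a b * G a b)"
  unfolding fps_cont_def fps_mult_nth by (intro allI adic_cont_sum adic_cont_mult) auto

lemma fps_cont_power: "fps_cont p F \<Longrightarrow> fps_cont p (\<lambda>a b. F a b ^ (k::nat))"
  by (induction k) (simp_all add: fps_cont_const fps_cont_mult)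

lemma fps_cont_sum: "(\<And>i. i \<in> S \<Longrightarrow> fps_cont p (F i)) \<Longrightarrow> fps_cont p (\<lambda>a b. \<Sum>i\<in>S. F i a b)"
  by (induction S rule: infinite_finite_induct) (auto intro: fps_cont_add fps_cont_const)

lemma fps_nth_of_nat_mult: "fps_nth (of_nat c * F) l = int c * fps_nth (F :: int fps) l"
  by (simp flip: fps_of_nat)

lemma fps_cont_cancel: "prime p \<Longrightarrow> c > 0 \<Longrightarrow> fps_cont p (\<lambda>a b. of_nat c * F a b) \<Longrightarrow> fps_cont p F"
  unfolding fps_cont_def fps_nth_of_nat_mult by (intro allI) (rule adic_cont_cancel, auto)

lemma fps_nth_one_plus_X_power: "fps_nth ((1 + fps_X) ^ n) l = int (n choose l)"
proof (induction n arbitrary: l)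
  case 0
  then show ?case by (cases l) auto
next
  case (Suc n)
  then show ?case by (cases l) (simp_all add: distrib_right)
qed

section \<open>Geometric sums\<close>

text \<open>The quotient (x^m - 1)/(x - 1) without division, hence meaningful when x - 1 is a zero
  divisor.\<close>

definition geo_sum :: "('a, 'm) ring_scheme \<Rightarrow> 'a \<Rightarrow> nat \<Rightarrow> 'a" where
  "geo_sum A x m = (\<Oplus>\<^bsub>A\<^esub>j\<in>{..<m}. x [^]\<^bsub>A\<^esub> j)"

context cring
begin

lemma geo_sum_0 [simp]: "geo_sum R x 0 = \<zero>"
  by (simp add: geo_sum_def)

lemma geo_sum_closed [simp]: "x \<in> carrier R \<Longrightarrow> geo_sum R x m \<in> carrier R"
  unfolding geo_sum_def by (rule finsum_closed) auto

lemma geo_sum_Suc: "x \<in> carrier R \<Longrightarrow> geo_sum R x (Suc m) = x [^] m \<oplus> geo_sum R x m"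
  unfolding geo_sum_def lessThan_Suc by (rule finsum_insert) auto

lemma geo_sum_1: "x \<in> carrier R \<Longrightarrow> geo_sum R x 1 = \<one>"
  using geo_sum_Suc[of x 0] by simp

lemma geo_sum_add:
  assumes x: "x \<in> carrier R"
  shows "geo_sum R x (m + n) = geo_sum R x m \<oplus> x [^] m \<otimes> geo_sum R x n"
proof (induction n)
  case (Suc n)
  then show ?case using x by (simp add: geo_sum_Suc nat_pow_mult[symmetric] r_distr a_ac)
qed (use x in simp)

text \<open>The chain rule (x^a - 1)/(x - 1) times (x^(ab) - 1)/(x^a - 1). It yields the inverses of
  the limits of geometric sums and the relation between Phi_p([q^n]) and Phi_p([q]).\<close>

lemma geo_sum_compose:
  assumes x: "x \<in> carrier R"
  shows "geo_sum R x a \<otimes> geo_sum R (x [^] a) b = geo_sum R x (a * b)"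
proof (induction b)
  case (Suc b)
  have "geo_sum R x (a * Suc b) = geo_sum R x (a * b + a)" by (simp add: add.commute)
  also have "\<dots> = geo_sum R x (a * b) \<oplus> x [^] (a * b) \<otimes> geo_sum R x a" by (rule geo_sum_add[OF x])
  finally show ?case using x Suc by (simp add: geo_sum_Suc r_distr nat_pow_pow m_comm a_comm)
qed (use x in simp)

lemma geo_sum_telescope:
  assumes x: "x \<in> carrier R"
  shows "geo_sum R x m \<otimes> (x \<ominus> \<one>) = x [^] m \<ominus> \<one>"
proof (induction m)
  case (Suc m)
  have "geo_sum R x (Suc m) \<otimes> (x \<ominus> \<one>) = x [^] m \<otimes> (x \<ominus> \<one>) \<oplus> (x [^] m \<ominus> \<one>)"
    using x Suc by (simp add: geo_sum_Suc l_distr)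
  also have "\<dots> = x [^] Suc m \<ominus> \<one>"
  proof -
    have xm: "x [^] m \<in> carrier R" using x by simp
    show ?thesis using x xm by (simp add: minus_eq r_distr r_minus a_assoc r_neg1 r_neg2)
  qed
  finally show ?case .
qed (use x in \<open>simp add: minus_eq r_neg\<close>)

end

lemma (in ring_hom_cring) hom_nat_power: "x \<in> carrier R \<Longrightarrow> h (x [^] (n::nat)) = h x [^]\<^bsub>S\<^esub> n"
  by (induction n) simp_all

lemma (in ring_hom_cring) hom_geo_sum: "x \<in> carrier R \<Longrightarrow> h (geo_sum R x m) = geo_sum S (h x) m"
  by (induction m) (simp_all add: R.geo_sum_Suc S.geo_sum_Suc hom_nat_power)

lemma geo_sum_type_ring: "geo_sum type_ring x m = (\<Sum>j<m. x ^ j)"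
  by (simp add: geo_sum_def)

lemma Phi_q_eq: "Phi_q p A q = geo_sum (witt p A) (teich A q) p"
  by (simp add: Phi_q_def cyclotomic_p_def geo_sum_def)

lemma (in plain_cring) ghost_hom:
  assumes p: "prime p"
  shows "ring_hom_cring (witt p R) R (ghost p R n)"
proof (intro ring_hom_cring.intro ring_hom_cring_axioms.intro cring_witt p cring_axioms ring_hom_memI)
  show "ghost p R n x \<in> carrier R" if "x \<in> carrier (witt p R)" for x
    using that by (simp add: in_witt_iff)
qed (auto simp: ghost_add[OF p] ghost_mult[OF p] ghost_one[OF prime_gt_0_nat[OF p]])

section \<open>Witt vectors depending \<open>p\<close>-adically continuously on exponents\<close>

abbreviation q_pow :: "nat \<Rightarrow> int fps" where
  "q_pow a \<equiv> (1 + fps_X) ^ a"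

text \<open>The Witt vector ([q^(ab)] - 1)/([q^a] - 1) over Z[[q-1]]; for b = p it is
  Phi_p([q^a]).\<close>

definition q_geo :: "nat \<Rightarrow> nat \<Rightarrow> nat \<Rightarrow> nat \<Rightarrow> int fps" where
  "q_geo p a b = geo_sum (witt p type_ring) (teich type_ring (q_pow a)) b"

text \<open>The ghost components are sums of powers of \<open>q\<close>, and a family that becomes continuous after
  multiplication by a power of \<open>p\<close> is continuous.\<close>

lemma fps_cont_q_geo:
  assumes p: "prime p"
  shows "fps_cont p (\<lambda>a b. q_geo p a b n)"
proof (induction n rule: less_induct)
  case (less n)
  interpret T: plain_cring "type_ring :: int fps ring" by (intro plain_cringI cring_type_ring)
  interpret G: ring_hom_cring "witt p type_ring" "type_ring :: int fps ring" "ghost p type_ring n"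
    by (rule T.ghost_hom[OF p])
  have "witt_ghost p n (q_geo p a b) = (\<Sum>j<b. q_pow (p ^ n * (a * j)))" for a b
  proof -
    have "ghost p type_ring n (q_geo p a b) = geo_sum type_ring (ghost p type_ring n (teich type_ring (q_pow a))) b"
      unfolding q_geo_def by (rule G.hom_geo_sum) simp
    also have "\<dots> = (\<Sum>j<b. q_pow (p ^ n * (a * j)))"
      by (simp add: T.ghost_teich prime_gt_0_nat[OF p] geo_sum_type_ring mult_ac flip: power_mult)
    finally show ?thesis by (simp add: ghost_type_ring)
  qed
  moreover have "fps_cont p (\<lambda>a b. \<Sum>j<b. q_pow (p ^ n * (a * j)))"
    unfolding fps_cont_def fps_sum_nth fps_nth_one_plus_X_power
    by (intro allI adic_cont_geo[OF p, where f = "\<lambda>a. int ((p ^ n * a) choose _)"]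
        adic_cont_scale[where f = "\<lambda>a b. int (a choose _)"] adic_cont_binomial p)
  ultimately have "fps_cont p (\<lambda>a b. witt_ghost p n (q_geo p a b) - (\<Sum>i<n. of_nat (p ^ i) * q_geo p a b i ^ (p ^ (n - i))))"
    by (intro fps_cont_diff fps_cont_sum fps_cont_mult fps_cont_const fps_cont_power less) auto
  then have "fps_cont p (\<lambda>a b. of_nat (p ^ n) * q_geo p a b n)"
    by (simp add: ghost_lessThan)
  then show ?case by (rule fps_cont_cancel[OF p, rotated]) (use prime_gt_0_nat[OF p] in simp)
qed

lemma fps_cont_teich_q_pow:
  assumes p: "prime p"
  shows "fps_cont p (\<lambda>a b. teich type_ring (q_pow a) n)"
proof (cases "n = 0")
  case True
  then show ?thesis using adic_cont_binomial[OF p] by (simp add: teich_def fps_cont_def fps_nth_one_plus_X_power)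
next
  case False
  then show ?thesis by (simp add: teich_def fps_cont_const)
qed

section \<open>\<open>p\<close>-adic limits\<close>

definition adic_conv :: "nat \<Rightarrow> (nat \<Rightarrow> int) \<Rightarrow> bool" where
  "adic_conv p c \<longleftrightarrow> (\<forall>L. \<exists>r. \<forall>\<^sub>F k in sequentially. c k mod int p ^ L = r)"

text \<open>The eventual residues are already the normalized representatives that \<open>Zp\<close>
  requires.\<close>

definition adic_lim :: "nat \<Rightarrow> (nat \<Rightarrow> int) \<Rightarrow> padic" where
  "adic_lim p c L = (THE r. \<forall>\<^sub>F k in sequentially. c k mod int p ^ L = r)"

lemma adic_lim_eqI:
  assumes "\<forall>\<^sub>F k in sequentially. c k mod int p ^ L = r"
  shows "adic_lim p c L = r"
  unfolding adic_lim_def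
proof (rule the_equality[where P = "\<lambda>r. \<forall>\<^sub>F k in sequentially. c k mod int p ^ L = r", OF assms])
  fix s assume "\<forall>\<^sub>F k in sequentially. c k mod int p ^ L = s"
  with assms have "\<forall>\<^sub>F k in sequentially. s = r" by eventually_elim simp
  then show "s = r" by simp
qed

lemma eventually_adic_lim:
  assumes "adic_conv p c"
  shows "\<forall>\<^sub>F k in sequentially. c k mod int p ^ L = adic_lim p c L"
proof -
  obtain r where "\<forall>\<^sub>F k in sequentially. c k mod int p ^ L = r" using assms by (auto simp: adic_conv_def)
  then show ?thesis using adic_lim_eqI by blast
qed

lemma adic_lim_closed:
  assumes p: "p > 0" and c: "adic_conv p c"
  shows "adic_lim p c \<in> carrier (Zp p)"
proof -
  have "adic_lim p c L \<in> {0..<int p ^ L} \<and> adic_lim p c (Suc L) mod int p ^ L = adic_lim p c L" for L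
  proof -
    have "\<forall>\<^sub>F k in sequentially. adic_lim p c L \<in> {0..<int p ^ L} \<and> adic_lim p c (Suc L) mod int p ^ L = adic_lim p c L"
      using eventually_adic_lim[OF c, of L] eventually_adic_lim[OF c, of "Suc L"]
    proof eventually_elim
      case (elim k)
      then show ?case using p by (metis atLeastLessThan_iff dvd_triv_right mod_mod_cancel of_nat_0_less_iff
          pos_mod_bound pos_mod_sign power_Suc zero_less_power)
    qed
    then show ?thesis by simp
  qed
  then show ?thesis by (simp add: Zp_def)
qed

text \<open>Evaluation at an index and the p-adic limit are both ring homomorphisms on this ring,
  which reduces limits of Witt vectors to functoriality.\<close>

definition conv_ring :: "nat \<Rightarrow> (nat \<Rightarrow> int) ring" where
  "conv_ring p = \<lparr>carrier = {c. adic_conv p c}, monoid.mult = (\<lambda>c d k. c k * d k), one = (\<lambda>_. 1),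
    zero = (\<lambda>_. 0), add = (\<lambda>c d k. c k + d k)\<rparr>"

lemma conv_ring_simps [simp]:
  "carrier (conv_ring p) = {c. adic_conv p c}" "c \<otimes>\<^bsub>conv_ring p\<^esub> d = (\<lambda>k. c k * d k)"
  "\<one>\<^bsub>conv_ring p\<^esub> = (\<lambda>_. 1)" "\<zero>\<^bsub>conv_ring p\<^esub> = (\<lambda>_. 0)" "c \<oplus>\<^bsub>conv_ring p\<^esub> d = (\<lambda>k. c k + d k)"
  by (simp_all add: conv_ring_def)

lemma adic_conv_const: "adic_conv p (\<lambda>_. c)"
  unfolding adic_conv_def by (intro allI exI always_eventually) (rule refl)

lemma adic_lim_const: "adic_lim p (\<lambda>_. c) = (\<lambda>L. c mod int p ^ L)"
  by (intro ext adic_lim_eqI always_eventually) simp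

lemma
  assumes c: "adic_conv p c" and d: "adic_conv p d"
  shows eventually_adic_lim_add: "\<forall>\<^sub>F k in sequentially. (c k + d k) mod int p ^ L = (adic_lim p c L + adic_lim p d L) mod int p ^ L"
    and eventually_adic_lim_mult: "\<forall>\<^sub>F k in sequentially. (c k * d k) mod int p ^ L = (adic_lim p c L * adic_lim p d L) mod int p ^ L"
proof -
  show "\<forall>\<^sub>F k in sequentially. (c k + d k) mod int p ^ L = (adic_lim p c L + adic_lim p d L) mod int p ^ L"
    using eventually_adic_lim[OF c, of L] eventually_adic_lim[OF d, of L]
    by eventually_elim (metis mod_add_eq)
  show "\<forall>\<^sub>F k in sequentially. (c k * d k) mod int p ^ L = (adic_lim p c L * adic_lim p d L) mod int p ^ L"
    using eventually_adic_lim[OF c, of L] eventually_adic_lim[OF d, of L]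
    by eventually_elim (metis mod_mult_eq)
qed

lemma adic_conv_add: "adic_conv p c \<Longrightarrow> adic_conv p d \<Longrightarrow> adic_conv p (\<lambda>k. c k + d k)"
  unfolding adic_conv_def[of p "\<lambda>k. c k + d k"] using eventually_adic_lim_add by blast

lemma adic_conv_mult: "adic_conv p c \<Longrightarrow> adic_conv p d \<Longrightarrow> adic_conv p (\<lambda>k. c k * d k)"
  unfolding adic_conv_def[of p "\<lambda>k. c k * d k"] using eventually_adic_lim_mult by blast

lemma cring_conv_ring: "cring (conv_ring p)"
proof (rule cringI)
  show "abelian_group (conv_ring p)"
  proof (rule abelian_groupI)
    fix c assume "c \<in> carrier (conv_ring p)"
    then have "adic_conv p (\<lambda>k. (-1) * c k)" by (intro adic_conv_mult adic_conv_const) simp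
    then show "\<exists>d\<in>carrier (conv_ring p). d \<oplus>\<^bsub>conv_ring p\<^esub> c = \<zero>\<^bsub>conv_ring p\<^esub>"
      by (intro bexI[of _ "\<lambda>k. (-1) * c k"]) auto
  qed (auto intro: adic_conv_add adic_conv_const simp: algebra_simps)
  show "comm_monoid (conv_ring p)"
    by (rule comm_monoidI) (auto intro: adic_conv_mult adic_conv_const simp: algebra_simps)
qed (auto simp: algebra_simps)

lemma adic_lim_hom:
  assumes p: "p > 0"
  shows "adic_lim p \<in> ring_hom (conv_ring p) (Zp p)"
proof (rule ring_hom_memI)
  show "adic_lim p c \<in> carrier (Zp p)" if "c \<in> carrier (conv_ring p)" for c
    using that adic_lim_closed[OF p] by simp
qed (auto simp: Zp_simps adic_lim_const intro!: adic_lim_eqI eventually_adic_lim_add eventually_adic_lim_mult)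

lemma conv_ring_finsum:
  assumes "\<And>i. i \<in> S \<Longrightarrow> adic_conv p (c i)" "finite S"
  shows "(\<Oplus>\<^bsub>conv_ring p\<^esub>i\<in>S. c i) k = (\<Sum>i\<in>S. c i k)"
proof -
  interpret cring "conv_ring p" by (rule cring_conv_ring)
  show ?thesis using assms(2,1) by (induction S rule: finite_induct) (simp_all add: Pi_def)
qed

section \<open>Limits of Witt vectors\<close>

text \<open>Reorders the indices, so that a sequence of Witt vectors becomes a single Witt vector
  over power series over \<open>conv_ring\<close>.\<close>

definition witt_seq :: "(nat \<Rightarrow> nat \<Rightarrow> int fps) \<Rightarrow> nat \<Rightarrow> nat \<Rightarrow> nat \<Rightarrow> int" where
  "witt_seq x = (\<lambda>i l k. fps_nth (x k i) l)"

definition witt_conv :: "nat \<Rightarrow> (nat \<Rightarrow> nat \<Rightarrow> int fps) \<Rightarrow> bool" where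
  "witt_conv p x \<longleftrightarrow> (\<forall>i l. adic_conv p (\<lambda>k. fps_nth (x k i) l))"

definition witt_lim :: "nat \<Rightarrow> (nat \<Rightarrow> nat \<Rightarrow> int fps) \<Rightarrow> nat \<Rightarrow> zpq" where
  "witt_lim p x = (\<lambda>i l. adic_lim p (\<lambda>k. fps_nth (x k i) l))"

locale prime_locale =
  fixes p :: nat
  assumes prime: "prime p"
begin

lemma p_pos: "p > 0" by (rule prime_gt_0_nat[OF prime])

abbreviation "CP \<equiv> ps_ring (conv_ring p)"
abbreviation "ZX \<equiv> type_ring :: int fps ring"
abbreviation "WX \<equiv> witt p ZX"
abbreviation "WQ \<equiv> witt p (Zpq p)"

sublocale CP: plain_cring CP
  by (intro plain_cringI plain_cring.cring_ps_ring cring_conv_ring)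
sublocale ZX: plain_cring ZX
  by (intro plain_cringI cring_type_ring)
sublocale ZP: plain_cring "Zp p"
  by (intro plain_cringI cring_Zp p_pos)
sublocale ZQ: plain_cring "Zpq p"
  unfolding Zpq_def by (intro plain_cringI plain_cring.cring_ps_ring cring_Zp p_pos)
sublocale WCP: plain_cring "witt p CP"
  by (intro plain_cringI CP.cring_witt prime)
sublocale WX: plain_cring WX
  by (intro plain_cringI ZX.cring_witt prime)
sublocale WQ: plain_cring WQ
  by (intro plain_cringI ZQ.cring_witt prime)

lemma CP_lim_hom: "plain_ring_hom CP (Zpq p) (\<lambda>f. adic_lim p \<circ> f)"
  unfolding Zpq_def
  by (intro plain_ring_homI plain_ring_hom.ps_ring_hom plain_ring_homI CP.cring_axioms cring_conv_ring
      ZP.cring_axioms adic_lim_hom p_pos plain_cring.cring_ps_ring ZP.plain_cring_axioms)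

lemma CP_at_hom: "plain_ring_hom CP ZX (\<lambda>f. Abs_fps (\<lambda>l. f l k))"
proof (intro plain_ring_homI CP.cring_axioms cring_type_ring ring_hom_memI)
  fix f g assume "f \<in> carrier CP" "g \<in> carrier CP"
  then have fg: "adic_conv p (f i)" "adic_conv p (g i)" for i by (auto simp: ps_ring_simps)
  show "Abs_fps (\<lambda>l. (f \<otimes>\<^bsub>CP\<^esub> g) l k) = Abs_fps (\<lambda>l. f l k) \<otimes>\<^bsub>ZX\<^esub> Abs_fps (\<lambda>l. g l k)"
    by (rule fps_ext) (simp add: ps_ring_simps conv_ring_finsum fg adic_conv_mult fps_mult_nth atLeast0AtMost)
qed (auto simp: ps_ring_simps fps_eq_iff)

sublocale lim: ring_hom_cring "witt p CP" WQ "\<lambda>x. (\<lambda>f. adic_lim p \<circ> f) \<circ> x"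
  by (intro ring_hom_cring.intro WCP.cring_axioms WQ.cring_axioms ring_hom_cring_axioms.intro
      plain_ring_hom.witt_hom CP_lim_hom)

lemma at_hom: "ring_hom_cring (witt p CP) WX (\<lambda>x. (\<lambda>f. Abs_fps (\<lambda>l. f l k)) \<circ> x)"
  by (intro ring_hom_cring.intro WCP.cring_axioms WX.cring_axioms ring_hom_cring_axioms.intro
      plain_ring_hom.witt_hom CP_at_hom)

lemma at_simps:
  assumes "x \<in> carrier (witt p CP)" "y \<in> carrier (witt p CP)"
  shows "(\<lambda>f. Abs_fps (\<lambda>l. f l k)) \<circ> (x \<oplus>\<^bsub>witt p CP\<^esub> y) = ((\<lambda>f. Abs_fps (\<lambda>l. f l k)) \<circ> x) \<oplus>\<^bsub>WX\<^esub> ((\<lambda>f. Abs_fps (\<lambda>l. f l k)) \<circ> y)"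
    "(\<lambda>f. Abs_fps (\<lambda>l. f l k)) \<circ> (x \<otimes>\<^bsub>witt p CP\<^esub> y) = ((\<lambda>f. Abs_fps (\<lambda>l. f l k)) \<circ> x) \<otimes>\<^bsub>WX\<^esub> ((\<lambda>f. Abs_fps (\<lambda>l. f l k)) \<circ> y)"
    "(\<lambda>f. Abs_fps (\<lambda>l. f l k)) \<circ> (x \<ominus>\<^bsub>witt p CP\<^esub> y) = ((\<lambda>f. Abs_fps (\<lambda>l. f l k)) \<circ> x) \<ominus>\<^bsub>WX\<^esub> ((\<lambda>f. Abs_fps (\<lambda>l. f l k)) \<circ> y)"
    "(\<lambda>f. Abs_fps (\<lambda>l. f l k)) \<circ> \<one>\<^bsub>witt p CP\<^esub> = \<one>\<^bsub>WX\<^esub>"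
proof -
  interpret at: ring_hom_cring "witt p CP" WX "\<lambda>x. (\<lambda>f. Abs_fps (\<lambda>l. f l k)) \<circ> x"
    by (rule at_hom)
  show "(\<lambda>f. Abs_fps (\<lambda>l. f l k)) \<circ> (x \<oplus>\<^bsub>witt p CP\<^esub> y) = ((\<lambda>f. Abs_fps (\<lambda>l. f l k)) \<circ> x) \<oplus>\<^bsub>WX\<^esub> ((\<lambda>f. Abs_fps (\<lambda>l. f l k)) \<circ> y)"
    by (rule at.hom_add[OF assms])
  show "(\<lambda>f. Abs_fps (\<lambda>l. f l k)) \<circ> (x \<otimes>\<^bsub>witt p CP\<^esub> y) = ((\<lambda>f. Abs_fps (\<lambda>l. f l k)) \<circ> x) \<otimes>\<^bsub>WX\<^esub> ((\<lambda>f. Abs_fps (\<lambda>l. f l k)) \<circ> y)"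
    by (rule at.hom_mult[OF assms])
  show "(\<lambda>f. Abs_fps (\<lambda>l. f l k)) \<circ> (x \<ominus>\<^bsub>witt p CP\<^esub> y) = ((\<lambda>f. Abs_fps (\<lambda>l. f l k)) \<circ> x) \<ominus>\<^bsub>WX\<^esub> ((\<lambda>f. Abs_fps (\<lambda>l. f l k)) \<circ> y)"
    unfolding WCP.minus_eq WX.minus_eq
    by (simp only: at.hom_add[OF assms(1) WCP.a_inv_closed[OF assms(2)]] at.hom_a_inv[OF assms(2)])
  show "(\<lambda>f. Abs_fps (\<lambda>l. f l k)) \<circ> \<one>\<^bsub>witt p CP\<^esub> = \<one>\<^bsub>WX\<^esub>"
    by (rule at.hom_one)
qed

lemma witt_seq_closed: "witt_seq x \<in> carrier (witt p CP) \<longleftrightarrow> witt_conv p x"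
  by (auto simp: in_witt_iff witt_seq_def witt_conv_def ps_ring_simps)

lemma witt_seq_at: "(\<lambda>f. Abs_fps (\<lambda>l. f l k)) \<circ> witt_seq x = x k"
  by (auto simp: witt_seq_def fps_eq_iff)

text \<open>Evaluations at all indices are jointly injective.\<close>

lemma witt_seq_eqI: "(\<And>k. (\<lambda>f. Abs_fps (\<lambda>l. f l k)) \<circ> X = x k) \<Longrightarrow> X = witt_seq x"
  by (simp add: fun_eq_iff witt_seq_def fps_eq_iff)

lemma witt_lim_eq: "witt_lim p x = (\<lambda>f. adic_lim p \<circ> f) \<circ> witt_seq x"
  by (simp add: witt_lim_def witt_seq_def comp_def)

lemma WX_carrier [simp]: "x \<in> carrier WX"
  by (simp add: in_witt_iff)

text \<open>The operation is performed once over \<open>CP\<close>. Evaluation at each index shows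
  that it represents the sequence of termwise results, and the limit homomorphism gives its
  limit.\<close>

lemma
  assumes x: "witt_conv p x" and y: "witt_conv p y"
  shows witt_conv_add: "witt_conv p (\<lambda>k. x k \<oplus>\<^bsub>WX\<^esub> y k)"
    and witt_lim_add: "witt_lim p (\<lambda>k. x k \<oplus>\<^bsub>WX\<^esub> y k) = witt_lim p x \<oplus>\<^bsub>WQ\<^esub> witt_lim p y"
    and witt_conv_mult: "witt_conv p (\<lambda>k. x k \<otimes>\<^bsub>WX\<^esub> y k)"
    and witt_lim_mult: "witt_lim p (\<lambda>k. x k \<otimes>\<^bsub>WX\<^esub> y k) = witt_lim p x \<otimes>\<^bsub>WQ\<^esub> witt_lim p y"
    and witt_conv_minus: "witt_conv p (\<lambda>k. x k \<ominus>\<^bsub>WX\<^esub> y k)"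
    and witt_lim_minus: "witt_lim p (\<lambda>k. x k \<ominus>\<^bsub>WX\<^esub> y k) = witt_lim p x \<ominus>\<^bsub>WQ\<^esub> witt_lim p y"
proof -
  note xy = x[folded witt_seq_closed] y[folded witt_seq_closed]
  have add: "witt_seq x \<oplus>\<^bsub>witt p CP\<^esub> witt_seq y = witt_seq (\<lambda>k. x k \<oplus>\<^bsub>WX\<^esub> y k)"
    by (rule witt_seq_eqI) (simp only: at_simps[OF xy] witt_seq_at)
  have mult: "witt_seq x \<otimes>\<^bsub>witt p CP\<^esub> witt_seq y = witt_seq (\<lambda>k. x k \<otimes>\<^bsub>WX\<^esub> y k)"
    by (rule witt_seq_eqI) (simp only: at_simps[OF xy] witt_seq_at)
  have minus: "witt_seq x \<ominus>\<^bsub>witt p CP\<^esub> witt_seq y = witt_seq (\<lambda>k. x k \<ominus>\<^bsub>WX\<^esub> y k)"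
    by (rule witt_seq_eqI) (simp only: at_simps[OF xy] witt_seq_at)
  show "witt_conv p (\<lambda>k. x k \<oplus>\<^bsub>WX\<^esub> y k)" "witt_conv p (\<lambda>k. x k \<otimes>\<^bsub>WX\<^esub> y k)" "witt_conv p (\<lambda>k. x k \<ominus>\<^bsub>WX\<^esub> y k)"
    unfolding witt_seq_closed[symmetric] add[symmetric] mult[symmetric] minus[symmetric]
    using xy by simp_all
  show "witt_lim p (\<lambda>k. x k \<oplus>\<^bsub>WX\<^esub> y k) = witt_lim p x \<oplus>\<^bsub>WQ\<^esub> witt_lim p y"
    unfolding witt_lim_eq add[symmetric] by (rule lim.hom_add[OF xy])
  show "witt_lim p (\<lambda>k. x k \<otimes>\<^bsub>WX\<^esub> y k) = witt_lim p x \<otimes>\<^bsub>WQ\<^esub> witt_lim p y"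
    unfolding witt_lim_eq mult[symmetric] by (rule lim.hom_mult[OF xy])
  show "witt_lim p (\<lambda>k. x k \<ominus>\<^bsub>WX\<^esub> y k) = witt_lim p x \<ominus>\<^bsub>WQ\<^esub> witt_lim p y"
    unfolding witt_lim_eq minus[symmetric] WCP.minus_eq WQ.minus_eq
    by (simp only: lim.hom_add[OF xy(1) WCP.a_inv_closed[OF xy(2)]] lim.hom_a_inv[OF xy(2)])
qed

lemma witt_conv_one: "witt_conv p (\<lambda>k. \<one>\<^bsub>WX\<^esub>)"
  and witt_lim_one: "witt_lim p (\<lambda>k. \<one>\<^bsub>WX\<^esub>) = \<one>\<^bsub>WQ\<^esub>"
proof -
  have one: "\<one>\<^bsub>witt p CP\<^esub> = witt_seq (\<lambda>k. \<one>\<^bsub>WX\<^esub>)"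
    by (rule witt_seq_eqI) (rule at_simps(4)[OF WCP.one_closed WCP.one_closed])
  show "witt_conv p (\<lambda>k. \<one>\<^bsub>WX\<^esub>)" unfolding witt_seq_closed[symmetric] one[symmetric] by simp
  show "witt_lim p (\<lambda>k. \<one>\<^bsub>WX\<^esub>) = \<one>\<^bsub>WQ\<^esub>"
    unfolding witt_lim_eq one[symmetric] by (rule lim.hom_one)
qed

lemma witt_lim_closed: "witt_conv p x \<Longrightarrow> witt_lim p x \<in> carrier WQ"
  unfolding witt_lim_eq witt_seq_closed[symmetric] by (rule lim.hom_closed)

lemma witt_lim_geo_sum:
  assumes x: "witt_conv p x"
  shows "witt_lim p (\<lambda>k. geo_sum WX (x k) m) = geo_sum WQ (witt_lim p x) m"
proof -
  have pow: "witt_conv p (\<lambda>k. x k [^]\<^bsub>WX\<^esub> j) \<and> witt_lim p (\<lambda>k. x k [^]\<^bsub>WX\<^esub> j) = witt_lim p x [^]\<^bsub>WQ\<^esub> j" for j :: nat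
    by (induction j) (simp_all add: witt_conv_one witt_lim_one witt_conv_mult witt_lim_mult x)
  \<comment> \<open>The empty sum is written as a difference so that the limit rules for one and
    subtraction apply.\<close>
  have zero: "geo_sum WX (x k) 0 = \<one>\<^bsub>WX\<^esub> \<ominus>\<^bsub>WX\<^esub> \<one>\<^bsub>WX\<^esub>" for k
    by (simp add: WX.minus_eq WX.r_neg)
  have "witt_conv p (\<lambda>k. geo_sum WX (x k) m) \<and> witt_lim p (\<lambda>k. geo_sum WX (x k) m) = geo_sum WQ (witt_lim p x) m"
  proof (induction m)
    case 0
    show ?case unfolding zero
      by (simp add: witt_conv_minus witt_lim_minus witt_conv_one witt_lim_one WQ.minus_eq WQ.r_neg)
  next
    case (Suc m)
    then show ?case using pow
      by (simp add: WX.geo_sum_Suc WQ.geo_sum_Suc witt_lim_closed[OF x] witt_conv_add witt_lim_add)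
  qed
  then show ?thesis ..
qed

definition tends :: "(nat \<Rightarrow> nat) \<Rightarrow> padic \<Rightarrow> bool" where
  "tends \<alpha> a \<longleftrightarrow> a \<in> carrier (Zp p) \<and> (\<forall>L. \<forall>\<^sub>F k in sequentially. int (\<alpha> k) mod int p ^ L = a L)"

text \<open>The residue \<open>r\<close> depends on the limits \<open>a\<close> and \<open>b\<close>
  alone: it is the residue of f at the representatives of their components at level K.\<close>

lemma adic_cont_tends:
  assumes f: "adic_cont p f"
  obtains r where "\<And>\<alpha> \<beta>. tends \<alpha> a \<Longrightarrow> tends \<beta> b \<Longrightarrow> \<forall>\<^sub>F k in sequentially. f (\<alpha> k) (\<beta> k) mod int p ^ L = r"
proof -
  obtain K where K: "\<And>a a' b b'. int p ^ K dvd int a - int a' \<Longrightarrow> int p ^ K dvd int b - int b' \<Longrightarrow>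
    int p ^ L dvd f a b - f a' b'" using adic_contE[OF f, of L] by blast
  have close: "int p ^ K dvd int x - int (nat (a K))" if "int x mod int p ^ K = a K" "a \<in> carrier (Zp p)" for x a
    using that Zp_nonneg[OF that(2), of K] Zp_mod[OF that(2), of K] by (simp add: mod_eq_dvd_iff[symmetric])
  have "\<forall>\<^sub>F k in sequentially. f (\<alpha> k) (\<beta> k) mod int p ^ L = f (nat (a K)) (nat (b K)) mod int p ^ L"
    if "tends \<alpha> a" "tends \<beta> b" for \<alpha> \<beta>
  proof -
    have ab: "a \<in> carrier (Zp p)" "b \<in> carrier (Zp p)" using that by (auto simp: tends_def)
    have "\<forall>\<^sub>F k in sequentially. int (\<alpha> k) mod int p ^ K = a K" "\<forall>\<^sub>F k in sequentially. int (\<beta> k) mod int p ^ K = b K"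
      using that by (auto simp: tends_def)
    then show ?thesis
      by eventually_elim (intro mod_eq_dvd_iff[THEN iffD2] K close ab)
  qed
  then show thesis by (rule that)
qed

lemma adic_cont_conv:
  assumes "adic_cont p f" "tends \<alpha> a" "tends \<beta> b"
  shows "adic_conv p (\<lambda>k. f (\<alpha> k) (\<beta> k))"
  unfolding adic_conv_def using adic_cont_tends[OF assms(1), of a b] assms(2,3) by metis

lemma adic_cont_lim_unique:
  assumes f: "adic_cont p f" and "tends \<alpha> a" "tends \<beta> b" "tends \<alpha>' a" "tends \<beta>' b"
  shows "adic_lim p (\<lambda>k. f (\<alpha> k) (\<beta> k)) = adic_lim p (\<lambda>k. f (\<alpha>' k) (\<beta>' k))"
proof
  fix L
  obtain r where r: "\<And>\<alpha> \<beta>. tends \<alpha> a \<Longrightarrow> tends \<beta> b \<Longrightarrow> \<forall>\<^sub>F k in sequentially. f (\<alpha> k) (\<beta> k) mod int p ^ L = r"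
    using adic_cont_tends[OF f, of a b L] by blast
  show "adic_lim p (\<lambda>k. f (\<alpha> k) (\<beta> k)) L = adic_lim p (\<lambda>k. f (\<alpha>' k) (\<beta>' k)) L"
    using adic_lim_eqI[OF r[OF assms(2,3)]] adic_lim_eqI[OF r[OF assms(4,5)]] by simp
qed

lemma fps_cont_witt_conv:
  assumes "\<And>i. fps_cont p (\<lambda>a b. F a b i)" "tends \<alpha> a" "tends \<beta> b"
  shows "witt_conv p (\<lambda>k. F (\<alpha> k) (\<beta> k))"
  unfolding witt_conv_def using assms(1)
  by (auto simp: fps_cont_def intro!: adic_cont_conv[OF _ assms(2,3), of "\<lambda>a b. fps_nth (F a b _) _"])

lemma fps_cont_witt_lim_unique:
  assumes "\<And>i. fps_cont p (\<lambda>a b. F a b i)" "tends \<alpha> a" "tends \<beta> b" "tends \<alpha>' a" "tends \<beta>' b"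
  shows "witt_lim p (\<lambda>k. F (\<alpha> k) (\<beta> k)) = witt_lim p (\<lambda>k. F (\<alpha>' k) (\<beta>' k))"
  unfolding witt_lim_def using assms(1)
  by (intro ext adic_cont_lim_unique[OF _ assms(2-5), of "\<lambda>a b. fps_nth (F a b _) _"]) (auto simp: fps_cont_def)

lemma tends_const: "tends (\<lambda>_. m) (\<lambda>L. int m mod int p ^ L)"
  unfolding tends_def using Zp_memI[OF p_pos, of "\<lambda>_. int m"] by simp

lemma tends_one: "tends (\<lambda>_. 1) \<one>\<^bsub>Zp p\<^esub>"
  using tends_const[of 1] by (simp add: Zp_simps)

lemma tends_mult: "tends \<alpha> a \<Longrightarrow> tends \<beta> b \<Longrightarrow> tends (\<lambda>k. \<alpha> k * \<beta> k) (a \<otimes>\<^bsub>Zp p\<^esub> b)"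
  unfolding tends_def
proof (intro conjI allI)
  fix L assume *: "a \<in> carrier (Zp p) \<and> (\<forall>L. \<forall>\<^sub>F k in sequentially. int (\<alpha> k) mod int p ^ L = a L)"
    "b \<in> carrier (Zp p) \<and> (\<forall>L. \<forall>\<^sub>F k in sequentially. int (\<beta> k) mod int p ^ L = b L)"
  then have "\<forall>\<^sub>F k in sequentially. int (\<alpha> k) mod int p ^ L = a L" "\<forall>\<^sub>F k in sequentially. int (\<beta> k) mod int p ^ L = b L"
    by auto
  then show "\<forall>\<^sub>F k in sequentially. int (\<alpha> k * \<beta> k) mod int p ^ L = (a \<otimes>\<^bsub>Zp p\<^esub> b) L"
    by eventually_elim (metis Zp_simps(1) mod_mult_eq of_nat_mult)
qed auto

lemma tends_nat: "a \<in> carrier (Zp p) \<Longrightarrow> tends (\<lambda>k. nat (a k)) a"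
  unfolding tends_def eventually_sequentially
  by (intro conjI allI exI impI) (simp_all add: Zp_nonneg, erule Zp_le, assumption)

lemma tends_adic_lim:
  assumes "tends \<alpha> a"
  shows "adic_conv p (\<lambda>k. int (\<alpha> k))" "adic_lim p (\<lambda>k. int (\<alpha> k)) = a"
  using assms unfolding tends_def adic_conv_def by (blast, intro ext adic_lim_eqI, blast)

text \<open>The limit satisfies the defining equation, obtained by passing to the limit in l! (x
  choose l) = x(x-1)...(x-l+1), and the solution is unique because \<open>Zp p\<close> is
  torsion-free.\<close>

lemma padic_binomial_eq:
  assumes \<alpha>: "tends \<alpha> a"
  shows "padic_binomial p a l = adic_lim p (\<lambda>k. int (\<alpha> k choose l))"
proof -
  interpret L: ring_hom_cring "conv_ring p" "Zp p" "adic_lim p"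
    by (intro ring_hom_cring.intro cring_conv_ring ZP.cring_axioms ring_hom_cring_axioms.intro adic_lim_hom p_pos)
  have ac: "a \<in> carrier (Zp p)" using \<alpha> by (simp add: tends_def)
  define c where "c = adic_lim p (\<lambda>k. int (\<alpha> k choose l))"
  have binom: "adic_conv p (\<lambda>k. int (\<alpha> k choose l))"
    using adic_cont_conv[OF adic_cont_binomial[OF prime, of l] \<alpha> \<alpha>] .
  have c: "c \<in> carrier (Zp p)" unfolding c_def using binom adic_lim_closed[OF p_pos] by blast
  have nat: "[m] \<cdot>\<^bsub>Zp p\<^esub> adic_lim p d = adic_lim p (\<lambda>k. int m * d k)" if "adic_conv p d" for m d
    using L.hom_mult[of "\<lambda>_. int m" d] that adic_conv_const[of p "int m"] adic_lim_closed[OF p_pos that]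
    by (simp add: Zp_add_pow_nat p_pos adic_lim_const Zp_simps mod_simps)
  have lin: "adic_conv p (\<lambda>k. int (\<alpha> k) - int j)"
    "adic_lim p (\<lambda>k. int (\<alpha> k) - int j) = a \<ominus>\<^bsub>Zp p\<^esub> [j] \<cdot>\<^bsub>Zp p\<^esub> \<one>\<^bsub>Zp p\<^esub>" for j
  proof -
    show lc: "adic_conv p (\<lambda>k. int (\<alpha> k) - int j)"
      using adic_conv_add[OF tends_adic_lim(1)[OF \<alpha>] adic_conv_const[of p "- int j"]] by simp
    have j: "adic_lim p (\<lambda>_. int j) = [j] \<cdot>\<^bsub>Zp p\<^esub> \<one>\<^bsub>Zp p\<^esub>"
      using nat[OF adic_conv_const[of p 1], of j] L.hom_one by simp
    have "adic_lim p (\<lambda>k. int (\<alpha> k) - int j) \<oplus>\<^bsub>Zp p\<^esub> [j] \<cdot>\<^bsub>Zp p\<^esub> \<one>\<^bsub>Zp p\<^esub> = a"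
      using L.hom_add[of "\<lambda>k. int (\<alpha> k) - int j" "\<lambda>_. int j"] lc adic_conv_const[of p "int j"]
      by (simp add: j tends_adic_lim(2)[OF \<alpha>])
    then show "adic_lim p (\<lambda>k. int (\<alpha> k) - int j) = a \<ominus>\<^bsub>Zp p\<^esub> [j] \<cdot>\<^bsub>Zp p\<^esub> \<one>\<^bsub>Zp p\<^esub>"
      using adic_lim_closed[OF p_pos lc] by (auto simp: ZP.minus_eq ZP.a_assoc ZP.r_neg)
  qed
  have prod: "adic_conv p (\<lambda>k. \<Prod>j<m. int (\<alpha> k) - int j) \<and> adic_lim p (\<lambda>k. \<Prod>j<m. int (\<alpha> k) - int j) =
     (\<Otimes>\<^bsub>Zp p\<^esub>j\<in>{..<m}. a \<ominus>\<^bsub>Zp p\<^esub> [j] \<cdot>\<^bsub>Zp p\<^esub> \<one>\<^bsub>Zp p\<^esub>)" for m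
  proof (induction m)
    case 0
    then show ?case using L.hom_one adic_conv_const[of p 1] by simp
  next
    case (Suc m)
    then have "adic_conv p (\<lambda>k. (int (\<alpha> k) - int m) * (\<Prod>j<m. int (\<alpha> k) - int j))"
      by (intro adic_conv_mult lin) simp
    moreover have "adic_lim p (\<lambda>k. (int (\<alpha> k) - int m) * (\<Prod>j<m. int (\<alpha> k) - int j)) =
      (a \<ominus>\<^bsub>Zp p\<^esub> [m] \<cdot>\<^bsub>Zp p\<^esub> \<one>\<^bsub>Zp p\<^esub>) \<otimes>\<^bsub>Zp p\<^esub> (\<Otimes>\<^bsub>Zp p\<^esub>j\<in>{..<m}. a \<ominus>\<^bsub>Zp p\<^esub> [j] \<cdot>\<^bsub>Zp p\<^esub> \<one>\<^bsub>Zp p\<^esub>)"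
      using L.hom_mult[of "\<lambda>k. int (\<alpha> k) - int m" "\<lambda>k. \<Prod>j<m. int (\<alpha> k) - int j"] Suc lin by simp
    ultimately show ?case using ac by (simp add: lessThan_Suc mult.commute)
  qed
  have eq: "[(fact l :: nat)] \<cdot>\<^bsub>Zp p\<^esub> c = (\<Otimes>\<^bsub>Zp p\<^esub>j\<in>{..<l}. a \<ominus>\<^bsub>Zp p\<^esub> [j] \<cdot>\<^bsub>Zp p\<^esub> \<one>\<^bsub>Zp p\<^esub>)"
    unfolding c_def nat[OF binom] fact_binomial using prod by blast
  show ?thesis unfolding padic_binomial_def c_def[symmetric]
  proof (rule the_equality)
    fix d assume d: "d \<in> carrier (Zp p) \<and> [(fact l :: nat)] \<cdot>\<^bsub>Zp p\<^esub> d =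
      (\<Otimes>\<^bsub>Zp p\<^esub>j\<in>{..<l}. a \<ominus>\<^bsub>Zp p\<^esub> [j] \<cdot>\<^bsub>Zp p\<^esub> \<one>\<^bsub>Zp p\<^esub>)"
    then have dc: "d \<in> carrier (Zp p)" and "[(fact l :: nat)] \<cdot>\<^bsub>Zp p\<^esub> d = [(fact l :: nat)] \<cdot>\<^bsub>Zp p\<^esub> c" using eq by auto
    then have "[(fact l :: nat)] \<cdot>\<^bsub>Zp p\<^esub> (d \<ominus>\<^bsub>Zp p\<^esub> c) = \<zero>\<^bsub>Zp p\<^esub>"
      unfolding ZP.nat_add_pow_minus[OF dc c] using c by (simp add: ZP.minus_eq ZP.r_neg)
    then have "d \<ominus>\<^bsub>Zp p\<^esub> c = \<zero>\<^bsub>Zp p\<^esub>"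
      by (rule Zp_torsion_free[OF prime fact_gt_zero ZP.minus_closed[OF dc c]])
    then show "d = c" by (rule ZP.minus_eq_zeroD[OF dc c])
  qed (use c eq in simp)
qed

end

section \<open>The unit \<open>u\<^sub>n\<close>\<close>

text \<open>Coefficient k of the product is f_0 g_k once all lower coefficients of g are known to
  vanish.\<close>

lemma (in plain_cring) ps_cancel:
  assumes f: "f \<in> carrier (ps_ring R)" and g: "g \<in> carrier (ps_ring R)"
    and f0: "\<And>a. a \<in> carrier R \<Longrightarrow> f 0 \<otimes> a = \<zero> \<Longrightarrow> a = \<zero>"
    and fg: "f \<otimes>\<^bsub>ps_ring R\<^esub> g = \<zero>\<^bsub>ps_ring R\<^esub>"
  shows "g = \<zero>\<^bsub>ps_ring R\<^esub>"
proof -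
  have fc: "f i \<in> carrier R" and gc: "g i \<in> carrier R" for i using f g by (auto simp: ps_ring_simps)
  have "g k = \<zero>" for k
  proof (induction k rule: less_induct)
    case (less k)
    have "(\<Oplus>i\<in>{..k}. f i \<otimes> g (k - i)) = (\<Oplus>i\<in>{..k}. if 0 = i then f 0 \<otimes> g k else \<zero>)"
    proof (rule finsum_cong')
      fix i assume "i \<in> {..k}"
      then show "f i \<otimes> g (k - i) = (if 0 = i then f 0 \<otimes> g k else \<zero>)"
        using less[of "k - i"] fc by auto
    qed (use fc gc in auto)
    also have "\<dots> = f 0 \<otimes> g k" using fc gc by (subst finsum_singleton) auto
    finally have "f 0 \<otimes> g k = \<zero>" using fun_cong[OF fg, of k] by (simp add: ps_ring_simps)
    then show ?case by (rule f0[OF gc])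
  qed
  then show ?thesis by (auto simp: ps_ring_simps)
qed

context prime_locale
begin

abbreviation "Qt a \<equiv> teich ZX (q_pow a)"

lemma Qt_power: "Qt a [^]\<^bsub>WX\<^esub> b = Qt (a * b)"
  using ZX.teich_pow[OF prime, of "q_pow a" b] by (simp flip: power_mult)

lemma q_geo_compose: "q_geo p a b \<otimes>\<^bsub>WX\<^esub> q_geo p (a * b) c = q_geo p a (b * c)"
  using WX.geo_sum_compose[of "Qt a" b c] by (simp add: q_geo_def Qt_power)

lemma q_geo_telescope: "q_geo p a b \<otimes>\<^bsub>WX\<^esub> (Qt a \<ominus>\<^bsub>WX\<^esub> \<one>\<^bsub>WX\<^esub>) = Qt (a * b) \<ominus>\<^bsub>WX\<^esub> \<one>\<^bsub>WX\<^esub>"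
  using WX.geo_sum_telescope[of "Qt a" b] by (simp add: q_geo_def Qt_power)

lemma q_geo_1: "q_geo p a 1 = \<one>\<^bsub>WX\<^esub>"
  using WX.geo_sum_1[of "Qt a"] by (simp add: q_geo_def)

lemma q_geo_conv: "tends \<alpha> a \<Longrightarrow> tends \<beta> b \<Longrightarrow> witt_conv p (\<lambda>k. q_geo p (\<alpha> k) (\<beta> k))"
  by (rule fps_cont_witt_conv[where F = "q_geo p", OF fps_cont_q_geo[OF prime]])

lemma Qt_conv: "tends \<alpha> a \<Longrightarrow> witt_conv p (\<lambda>k. Qt (\<alpha> k))"
  by (rule fps_cont_witt_conv[where F = "\<lambda>a b. Qt a", OF fps_cont_teich_q_pow[OF prime]])

lemma Qt_lim: "tends \<alpha> a \<Longrightarrow> witt_lim p (\<lambda>k. Qt (\<alpha> k)) = teich (Zpq p) (q_gen_pow p a)"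
  by (auto simp: witt_lim_def teich_def q_gen_pow_def padic_binomial_eq fps_nth_one_plus_X_power
      adic_lim_const Zpq_def ps_ring_simps Zp_simps fun_eq_iff)

lemma q_gen_eq: "q_gen_pow p \<one>\<^bsub>Zp p\<^esub> = q_gen p"
proof
  fix l
  have "(1 choose l) = (if l \<le> 1 then 1 else 0)" by (cases l) auto
  then show "q_gen_pow p \<one>\<^bsub>Zp p\<^esub> l = q_gen p l"
    unfolding q_gen_pow_def padic_binomial_eq[OF tends_one] by (auto simp: q_gen_def adic_lim_const Zp_simps)
qed

lemma q_gen_pow_closed:
  assumes "a \<in> carrier (Zp p)"
  shows "q_gen_pow p a \<in> carrier (Zpq p)"
proof -
  have "teich (Zpq p) (q_gen_pow p a) \<in> carrier WQ"
    unfolding Qt_lim[OF tends_nat[OF assms], symmetric] by (rule witt_lim_closed[OF Qt_conv[OF tends_nat[OF assms]]])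
  then show ?thesis using witt_component[of _ p _ 0] by (fastforce simp: teich_def)
qed

lemma Phi_q_lim:
  assumes "tends \<alpha> a"
  shows "Phi_q p (Zpq p) (q_gen_pow p a) = witt_lim p (\<lambda>k. q_geo p (\<alpha> k) p)"
  unfolding Phi_q_eq q_geo_def witt_lim_geo_sum[OF Qt_conv[OF assms]] Qt_lim[OF assms] ..

text \<open>The base ring is torsion-free, so ghost components decide. That of Phi_p([q]) is a
  geometric sum in q^(p^n) with constant coefficient p (its value at q = 1), hence not a zero
  divisor. Uniqueness of u_n rests on this.\<close>

lemma Phi_q_cancel:
  assumes y: "y \<in> carrier WQ" and eq: "Phi_q p (Zpq p) (q_gen p) \<otimes>\<^bsub>WQ\<^esub> y = \<zero>\<^bsub>WQ\<^esub>"
  shows "y = \<zero>\<^bsub>WQ\<^esub>"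
proof (rule ZQ.ghost_inj[where p = p])
  have qc: "q_gen p \<in> carrier (Zpq p)" using q_gen_pow_closed[OF ZP.one_closed] by (simp add: q_gen_eq)
  have tf: "a = \<zero>\<^bsub>Zp p\<^esub>" if "a \<in> carrier (Zp p)" "[p] \<cdot>\<^bsub>Zp p\<^esub> a = \<zero>\<^bsub>Zp p\<^esub>" for a
    using Zp_torsion_free[OF prime p_pos] that by blast
  show "range y \<subseteq> carrier (Zpq p)" using y by (simp add: in_witt_iff)
  show "range \<zero>\<^bsub>WQ\<^esub> \<subseteq> carrier (Zpq p)" using WQ.zero_closed by (simp add: in_witt_iff)
  show "f = \<zero>\<^bsub>Zpq p\<^esub>" if f: "f \<in> carrier (Zpq p)" and "[p] \<cdot>\<^bsub>Zpq p\<^esub> f = \<zero>\<^bsub>Zpq p\<^esub>" for f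
  proof
    fix i
    have "\<zero>\<^bsub>Zpq p\<^esub> i = \<zero>\<^bsub>Zp p\<^esub>" "(g \<oplus>\<^bsub>Zpq p\<^esub> g') i = g i \<oplus>\<^bsub>Zp p\<^esub> g' i" for g g'
      by (simp_all add: Zpq_def ps_ring_simps)
    then have "([m] \<cdot>\<^bsub>Zpq p\<^esub> f) i = [m] \<cdot>\<^bsub>Zp p\<^esub> f i" for m :: nat
      by (induction m) simp_all
    then have "[p] \<cdot>\<^bsub>Zp p\<^esub> f i = \<zero>\<^bsub>Zp p\<^esub>" using that(2) by (metis Zpq_def ps_ring_simps(4))
    then show "f i = \<zero>\<^bsub>Zpq p\<^esub> i" using f tf[of "f i"] by (simp add: Zpq_def ps_ring_simps)
  qed
  fix n
  interpret G: ring_hom_cring WQ "Zpq p" "ghost p (Zpq p) n" by (rule ZQ.ghost_hom[OF prime])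
  have "(\<lambda>f. f 0) \<in> ring_hom (Zpq p) (Zp p)"
    by (rule ring_hom_memI) (simp_all add: Zpq_def ps_ring_simps)
  then interpret C: ring_hom_cring "Zpq p" "Zp p" "\<lambda>f. f 0"
    by (intro ring_hom_cring.intro ZQ.cring_axioms ZP.cring_axioms ring_hom_cring_axioms.intro)
  define g where "g = geo_sum (Zpq p) (q_gen p [^]\<^bsub>Zpq p\<^esub> (p ^ n)) p"
  have "ghost p (Zpq p) n (Phi_q p (Zpq p) (q_gen p)) = g"
    unfolding Phi_q_eq g_def using qc by (simp add: G.hom_geo_sum ZQ.ghost_teich[OF p_pos])
  then have gy: "g \<otimes>\<^bsub>Zpq p\<^esub> ghost p (Zpq p) n y = \<zero>\<^bsub>Zpq p\<^esub>"
    using arg_cong[OF eq, of "ghost p (Zpq p) n"] qc y by (simp add: Phi_q_eq)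
  have g0: "g 0 = [p] \<cdot>\<^bsub>Zp p\<^esub> \<one>\<^bsub>Zp p\<^esub>"
  proof -
    have "q_gen p 0 = \<one>\<^bsub>Zp p\<^esub>" by (simp add: q_gen_def)
    then have "g 0 = geo_sum (Zp p) \<one>\<^bsub>Zp p\<^esub> p"
      unfolding g_def using qc by (simp add: C.hom_geo_sum C.hom_nat_power)
    moreover have "geo_sum (Zp p) \<one>\<^bsub>Zp p\<^esub> m = [m] \<cdot>\<^bsub>Zp p\<^esub> \<one>\<^bsub>Zp p\<^esub>" for m
      by (induction m) (simp_all add: ZP.geo_sum_Suc ZP.a_comm)
    ultimately show ?thesis by simp
  qed
  have gc: "g \<in> carrier (Zpq p)" unfolding g_def using qc by simp
  have "a = \<zero>\<^bsub>Zp p\<^esub>" if "a \<in> carrier (Zp p)" "g 0 \<otimes>\<^bsub>Zp p\<^esub> a = \<zero>\<^bsub>Zp p\<^esub>" for a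
    by (rule tf[OF that(1)]) (simp only: ZP.nat_add_pow_eq[OF that(1)] that(2)[unfolded g0])
  from ZP.ps_cancel[OF gc[unfolded Zpq_def] G.hom_closed[OF y, unfolded Zpq_def] this gy[unfolded Zpq_def]]
  have "ghost p (Zpq p) n y = \<zero>\<^bsub>Zpq p\<^esub>" unfolding Zpq_def .
  then show "ghost p (Zpq p) n y = ghost p (Zpq p) n \<zero>\<^bsub>WQ\<^esub>" by simp
qed

text \<open>With \<open>v = ([q\<^sup>n] - 1)/([q] - 1)\<close> and \<open>v' = ([q\<^sup>p\<^sup>n] - 1)/([q\<^sup>p] - 1)\<close>, both limits of geometric sums,
  \<open>u\<^sub>n = v'/v\<close>. The inverse \<open>w\<close> of \<open>v\<close> is the limit of \<open>([q\<^sup>a\<^sup>b] - 1)/([q\<^sup>a] - 1)\<close> for \<open>a \<rightarrow> n\<close> and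
  \<open>b \<rightarrow> n\<^sup>-\<^sup>1\<close>.\<close>

lemma u_unit:
  assumes n: "n \<in> Units (Zp p)"
  defines "\<alpha> \<equiv> \<lambda>k. nat (n k)"
  shows "u_unit p n \<in> Units WQ"
    and "u_unit p n \<otimes>\<^bsub>WQ\<^esub> (teich (Zpq p) (q_gen_pow p n) \<ominus>\<^bsub>WQ\<^esub> \<one>\<^bsub>WQ\<^esub>) =
      witt_lim p (\<lambda>k. q_geo p p (\<alpha> k) \<otimes>\<^bsub>WX\<^esub> (Qt 1 \<ominus>\<^bsub>WX\<^esub> \<one>\<^bsub>WX\<^esub>))"
proof -
  define n' where "n' = inv\<^bsub>Zp p\<^esub> n"
  define \<beta> where "\<beta> = (\<lambda>k. nat (n' k))"
  have nc: "n \<in> carrier (Zp p)" "n' \<in> carrier (Zp p)" and nn': "n \<otimes>\<^bsub>Zp p\<^esub> n' = \<one>\<^bsub>Zp p\<^esub>"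
    using n by (auto simp: n'_def)
  have \<alpha>: "tends \<alpha> n" and \<beta>: "tends \<beta> n'" unfolding \<alpha>_def \<beta>_def by (intro tends_nat nc)+
  have \<alpha>\<beta>: "tends (\<lambda>k. \<alpha> k * \<beta> k) \<one>\<^bsub>Zp p\<^esub>" using tends_mult[OF \<alpha> \<beta>] by (simp add: nn')
  note one = tends_one
  note pp = tends_const[of p]
  define v v' w w' where "v = witt_lim p (\<lambda>k. q_geo p 1 (\<alpha> k))"
    and "v' = witt_lim p (\<lambda>k. q_geo p p (\<alpha> k))"
    and "w = witt_lim p (\<lambda>k. q_geo p (\<alpha> k) (\<beta> k))"
    and "w' = witt_lim p (\<lambda>k. q_geo p (p * \<alpha> k) (\<beta> k))"
  note conv = q_geo_conv[OF one \<alpha>] q_geo_conv[OF pp \<alpha>] q_geo_conv[OF \<alpha> \<beta>] q_geo_conv[OF tends_mult[OF pp \<alpha>] \<beta>]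
  note closed [simp] = conv[THEN witt_lim_closed, folded v_def v'_def w_def w'_def]
  \<comment> \<open>Since \<open>\<alpha> k * \<beta> k\<close> tends to 1, the limit agrees with
    that of the constant length 1, a sum with the single term 1.\<close>
  have unit: "witt_lim p (\<lambda>k. q_geo p a (\<alpha> k * \<beta> k)) = \<one>\<^bsub>WQ\<^esub>" for a
    using fps_cont_witt_lim_unique[where F = "q_geo p", OF fps_cont_q_geo[OF prime] tends_const[of a] \<alpha>\<beta> tends_const[of a] one]
    by (simp only: q_geo_1 witt_lim_one)
  have vw: "v \<otimes>\<^bsub>WQ\<^esub> w = \<one>\<^bsub>WQ\<^esub>"
    unfolding v_def w_def witt_lim_mult[OF conv(1,3), symmetric]
    using q_geo_compose[of 1] by (simp add: unit)
  have vw': "v' \<otimes>\<^bsub>WQ\<^esub> w' = \<one>\<^bsub>WQ\<^esub>"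
    unfolding v'_def w'_def witt_lim_mult[OF conv(2,4), symmetric] by (simp add: q_geo_compose unit)
  define \<Phi> where "\<Phi> = Phi_q p (Zpq p) (q_gen p)"
  define \<Phi>n where "\<Phi>n = Phi_q p (Zpq p) (q_gen_pow p n)"
  have \<Phi>: "\<Phi> = witt_lim p (\<lambda>k. q_geo p 1 p)" unfolding \<Phi>_def q_gen_eq[symmetric] Phi_q_lim[OF one] ..
  have \<Phi>n: "\<Phi>n = witt_lim p (\<lambda>k. q_geo p (\<alpha> k) p)" unfolding \<Phi>n_def Phi_q_lim[OF \<alpha>] ..
  have \<Phi>c [simp]: "\<Phi> \<in> carrier WQ" unfolding \<Phi> by (rule witt_lim_closed[OF q_geo_conv[OF one pp]])
  have \<Phi>nc [simp]: "\<Phi>n \<in> carrier WQ" unfolding \<Phi>n by (rule witt_lim_closed[OF q_geo_conv[OF \<alpha> pp]])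
  \<comment> \<open>Both products equal ([q^(p \<alpha>)] - 1)/([q] - 1).\<close>
  have "q_geo p p (\<alpha> k) \<otimes>\<^bsub>WX\<^esub> q_geo p 1 p = q_geo p 1 (\<alpha> k) \<otimes>\<^bsub>WX\<^esub> q_geo p (\<alpha> k) p" for k
    using q_geo_compose[of 1 p "\<alpha> k"] q_geo_compose[of 1 "\<alpha> k" p] by (simp add: WX.m_comm mult.commute)
  then have main: "v' \<otimes>\<^bsub>WQ\<^esub> \<Phi> = v \<otimes>\<^bsub>WQ\<^esub> \<Phi>n"
    unfolding \<Phi> \<Phi>n v_def v'_def witt_lim_mult[OF conv(2) q_geo_conv[OF one pp], symmetric]
      witt_lim_mult[OF conv(1) q_geo_conv[OF \<alpha> pp], symmetric] by simp
  define u where "u = v' \<otimes>\<^bsub>WQ\<^esub> w"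
  have uc [simp]: "u \<in> carrier WQ" unfolding u_def by simp
  have "u \<otimes>\<^bsub>WQ\<^esub> (v \<otimes>\<^bsub>WQ\<^esub> w') = (v \<otimes>\<^bsub>WQ\<^esub> w) \<otimes>\<^bsub>WQ\<^esub> (v' \<otimes>\<^bsub>WQ\<^esub> w')"
    unfolding u_def by (simp add: WQ.m_ac)
  then have "u \<otimes>\<^bsub>WQ\<^esub> (v \<otimes>\<^bsub>WQ\<^esub> w') = \<one>\<^bsub>WQ\<^esub>" by (simp add: vw vw')
  then have uU: "u \<in> Units WQ"
    using WQ.m_comm[of u "v \<otimes>\<^bsub>WQ\<^esub> w'"] by (auto simp: Units_def intro!: bexI[of _ "v \<otimes>\<^bsub>WQ\<^esub> w'"])
  have "u \<otimes>\<^bsub>WQ\<^esub> \<Phi> = w \<otimes>\<^bsub>WQ\<^esub> (v' \<otimes>\<^bsub>WQ\<^esub> \<Phi>)" unfolding u_def by (simp add: WQ.m_ac)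
  also have "\<dots> = (v \<otimes>\<^bsub>WQ\<^esub> w) \<otimes>\<^bsub>WQ\<^esub> \<Phi>n" unfolding main by (simp add: WQ.m_ac)
  finally have u\<Phi>: "\<Phi>n = u \<otimes>\<^bsub>WQ\<^esub> \<Phi>" by (simp add: vw)
  have u_eq: "u_unit p n = u" unfolding u_unit_def \<Phi>_def[symmetric] \<Phi>n_def[symmetric]
  proof (rule the_equality)
    show "u \<in> Units WQ \<and> \<Phi>n = u \<otimes>\<^bsub>WQ\<^esub> \<Phi>" using uU u\<Phi> by blast
    fix y assume y: "y \<in> Units WQ \<and> \<Phi>n = y \<otimes>\<^bsub>WQ\<^esub> \<Phi>"
    then have yc: "y \<in> carrier WQ" by (simp add: Units_def)
    have "\<Phi> \<otimes>\<^bsub>WQ\<^esub> (y \<ominus>\<^bsub>WQ\<^esub> u) = y \<otimes>\<^bsub>WQ\<^esub> \<Phi> \<ominus>\<^bsub>WQ\<^esub> u \<otimes>\<^bsub>WQ\<^esub> \<Phi>"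
      using yc by (simp add: WQ.minus_eq WQ.r_distr WQ.r_minus WQ.m_comm)
    also have "\<dots> = \<zero>\<^bsub>WQ\<^esub>" using y u\<Phi> \<Phi>nc by (metis WQ.minus_eq WQ.r_neg)
    finally have "y \<ominus>\<^bsub>WQ\<^esub> u = \<zero>\<^bsub>WQ\<^esub>"
      unfolding \<Phi>_def by (rule Phi_q_cancel[OF WQ.minus_closed[OF yc uc]])
    then show "y = u" by (rule WQ.minus_eq_zeroD[OF yc uc])
  qed
  show "u_unit p n \<in> Units WQ" unfolding u_eq by (rule uU)
  let ?d = "teich (Zpq p) (q_gen_pow p n) \<ominus>\<^bsub>WQ\<^esub> \<one>\<^bsub>WQ\<^esub>"
  have d: "?d = witt_lim p (\<lambda>k. Qt (\<alpha> k) \<ominus>\<^bsub>WX\<^esub> \<one>\<^bsub>WX\<^esub>)"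
    by (simp only: witt_lim_minus[OF Qt_conv[OF \<alpha>] witt_conv_one] Qt_lim[OF \<alpha>] witt_lim_one)
  have dconv: "witt_conv p (\<lambda>k. Qt (\<alpha> k) \<ominus>\<^bsub>WX\<^esub> \<one>\<^bsub>WX\<^esub>)"
    by (rule witt_conv_minus[OF Qt_conv[OF \<alpha>] witt_conv_one])
  have dc: "?d \<in> carrier WQ" unfolding d by (rule witt_lim_closed[OF dconv])
  have econv: "witt_conv p (\<lambda>k. Qt 1 \<ominus>\<^bsub>WX\<^esub> \<one>\<^bsub>WX\<^esub>)"
    by (rule witt_conv_minus[OF Qt_conv[OF one] witt_conv_one])
  \<comment> \<open>Both sides are [q^(\<alpha> \<beta>)] - 1; in the limit this gives w([q^n] - 1)
    = [q] - 1.\<close>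
  have "q_geo p (\<alpha> k) (\<beta> k) \<otimes>\<^bsub>WX\<^esub> (Qt (\<alpha> k) \<ominus>\<^bsub>WX\<^esub> \<one>\<^bsub>WX\<^esub>) =
      q_geo p 1 (\<alpha> k * \<beta> k) \<otimes>\<^bsub>WX\<^esub> (Qt 1 \<ominus>\<^bsub>WX\<^esub> \<one>\<^bsub>WX\<^esub>)" for k
    unfolding q_geo_telescope by simp
  then have "w \<otimes>\<^bsub>WQ\<^esub> ?d = witt_lim p (\<lambda>k. q_geo p 1 (\<alpha> k * \<beta> k) \<otimes>\<^bsub>WX\<^esub> (Qt 1 \<ominus>\<^bsub>WX\<^esub> \<one>\<^bsub>WX\<^esub>))"
    unfolding w_def d witt_lim_mult[OF conv(3) dconv, symmetric] by simp
  also have "\<dots> = witt_lim p (\<lambda>k. Qt 1 \<ominus>\<^bsub>WX\<^esub> \<one>\<^bsub>WX\<^esub>)"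
    unfolding witt_lim_mult[OF q_geo_conv[OF one \<alpha>\<beta>] econv] unit
    by (rule WQ.l_one[OF witt_lim_closed[OF econv]])
  finally have wd: "w \<otimes>\<^bsub>WQ\<^esub> ?d = witt_lim p (\<lambda>k. Qt 1 \<ominus>\<^bsub>WX\<^esub> \<one>\<^bsub>WX\<^esub>)" .
  have "u \<otimes>\<^bsub>WQ\<^esub> ?d = v' \<otimes>\<^bsub>WQ\<^esub> (w \<otimes>\<^bsub>WQ\<^esub> ?d)" unfolding u_def using dc by (simp add: WQ.m_assoc)
  also have "\<dots> = witt_lim p (\<lambda>k. q_geo p p (\<alpha> k) \<otimes>\<^bsub>WX\<^esub> (Qt 1 \<ominus>\<^bsub>WX\<^esub> \<one>\<^bsub>WX\<^esub>))"
    unfolding wd v'_def by (rule witt_lim_mult[OF conv(2) econv, symmetric])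
  finally show "u_unit p n \<otimes>\<^bsub>WQ\<^esub> ?d = witt_lim p (\<lambda>k. q_geo p p (\<alpha> k) \<otimes>\<^bsub>WX\<^esub> (Qt 1 \<ominus>\<^bsub>WX\<^esub> \<one>\<^bsub>WX\<^esub>))"
    unfolding u_eq .
qed

end

section \<open>Specialization at a point of \<open>Q\<close>\<close>

context p_nilpotent
begin

sublocale P: prime_locale p by unfold_locales (rule prime)

text \<open>Only finitely many coefficients enter the value, each only modulo
  \<open>p ^ exponent\<close>, so the approximations eventually agree with the limit
  exactly.\<close>

lemma Zpq_to_lim:
  assumes t: "q \<ominus> \<one> \<in> nilpotents R" and f: "\<And>l. adic_conv p (\<lambda>k. fps_nth (f k) l)"
  shows "\<forall>\<^sub>F k in sequentially. Zpq_to p R q (\<lambda>l. adic_lim p (\<lambda>k. fps_nth (f k) l)) = int_fps_eval (q \<ominus> \<one>) (f k)"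
proof -
  define z where "z = q \<ominus> \<one>"
  obtain N :: nat where zc: "z \<in> carrier R" and N: "z [^] N = \<zero>" using nilpotentsE[OF t] unfolding z_def .
  have "\<forall>\<^sub>F k in sequentially. \<forall>l\<in>{..<N}. fps_nth (f k) l mod int p ^ exponent = adic_lim p (\<lambda>k. fps_nth (f k) l) exponent"
    by (intro eventually_ball_finite ballI eventually_adic_lim f) simp
  then show ?thesis
  proof eventually_elim
    case (elim k)
    have c1: "(\<lambda>i. padic_to p R (adic_lim p (\<lambda>k. fps_nth (f k) i))) \<in> carrier (ps_ring R)"
      by (auto simp: ps_ring_simps padic_to_eq)
    have c2: "(\<lambda>i. [fps_nth (f k) i] \<cdot> \<one>) \<in> carrier (ps_ring R)"
      by (auto simp: ps_ring_simps)
    have "padic_to p R (adic_lim p (\<lambda>k. fps_nth (f k) i)) = [fps_nth (f k) i] \<cdot> \<one>" if "i < N" for i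
      unfolding padic_to_eq using elim that int_mod_exponent[of "fps_nth (f k) i"] by auto
    then show ?case unfolding Zpq_to_def int_fps_eval_def z_def[symmetric] ps_eval_bound[OF c1 zc N] ps_eval_bound[OF c2 zc N]
      using zc by (intro finsum_cong') auto
  qed
qed

lemma int_fps_eval_q_pow:
  assumes a: "a \<in> carrier R" and t: "a \<ominus> \<one> \<in> nilpotents R"
  shows "int_fps_eval (a \<ominus> \<one>) (q_pow m) = a [^] m"
proof -
  interpret type_hom R "int_fps_eval (a \<ominus> \<one>)" by (rule type_homI[OF cring_axioms int_fps_eval_hom[OF t]])
  obtain N :: nat where zc: "a \<ominus> \<one> \<in> carrier R" and "(a \<ominus> \<one>) [^] N = \<zero>" using nilpotentsE[OF t] .
  \<comment> \<open>The shift by two puts the linear term inside the truncation even when N =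
    0.\<close>
  then have N: "(a \<ominus> \<one>) [^] Suc (Suc N) = \<zero>" by simp
  have c: "(\<lambda>i. [fps_nth (fps_X :: int fps) i] \<cdot> \<one>) \<in> carrier (ps_ring R)" by (auto simp: ps_ring_simps)
  have "int_fps_eval (a \<ominus> \<one>) fps_X = (\<Oplus>i\<in>{..<Suc (Suc N)}. if 1 = i then a \<ominus> \<one> else \<zero>)"
    unfolding int_fps_eval_def ps_eval_bound[OF c zc N]
    using zc by (intro finsum_cong') (auto simp: fps_X_def add_pow_int_ge)
  also have "\<dots> = a \<ominus> \<one>" using zc by (subst finsum_singleton) auto
  finally show ?thesis using a by (simp add: h_power h_add h_one add_minus_cancel)
qed

text \<open>In the binomial expansion around 1 only the terms l < N survive, and each coefficient
  matters only modulo \<open>p ^ exponent\<close>.\<close>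

lemma power_adic_cont:
  assumes a: "a \<in> carrier R" and t: "a \<ominus> \<one> \<in> nilpotents R"
  obtains K where "\<And>m m'. int p ^ K dvd int m - int m' \<Longrightarrow> a [^] m = a [^] m'"
proof -
  obtain N :: nat where zc: "a \<ominus> \<one> \<in> carrier R" and N: "(a \<ominus> \<one>) [^] N = \<zero>" using nilpotentsE[OF t] .
  have "\<exists>K. \<forall>m m'. int p ^ K dvd int m - int m' \<longrightarrow> int p ^ exponent dvd int (m choose l) - int (m' choose l)" for l
    using adic_contE[OF adic_cont_binomial[OF prime, of l], of exponent] by metis
  then obtain K where K: "\<And>l m m'. int p ^ K l dvd int m - int m' \<Longrightarrow> int p ^ exponent dvd int (m choose l) - int (m' choose l)"
    by metis
  show thesis
  proof (rule that)
    \<comment> \<open>The sum dominates every \<open>K l\<close> with l < N.\<close>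
    fix m m' assume mm': "int p ^ (\<Sum>l<N. K l) dvd int m - int m'"
    have c: "(\<lambda>i. [fps_nth (q_pow m) i] \<cdot> \<one>) \<in> carrier (ps_ring R)" for m by (auto simp: ps_ring_simps)
    have "[int (m choose l)] \<cdot> \<one> = [int (m' choose l)] \<cdot> \<one>" if "l < N" for l
    proof (rule int_cong_exponent)
      have "K l \<le> (\<Sum>l<N. K l)" using that by (intro member_le_sum) auto
      then have "int p ^ K l dvd int m - int m'" using mm' by (meson dvd_trans le_imp_power_dvd)
      then show "int (m choose l) mod int p ^ exponent = int (m' choose l) mod int p ^ exponent"
        unfolding mod_eq_dvd_iff by (rule K)
    qed
    then have "int_fps_eval (a \<ominus> \<one>) (q_pow m) = int_fps_eval (a \<ominus> \<one>) (q_pow m')"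
      unfolding int_fps_eval_def ps_eval_bound[OF c zc N]
      unfolding fps_nth_one_plus_X_power using zc by (intro finsum_cong') auto
    then show "a [^] m = a [^] m'" by (simp only: int_fps_eval_q_pow[OF a t])
  qed
qed

text \<open>The binomial series for the exponent n is the limit of those for the naturals \<alpha>
  k, which eventually have the same value; \<open>power_adic_cont\<close> then admits every m
  congruent to n.\<close>

lemma padic_pow_eq_power:
  assumes n: "n \<in> carrier (Zp p)" and a: "a \<in> carrier R" and t: "a \<ominus> \<one> \<in> nilpotents R"
  obtains K where "\<And>m. int m mod int p ^ K = n K \<Longrightarrow> padic_pow p R a n = a [^] m"
proof -
  define \<alpha> where "\<alpha> = (\<lambda>k. nat (n k))"
  have \<alpha>: "P.tends \<alpha> n" unfolding \<alpha>_def by (rule P.tends_nat[OF n])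
  obtain K where K: "\<And>m m'. int p ^ K dvd int m - int m' \<Longrightarrow> a [^] m = a [^] m'"
    using power_adic_cont[OF a t] by blast
  have eq: "padic_pow p R a n = Zpq_to p R a (\<lambda>l. adic_lim p (\<lambda>k. fps_nth (q_pow (\<alpha> k)) l))"
    unfolding padic_pow_def Zpq_to_def fps_nth_one_plus_X_power P.padic_binomial_eq[OF \<alpha>] ..
  have "\<forall>\<^sub>F k in sequentially. padic_pow p R a n = a [^] \<alpha> k"
    unfolding eq int_fps_eval_q_pow[OF a t, symmetric]
    by (rule Zpq_to_lim[OF t])
       (simp add: fps_nth_one_plus_X_power P.adic_cont_conv[OF adic_cont_binomial[OF prime] \<alpha> \<alpha>])
  moreover have "\<forall>\<^sub>F k in sequentially. int (\<alpha> k) mod int p ^ K = n K" using \<alpha> by (simp add: P.tends_def)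
  ultimately have "\<forall>\<^sub>F k in sequentially. \<forall>m. int m mod int p ^ K = n K \<longrightarrow> padic_pow p R a n = a [^] m"
    by eventually_elim (metis K mod_eq_dvd_iff)
  then have "\<forall>m. int m mod int p ^ K = n K \<longrightarrow> padic_pow p R a n = a [^] m" by simp
  then show thesis using that by blast
qed

text \<open>The \<open>m\<close>-th power of \<open>\<sigma>(q)\<close> in the fiber of \<open>G\<^sub>Q\<close>: the element \<open>x\<close> with
  \<open>1 + \<Phi>\<^sub>p([q])x = [q]\<^sup>p\<^sup>m\<close>.\<close>

definition sigma_pow :: "'a \<Rightarrow> nat \<Rightarrow> nat \<Rightarrow> 'a" where
  "sigma_pow q m = geo_sum (witt p R) (teich R q [^]\<^bsub>witt p R\<^esub> p) m \<otimes>\<^bsub>witt p R\<^esub> (teich R q \<ominus>\<^bsub>witt p R\<^esub> \<one>\<^bsub>witt p R\<^esub>)"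

abbreviation "WR \<equiv> witt p R"

lemma Q_carrier: "q \<in> Q_points R \<Longrightarrow> q \<in> carrier R"
  by (auto simp: Q_points_def)

lemma teich_in_W [simp]: "q \<in> Q_points R \<Longrightarrow> teich R q \<in> carrier WR"
  using Q_carrier by simp

lemma sigma_pow_closed [simp]: "q \<in> Q_points R \<Longrightarrow> sigma_pow q m \<in> carrier WR"
  by (simp add: sigma_pow_def)

text \<open>The vector [q]^p has order dividing some T = p^M, so T p^L s further terms of the
  geometric sum contribute p^L s copies of one full period, and p^L kills the factor [q] -
  1.\<close>

lemma sigma_pow_periodic:
  assumes q: "q \<in> Q_points R"
  obtains K where "\<And>m m'. int p ^ K dvd int m - int m' \<Longrightarrow> sigma_pow q m = sigma_pow q m'"
proof -
  obtain M where M: "\<And>m m'. int p ^ M dvd int m - int m' \<Longrightarrow> q [^] m = q [^] m'"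
    using power_adic_cont[OF Q_carrier[OF q] Q_pointsD(1)[OF q]] by blast
  obtain L where L: "[(p ^ L)] \<cdot>\<^bsub>WR\<^esub> (teich R q \<ominus>\<^bsub>WR\<^esub> \<one>\<^bsub>WR\<^esub>) = \<zero>\<^bsub>WR\<^esub>"
    using teich_minus_one_torsion[OF q] by blast
  define T where "T = p ^ M"
  define d where "d = teich R q \<ominus>\<^bsub>WR\<^esub> \<one>\<^bsub>WR\<^esub>"
  define x where "x = teich R q [^]\<^bsub>WR\<^esub> p"
  have c: "d \<in> carrier WR" "x \<in> carrier WR" using q by (auto simp: d_def x_def)
  have "x [^]\<^bsub>WR\<^esub> T = teich R (q [^] (p * T))"
    using Q_carrier[OF q] by (simp add: x_def teich_pow[OF prime] W.nat_pow_pow nat_pow_pow)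
  also have "q [^] (p * T) = q [^] (0::nat)" by (rule M) (simp add: T_def)
  finally have xT: "x [^]\<^bsub>WR\<^esub> T = \<one>\<^bsub>WR\<^esub>" by (simp add: witt_simps)
  have geo1: "geo_sum WR \<one>\<^bsub>WR\<^esub> r = [r] \<cdot>\<^bsub>WR\<^esub> \<one>\<^bsub>WR\<^esub>" for r
    by (induction r) (simp_all add: W.geo_sum_Suc W.a_comm)
  have zero: "geo_sum WR x (T * (p ^ L * s)) \<otimes>\<^bsub>WR\<^esub> d = \<zero>\<^bsub>WR\<^esub>" for s
  proof -
    have "[(p ^ L * s)] \<cdot>\<^bsub>WR\<^esub> d = [s] \<cdot>\<^bsub>WR\<^esub> ([(p ^ L)] \<cdot>\<^bsub>WR\<^esub> d)"
      using c by (simp add: W.add.nat_pow_pow)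
    also have "\<dots> = \<zero>\<^bsub>WR\<^esub>" using L by (simp add: d_def)
    finally have 0: "[(p ^ L * s)] \<cdot>\<^bsub>WR\<^esub> \<one>\<^bsub>WR\<^esub> \<otimes>\<^bsub>WR\<^esub> d = \<zero>\<^bsub>WR\<^esub>"
      using c by (simp add: W.add_pow_ldistr)
    have "geo_sum WR x (T * (p ^ L * s)) = geo_sum WR x T \<otimes>\<^bsub>WR\<^esub> [(p ^ L * s)] \<cdot>\<^bsub>WR\<^esub> \<one>\<^bsub>WR\<^esub>"
      using W.geo_sum_compose[OF c(2), of T "p ^ L * s"] by (simp add: xT geo1)
    then show ?thesis using c 0 by (simp add: W.m_assoc)
  qed
  have step: "sigma_pow q m' = sigma_pow q m" if mm': "int p ^ (M + L) dvd int m' - int m" and le: "m \<le> m'" for m m'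
  proof -
    have "p ^ (M + L) dvd m' - m" using mm' le by (simp flip: of_nat_diff of_nat_power add: of_nat_dvd_iff)
    then obtain s where "m' - m = p ^ (M + L) * s" by (rule dvdE)
    then have s: "m' = m + T * (p ^ L * s)" using le by (simp add: T_def power_add mult.assoc)
    have "sigma_pow q m' = geo_sum WR x m \<otimes>\<^bsub>WR\<^esub> d \<oplus>\<^bsub>WR\<^esub> x [^]\<^bsub>WR\<^esub> m \<otimes>\<^bsub>WR\<^esub> (geo_sum WR x (T * (p ^ L * s)) \<otimes>\<^bsub>WR\<^esub> d)"
      unfolding sigma_pow_def x_def[symmetric] d_def[symmetric] s W.geo_sum_add[OF c(2)]
      using c by (simp add: W.l_distr W.m_assoc)
    then show ?thesis
      using c unfolding zero by (simp add: sigma_pow_def x_def[symmetric] d_def[symmetric])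
  qed
  show thesis
  proof (rule that[of "M + L"])
    fix m m' assume "int p ^ (M + L) dvd int m - int m'"
    then show "sigma_pow q m = sigma_pow q m'"
      using step[of m m'] step[of m' m] by (cases "m \<le> m'") (auto simp: dvd_diff_commute)
  qed
qed

text \<open>Over a ring in which \<open>p\<close> is nilpotent, \<open>u\<^sub>n([q\<^sup>n] - 1)\<close> is the \<open>m\<close>-th power of \<open>\<sigma>(q)\<close> for
  every integer \<open>m\<close> close to \<open>n\<close>.\<close>

lemma G_act_sigma_pow:
  assumes n: "n \<in> Units (Zp p)" and q: "q \<in> Q_points R"
  obtains K where "\<And>m. int m mod int p ^ K = n K \<Longrightarrow> G_act p n R (q, sigma_pow q m) = sigma p R (padic_pow p R q n)"
proof -
  have nc: "n \<in> carrier (Zp p)" using n by auto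
  define \<alpha> where "\<alpha> = (\<lambda>k. nat (n k))"
  have \<alpha>: "P.tends \<alpha> n" unfolding \<alpha>_def by (rule P.tends_nat[OF nc])
  have t: "q \<ominus> \<one> \<in> nilpotents R" and qc: "q \<in> carrier R" using Q_pointsD(1)[OF q] Q_carrier[OF q] by auto
  interpret E: plain_ring_hom "Zpq p" R "Zpq_to p R q"
    by (intro plain_ring_homI cring_Zpq cring_axioms Zpq_to_hom q)
  interpret WE: ring_hom_cring P.WQ WR "\<lambda>x. Zpq_to p R q \<circ> x"
    by (intro ring_hom_cring.intro P.WQ.cring_axioms cring_W ring_hom_cring_axioms.intro E.witt_hom)
  interpret e: plain_ring_hom P.ZX R "int_fps_eval (q \<ominus> \<one>)"
    by (intro plain_ring_homI cring_type_ring cring_axioms int_fps_eval_hom t)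
  interpret We: ring_hom_cring P.WX WR "\<lambda>x. int_fps_eval (q \<ominus> \<one>) \<circ> x"
    by (intro ring_hom_cring.intro P.WX.cring_axioms cring_W ring_hom_cring_axioms.intro e.witt_hom)
  obtain K where K: "\<And>m m'. int p ^ K dvd int m - int m' \<Longrightarrow> sigma_pow q m = sigma_pow q m'"
    using sigma_pow_periodic[OF q] by blast
  \<comment> \<open>Its limit is u_n([q^n] - 1) by \<open>u_unit\<close>, while its k-th term
    specializes to a power of sigma(q).\<close>
  define Y where "Y = (\<lambda>k. q_geo p p (\<alpha> k) \<otimes>\<^bsub>P.WX\<^esub> (P.Qt 1 \<ominus>\<^bsub>P.WX\<^esub> \<one>\<^bsub>P.WX\<^esub>))"
  have Y: "witt_conv p Y" unfolding Y_def
    by (intro P.witt_conv_mult P.witt_conv_minus P.q_geo_conv[OF P.tends_const \<alpha>] P.Qt_conv[OF P.tends_one] P.witt_conv_one)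
  have Qt: "int_fps_eval (q \<ominus> \<one>) \<circ> P.Qt a = teich R (q [^] a)" for a
    by (subst e.hom_teich) (simp_all add: int_fps_eval_q_pow[OF qc t])
  have Qt1: "int_fps_eval (q \<ominus> \<one>) \<circ> P.Qt 1 = teich R q" unfolding Qt using qc by simp
  have eY: "int_fps_eval (q \<ominus> \<one>) \<circ> Y k = sigma_pow q (\<alpha> k)" for k
  proof -
    have "int_fps_eval (q \<ominus> \<one>) \<circ> q_geo p p (\<alpha> k) = geo_sum WR (teich R (q [^] p)) (\<alpha> k)"
      unfolding q_geo_def by (subst We.hom_geo_sum) (simp_all add: Qt)
    moreover have "int_fps_eval (q \<ominus> \<one>) \<circ> (P.Qt 1 \<ominus>\<^bsub>P.WX\<^esub> \<one>\<^bsub>P.WX\<^esub>) = teich R q \<ominus>\<^bsub>WR\<^esub> \<one>\<^bsub>WR\<^esub>"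
      unfolding P.WX.minus_eq W.minus_eq
      by (simp only: We.hom_add We.hom_a_inv We.hom_one P.WX_carrier Qt1)
    ultimately show ?thesis unfolding Y_def sigma_pow_def
      by (simp only: We.hom_mult P.WX_carrier teich_pow[OF prime qc])
  qed
  \<comment> \<open>The index from which a component agrees with the limit may depend on i. The
    exponent K does not, so one m serves all components.\<close>
  have lim: "Zpq_to p R q \<circ> witt_lim p Y = sigma_pow q m" if m: "int m mod int p ^ K = n K" for m
  proof
    fix i
    have "\<forall>\<^sub>F k in sequentially. Zpq_to p R q (witt_lim p Y i) = int_fps_eval (q \<ominus> \<one>) (Y k i)"
      unfolding witt_lim_def using Y by (intro Zpq_to_lim[OF t]) (simp add: witt_conv_def)
    moreover have "\<forall>\<^sub>F k in sequentially. int (\<alpha> k) mod int p ^ K = n K" using \<alpha> by (simp add: P.tends_def)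
    ultimately have "\<forall>\<^sub>F k in sequentially. Zpq_to p R q (witt_lim p Y i) = sigma_pow q m i"
    proof eventually_elim
      case (elim k)
      have "sigma_pow q (\<alpha> k) = sigma_pow q m" using elim(2) m by (intro K) (simp flip: mod_eq_dvd_iff)
      then show ?case using elim(1) fun_cong[OF eY, of k i] by simp
    qed
    then show "(Zpq_to p R q \<circ> witt_lim p Y) i = sigma_pow q m i" by simp
  qed
  let ?u = "u_unit p n"
  let ?d = "teich (Zpq p) (q_gen_pow p n) \<ominus>\<^bsub>P.WQ\<^esub> \<one>\<^bsub>P.WQ\<^esub>"
  have u: "?u \<in> Units P.WQ" "?u \<otimes>\<^bsub>P.WQ\<^esub> ?d = witt_lim p Y"
    using P.u_unit[OF n] by (simp_all only: Y_def \<alpha>_def)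
  have qn: "q_gen_pow p n \<in> carrier (Zpq p)" by (rule P.q_gen_pow_closed[OF nc])
  have dc: "?d \<in> carrier P.WQ" using qn by simp
  have uc: "?u \<in> carrier P.WQ" "inv\<^bsub>P.WQ\<^esub> ?u \<in> carrier P.WQ" using u(1) by auto
  have "Zpq_to p R q (q_gen_pow p n) = padic_pow p R q n"
    by (simp add: Zpq_to_def padic_pow_def q_gen_pow_def)
  then have Ed: "Zpq_to p R q \<circ> ?d = teich R (padic_pow p R q n) \<ominus>\<^bsub>WR\<^esub> \<one>\<^bsub>WR\<^esub>"
    unfolding P.WQ.minus_eq W.minus_eq using E.hom_teich[OF qn] P.ZQ.teich_closed[OF qn, of p]
    by (simp only: WE.hom_add WE.hom_a_inv WE.hom_one P.WQ.a_inv_closed P.WQ.one_closed)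
  show thesis
  proof (rule that[of K])
    fix m assume m: "int m mod int p ^ K = n K"
    have "(Zpq_to p R q \<circ> inv\<^bsub>P.WQ\<^esub> ?u) \<otimes>\<^bsub>WR\<^esub> sigma_pow q m = Zpq_to p R q \<circ> (inv\<^bsub>P.WQ\<^esub> ?u \<otimes>\<^bsub>P.WQ\<^esub> (?u \<otimes>\<^bsub>P.WQ\<^esub> ?d))"
      unfolding lim[OF m, symmetric] u(2)[symmetric]
      using uc dc by (simp only: WE.hom_mult P.WQ.m_closed)
    also have "inv\<^bsub>P.WQ\<^esub> ?u \<otimes>\<^bsub>P.WQ\<^esub> (?u \<otimes>\<^bsub>P.WQ\<^esub> ?d) = ?d"
      using uc dc u(1) by (simp flip: P.WQ.m_assoc)
    finally show "G_act p n R (q, sigma_pow q m) = sigma p R (padic_pow p R q n)"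
      unfolding Ed by (simp only: G_act_def sigma_def prod.case)
  qed
qed

lemma Phi_q_mult_sigma:
  assumes q: "q \<in> Q_points R"
  shows "Phi_q p R q \<otimes>\<^bsub>WR\<^esub> (teich R q \<ominus>\<^bsub>WR\<^esub> \<one>\<^bsub>WR\<^esub>) = teich R q [^]\<^bsub>WR\<^esub> p \<ominus>\<^bsub>WR\<^esub> \<one>\<^bsub>WR\<^esub>"
  unfolding Phi_q_eq by (rule W.geo_sum_telescope) (use q in simp)

text \<open>Two telescopings, Phi_p([q])([q] - 1) = [q]^p - 1 and then the geometric sum in [q]^p,
  leave [q]^(pm), the Teichmueller representative of a unit.\<close>

lemma sigma_pow_in_G:
  assumes q: "q \<in> Q_points R"
  shows "(q, sigma_pow q m) \<in> G_points p R"
proof -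
  define x d g where "x = teich R q [^]\<^bsub>WR\<^esub> p" and "d = teich R q \<ominus>\<^bsub>WR\<^esub> \<one>\<^bsub>WR\<^esub>" and "g = geo_sum WR x m"
  have c: "x \<in> carrier WR" "d \<in> carrier WR" "g \<in> carrier WR" "Phi_q p R q \<in> carrier WR"
    using q by (auto simp: x_def d_def g_def Phi_q_eq)
  have "Phi_q p R q \<otimes>\<^bsub>WR\<^esub> sigma_pow q m = g \<otimes>\<^bsub>WR\<^esub> (Phi_q p R q \<otimes>\<^bsub>WR\<^esub> d)"
    unfolding sigma_pow_def x_def[symmetric] d_def[symmetric] g_def[symmetric] using c by (simp add: W.m_ac)
  also have "\<dots> = x [^]\<^bsub>WR\<^esub> m \<ominus>\<^bsub>WR\<^esub> \<one>\<^bsub>WR\<^esub>"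
    unfolding d_def Phi_q_mult_sigma[OF q] x_def[symmetric] g_def by (rule W.geo_sum_telescope[OF c(1)])
  finally have "\<one>\<^bsub>WR\<^esub> \<oplus>\<^bsub>WR\<^esub> Phi_q p R q \<otimes>\<^bsub>WR\<^esub> sigma_pow q m = x [^]\<^bsub>WR\<^esub> m"
    using c by (simp add: W.add_minus_cancel)
  also have "\<dots> = teich R (q [^] (p * m))"
    using Q_carrier[OF q] by (simp add: x_def teich_pow[OF prime] W.nat_pow_pow nat_pow_pow)
  finally have "\<one>\<^bsub>WR\<^esub> \<oplus>\<^bsub>WR\<^esub> Phi_q p R q \<otimes>\<^bsub>WR\<^esub> sigma_pow q m = teich R (q [^] (p * m))" .
  moreover have "q [^] k \<in> Units R" for k :: nat
    using Q_pointsD(2)[OF q] by (induction k) auto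
  ultimately show ?thesis using q by (simp add: G_points_def)
qed

lemma sigma_pow_1: "q \<in> Q_points R \<Longrightarrow> sigma_pow q 1 = snd (sigma p R q)"
  unfolding sigma_pow_def sigma_def by (subst W.geo_sum_1) simp_all

text \<open>With d = [q] - 1 the correction term of the group law is ([q]^(pm) - 1)d, which turns
  the added d into the next summand [q]^(pm) d.\<close>

lemma sigma_pow_Suc:
  assumes q: "q \<in> Q_points R"
  shows "sigma_pow q (Suc m) = sigma_pow q m \<otimes>\<^bsub>G_fiber p R q\<^esub> sigma_pow q 1"
proof -
  define x d g where "x = teich R q [^]\<^bsub>WR\<^esub> p" and "d = teich R q \<ominus>\<^bsub>WR\<^esub> \<one>\<^bsub>WR\<^esub>" and "g = geo_sum WR x m"
  have c: "x \<in> carrier WR" "d \<in> carrier WR" "g \<in> carrier WR" "Phi_q p R q \<in> carrier WR"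
    using q by (auto simp: x_def d_def g_def Phi_q_eq)
  have s1: "sigma_pow q 1 = d" using sigma_pow_1[OF q] by (simp add: sigma_def d_def)
  have s: "sigma_pow q m = g \<otimes>\<^bsub>WR\<^esub> d" by (simp add: sigma_pow_def x_def d_def g_def)
  have "Phi_q p R q \<otimes>\<^bsub>WR\<^esub> (g \<otimes>\<^bsub>WR\<^esub> d \<otimes>\<^bsub>WR\<^esub> d) = (g \<otimes>\<^bsub>WR\<^esub> (Phi_q p R q \<otimes>\<^bsub>WR\<^esub> d)) \<otimes>\<^bsub>WR\<^esub> d"
    using c by (simp add: W.m_ac)
  also have "g \<otimes>\<^bsub>WR\<^esub> (Phi_q p R q \<otimes>\<^bsub>WR\<^esub> d) = x [^]\<^bsub>WR\<^esub> m \<ominus>\<^bsub>WR\<^esub> \<one>\<^bsub>WR\<^esub>"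
    unfolding d_def Phi_q_mult_sigma[OF q] x_def[symmetric] g_def by (rule W.geo_sum_telescope[OF c(1)])
  finally have "sigma_pow q m \<otimes>\<^bsub>G_fiber p R q\<^esub> sigma_pow q 1 =
      g \<otimes>\<^bsub>WR\<^esub> d \<oplus>\<^bsub>WR\<^esub> d \<oplus>\<^bsub>WR\<^esub> (x [^]\<^bsub>WR\<^esub> m \<ominus>\<^bsub>WR\<^esub> \<one>\<^bsub>WR\<^esub>) \<otimes>\<^bsub>WR\<^esub> d"
    unfolding s1 s by (simp add: G_fiber_def)
  also have "\<dots> = (g \<oplus>\<^bsub>WR\<^esub> \<one>\<^bsub>WR\<^esub> \<oplus>\<^bsub>WR\<^esub> (x [^]\<^bsub>WR\<^esub> m \<ominus>\<^bsub>WR\<^esub> \<one>\<^bsub>WR\<^esub>)) \<otimes>\<^bsub>WR\<^esub> d"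
    using c by (simp add: W.l_distr)
  also have "g \<oplus>\<^bsub>WR\<^esub> \<one>\<^bsub>WR\<^esub> \<oplus>\<^bsub>WR\<^esub> (x [^]\<^bsub>WR\<^esub> m \<ominus>\<^bsub>WR\<^esub> \<one>\<^bsub>WR\<^esub>) = geo_sum WR x (Suc m)"
    unfolding W.geo_sum_Suc[OF c(1)] g_def[symmetric] using c
    by (simp add: W.minus_eq W.a_ac W.r_neg)
  finally show ?thesis by (simp add: sigma_pow_def x_def d_def)
qed

section \<open>Characters of the formal group near the origin\<close>

lemma H_fiber_one: "\<one>\<^bsub>H_fiber p F R q\<^esub> = \<zero>"
  by (simp add: H_fiber_def)

text \<open>A homomorphism sends the neutral point 0 to 1, and the value of a series at 0 is its
  constant coefficient.\<close>

lemma H_dual_at_zero: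
  assumes F: "comm_group (H_fiber p F R q)" and f: "f \<in> carrier (H_dual_fiber p F R q)"
  shows "f 0 = \<one>"
proof -
  have fc: "f \<in> carrier (ps_ring R)" using f by (simp add: H_dual_fiber_def)
  \<comment> \<open>The multiplicativity condition is applied to \<open>R\<close> as an algebra over
    itself.\<close>
  have "ps_eval R (id \<circ> f) \<in> hom (H_fiber p F R (id q)) (units_of R)"
    using f p_nil id_ring_hom[of R] by (simp add: H_dual_fiber_def del: id_apply id_comp)
  then have "ps_eval R f \<in> hom (H_fiber p F R q) (units_of R)" by simp
  then have "ps_eval R f \<one>\<^bsub>H_fiber p F R q\<^esub> = \<one>\<^bsub>units_of R\<^esub>"
    using F by (intro hom_one) (auto simp: units_group comm_group_def)
  then have 1: "ps_eval R f \<zero> = \<one>" by (simp add: H_fiber_one units_of_one)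
  have "\<zero> [^] (1::nat) = \<zero>" by simp
  then have "\<zero> \<in> nilpotents R" unfolding nilpotents_def by blast
  from ps_eval_eq[OF fc this] show ?thesis using 1 fc by (auto simp: ps_ring_simps)
qed

lemma nilpotents_mult:
  assumes "z \<in> nilpotents R" "c \<in> carrier R"
  shows "z \<otimes> c \<in> nilpotents R"
proof -
  obtain N :: nat where z: "z \<in> carrier R" "z [^] N = \<zero>" using nilpotentsE[OF assms(1)] .
  then have "(z \<otimes> c) [^] N = \<zero>" using assms(2) by (simp add: nat_pow_distrib)
  then show ?thesis unfolding nilpotents_def using z assms(2) by auto
qed

end

theorem proposition2p11p3:
  fixes p :: nat
    and F :: fglaw
    and \<eta> :: "'a ring \<Rightarrow> 'a \<times> (nat \<Rightarrow> 'a) \<Rightarrow> (nat \<Rightarrow> 'a)"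
    and act :: "padic \<Rightarrow> 'a ring \<Rightarrow> 'a \<times> 'a \<Rightarrow> 'a \<times> 'a"
  assumes "prime p"
    and "formal_group_Q TYPE('a) p F"
    and "cartier_duality p F \<eta>"
    and "dual_action p F \<eta> act"
  shows "\<forall>n \<in> Units (Zp p). \<forall>A :: 'a ring. p_nilpotent_ring p A \<longrightarrow>
    (\<forall>h \<in> H_points A. sigma_star p \<eta> A (act n A h) = GmQ_act p n A (sigma_star p \<eta> A h))"
proof (intro ballI allI impI)
  fix n and A :: "'a ring" and h
  assume n: "n \<in> Units (Zp p)" and A: "p_nilpotent_ring p A" and h: "h \<in> H_points A"
  interpret p_nilpotent A p
    by (intro p_nilpotent.intro plain_cringI p_nilpotent_axioms.intro assms(1) A)
       (use A in \<open>simp add: p_nilpotent_ring_def\<close>)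
  obtain q z where qz: "h = (q, z)" by (cases h)
  have q: "q \<in> Q_points A" and z: "z \<in> nilpotents A" using h by (auto simp: qz H_points_def)
  have nc: "n \<in> carrier (Zp p)" using n by auto
  define qn where "qn = padic_pow p A q n"
  define f where "f m = \<eta> A (q, sigma_pow q m)" for m
  define a where "a = ps_eval A (f 1) z"
  have iso: "(\<lambda>x. \<eta> A (q, x)) \<in> iso (G_fiber p A q) (H_dual_fiber p F A q)"
    using assms(3) A q by (simp add: cartier_duality_def)
  have G: "sigma_pow q m \<in> carrier (G_fiber p A q)" for m
    using sigma_pow_in_G[OF q] by (simp add: G_fiber_def)
  have fH: "f m \<in> carrier (H_dual_fiber p F A q)" for m
    using hom_in_carrier[OF iso_imp_homomorphism[OF iso] G] by (simp add: f_def)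
  then have fc: "f m \<in> carrier (ps_ring A)" for m by (simp add: H_dual_fiber_def)
  have f_Suc: "f (Suc m) = f m \<otimes>\<^bsub>ps_ring A\<^esub> f 1" for m
    unfolding f_def sigma_pow_Suc[OF q] using hom_mult[OF iso_imp_homomorphism[OF iso] G G]
    by (simp add: H_dual_fiber_def)
  \<comment> \<open>The induction starts at \<open>f 1\<close>, the character attached to sigma(q),
    so exponents are written as successors.\<close>
  have power: "ps_eval A (f (Suc m)) z = a [^]\<^bsub>A\<^esub> Suc m" for m
  proof (induction m)
    case 0
    have "a \<in> carrier A" unfolding a_def using ring_hom_closed[OF ps_eval_hom[OF z] fc] .
    then show ?case by (simp add: a_def)
  next
    case (Suc m)
    have "ps_eval A (f (Suc (Suc m))) z = ps_eval A (f (Suc m)) z \<otimes>\<^bsub>A\<^esub> a"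
      unfolding f_Suc[of "Suc m"] a_def by (rule ring_hom_mult[OF ps_eval_hom[OF z] fc fc])
    then show ?case unfolding Suc by simp
  qed
  have "comm_group (H_fiber p F A q)" using assms(2) A q by (simp add: formal_group_Q_def)
  \<comment> \<open>The character is 1 at the origin, so its value \<open>a\<close> at the nilpotent
    z is 1 plus a nilpotent; the binomial series for \<open>a\<close> to the power n therefore makes
    sense.\<close>
  then have "f 1 0 = \<one>\<^bsub>A\<^esub>" using H_dual_at_zero fH by blast
  then obtain c where c: "c \<in> carrier A" and "a = \<one>\<^bsub>A\<^esub> \<oplus>\<^bsub>A\<^esub> z \<otimes>\<^bsub>A\<^esub> c"
    unfolding a_def using ps_eval_eq[OF fc z, of 1] by auto
  moreover have zc: "z \<otimes>\<^bsub>A\<^esub> c \<in> nilpotents A" by (rule nilpotents_mult[OF z c])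
  moreover have "z \<otimes>\<^bsub>A\<^esub> c \<in> carrier A" using zc by (simp add: nilpotents_def)
  ultimately have ac: "a \<in> carrier A" and a1: "a \<ominus>\<^bsub>A\<^esub> \<one>\<^bsub>A\<^esub> \<in> nilpotents A"
    by (simp_all add: add_minus_cancel)
  obtain K1 where K1: "\<And>m. int m mod int p ^ K1 = n K1 \<Longrightarrow> G_act p n A (q, sigma_pow q m) = sigma p A qn"
    using G_act_sigma_pow[OF n q] unfolding qn_def by blast
  obtain K2 where K2: "\<And>m. int m mod int p ^ K2 = n K2 \<Longrightarrow> padic_pow p A a n = a [^]\<^bsub>A\<^esub> m"
    using padic_pow_eq_power[OF nc ac a1] by blast
  define K where "K = K1 + K2"
  \<comment> \<open>The component \<open>n K\<close> approximates n well enough for both K1 and K2;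
    adding p^K keeps the residues and makes the exponent positive.\<close>
  define m where "m = nat (n K) + p ^ K"
  have m: "int m mod int p ^ k = n k" if "k \<le> K" for k
  proof -
    have "int p ^ k dvd int p ^ K" using that by (rule le_imp_power_dvd)
    then have "int m mod int p ^ k = n K mod int p ^ k"
      using Zp_nonneg[OF nc, of K] by (auto simp: m_def elim!: dvdE)
    then show ?thesis using Zp_le[OF nc that] by simp
  qed
  have "m > 0" using p_pos by (simp add: m_def)
  then obtain m0 where m0: "m = Suc m0" using gr0_implies_Suc by blast
  note dual = assms(4)[unfolded dual_action_def]
  have act: "fst (act n A (q, z)) = qn"
    using dual[THEN conjunct1, rule_format, of n A q z] n A h by (simp add: qz qn_def)
  \<comment> \<open>Invariance is applied to the m-th power of sigma(q), which the action carries to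
    sigma at q^n.\<close>
  have inv: "pairing \<eta> A (G_act p n A (q, sigma_pow q m)) (act n A (q, z)) = pairing \<eta> A (q, sigma_pow q m) (q, z)"
    using dual[THEN conjunct2, THEN conjunct2, THEN conjunct2, THEN conjunct2, THEN conjunct2, rule_format, of n A q "sigma_pow q m" z]
      n A h sigma_pow_in_G[OF q, of m] by (simp add: qz)
  have "pairing \<eta> A (sigma p A qn) (act n A (q, z)) = a [^]\<^bsub>A\<^esub> m"
    using inv K1[OF m[of K1]] power[of m0] by (simp add: K_def m0 pairing_def f_def)
  also have "\<dots> = padic_pow p A a n" using K2[OF m[of K2]] by (simp add: K_def)
  also have "a = pairing \<eta> A (sigma p A q) (q, z)"
    unfolding a_def f_def pairing_def sigma_pow_1[OF q] by (simp add: sigma_def)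
  finally show "sigma_star p \<eta> A (act n A h) = GmQ_act p n A (sigma_star p \<eta> A h)"
    unfolding qz by (simp add: sigma_star_def GmQ_act_def act qn_def)
qed

end
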